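(* Let $\mathfrak n\lhd A$ with $\deg(\mathfrak n)=3$. (i) If $\mathfrak n$ is not a product of three distinct monic polynomials of degree one, then $\mathbb T(\mathfrak n)=\mathbb T(\mathfrak n)^0$. (ii) The pairing $\mathbb T(\mathfrak n)\times\mathcal H_0(\mathfrak n,\mathbb Z)\to\mathbb Z$, $(t,f)\mapsto (f|t)^\ast(1)$, is perfect; in particular it induces an isomorphism of $\mathbb T(\mathfrak n)$-modules $\mathbb T(\mathfrak n)\cong \mathrm{Hom}(\mathcal H_0(\mathfrak n,\mathbb Z),\mathbb Z)$. (iii) The Hecke operators $T_\mathfrak p$ with $\mathfrak p$ prime of degree $1$ span $\mathbb T(\mathfrak n)$ as a $\mathbb Z$-module.
   Context: Let $q$ be a power of a prime $p$, $A=\mathbb{F}_q[T]$, $F_\infty=\mathbb{F}_q((\pi))$ with $\pi=T^{-1}$, $\mathcal O_\infty=\mathbb F_q[[\pi]]$. Ideals of $A$ are identified with monic generators; $|\mathfrak n|=\#A/\mathfrak n$. $\Gamma_0(\mathfrak n)=\{\begin{pmatrix}a&b\\c&d\end{pmatrix}\in \mathrm{GL}_2(A): c\in\mathfrak n\}$. $\mathscr T$ is the Bruhat–Tits tree of $\mathrm{PGL}_2(F_\infty)$ with oriented edges $\mathrm{GL}_2(F_\infty)/Z(F_\infty)\mathcal I_\infty$ ($\mathcal I_\infty$ the Iwahori subgroup), reversal $e\mapsto\bar e$ by right multiplication by $\begin{pmatrix}0&1\\ \pi&0\end{pmatrix}$, left action of $\mathrm{GL}_2(F_\infty)$, and $(f|\gamma)(e)=f(\gamma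 e)$. A harmonic cochain is $f:E(\mathscr T)\to R$ with $f(\bar e)=-f(e)$ and $\sum_{t(e)=v}f(e)=0$ for all vertices $v$; $\mathcal H_0(\mathfrak n,\mathbb Z)$ is the group of $\Gamma_0(\mathfrak n)$-invariant $\mathbb Z$-valued harmonic cochains with finite support modulo $\Gamma_0(\mathfrak n)$. Hecke operators: $f|T_\mathfrak m=\sum f|\begin{pmatrix}a&b\\0&d\end{pmatrix}$ over $a,b,d\in A$, $a,d$ monic, $(ad)=\mathfrak m$, $(a)+\mathfrak n=A$, $\deg b<\deg d$. $\mathbb T(\mathfrak n)\subseteq\mathrm{End}_{\mathbb Z}(\mathcal H_0(\mathfrak n,\mathbb Z))$ is generated by all $T_\mathfrak m$, and $\mathbb T(\mathfrak n)^0$ by the $T_\mathfrak m$ with $\mathfrak m$ coprime to $\mathfrak n$. Fourier coefficients: fix a nontrivial character $\eta_0:\mathbb F_p\to\mathbb C^\times$ and let $\eta(\sum a_i\pi^i)=\eta_0(\mathrm{Tr}_{\mathbb F_q/\mathbb F_p}(a_1))$; for $\mathfrak m\lhd A$, $f^\ast(\mathfrak m)=q^{-1-\deg\mathfrak m}\sum_{u\in(\pi)/(\pi^{2+\deg\mathfrak m})} f\left(\begin{pmatrix}\pi^{2+\deg\mathfrak m}&u\\0&1\end{pmatrix}\right)\eta(-\mathfrak m u)$. $\mathbb T(\mathfrak n)$ acts on $\mathrm{Hom}(\mathcal H_0(\mathfrak n,\mathbb Z),\mathbb Z)$ by $(t\varphi)(f)=\varphi(f|t)$. *)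

theory Defs
  imports
    "HOL-Algebra.Generated_Rings"
    "HOL-Algebra.Elementary_Groups"
    "HOL-Analysis.Cartesian_Space"
    "HOL-Computational_Algebra.Computational_Algebra"
begin

text \<open>
  The field \<open>\<bbbF>\<^sub>q\<close> is a type \<open>'k\<close> of class \<^class>\<open>finite_field\<close>, so \<open>q = CARD('k)\<close> and
  \<open>p = CHAR('k)\<close>. Further, \<open>A = 'k poly\<close>, \<open>F\<^sub>\<infinity> = 'k fls\<close> with \<open>\<pi> = fls_X\<close>, and
  \<open>\<O>\<^sub>\<infinity> = 'k fps\<close>. Nonzero ideals of \<open>A\<close> are given by their monic generators.
\<close>

section \<open>Matrix groups\<close>

text \<open>The embedding of \<open>A\<close> into \<open>F\<^sub>\<infinity>\<close>: evaluation at \<open>T = \<pi>\<^sup>-\<^sup>1\<close>.\<close>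

definition A_to_Finf :: "'k::finite_field poly \<Rightarrow> 'k fls" where
  "A_to_Finf a = poly (map_poly fls_const a) fls_X_inv"

definition mat2 :: "'a::zero \<Rightarrow> 'a \<Rightarrow> 'a \<Rightarrow> 'a \<Rightarrow> 'a^2^2" where
  "mat2 a b c d = vector [vector [a, b], vector [c, d]]"

definition GL2_Finf :: "('k::finite_field fls^2^2) set" where
  "GL2_Finf = {g. invertible g}"

definition GL2_Oinf :: "('k::finite_field fls^2^2) set" where
  "GL2_Oinf = map_matrix fps_to_fls ` {k. invertible k}"

definition Iwahori :: "('k::finite_field fls^2^2) set" where
  "Iwahori = map_matrix fps_to_fls ` {k. invertible k \<and> fps_X dvd k $ 2 $ 1}"

definition Gamma0 :: "'k::finite_field poly \<Rightarrow> ('k fls^2^2) set" where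
  "Gamma0 n = map_matrix A_to_Finf ` {g. invertible g \<and> n dvd g $ 2 $ 1}"

section \<open>The Bruhat--Tits tree\<close>

definition edge_class :: "'k::finite_field fls^2^2 \<Rightarrow> ('k fls^2^2) set" where
  "edge_class g = {g ** mat z ** k | z k. z \<noteq> 0 \<and> k \<in> Iwahori}"

definition vertex_class :: "'k::finite_field fls^2^2 \<Rightarrow> ('k fls^2^2) set" where
  "vertex_class g = {g ** mat z ** k | z k. z \<noteq> 0 \<and> k \<in> GL2_Oinf}"

definition tree_edges :: "('k::finite_field fls^2^2) set set" where
  "tree_edges = edge_class ` GL2_Finf"

definition tree_vertices :: "('k::finite_field fls^2^2) set set" where
  "tree_vertices = vertex_class ` GL2_Finf"

definition edge_rev :: "('k::finite_field fls^2^2) set \<Rightarrow> ('k fls^2^2) set" where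
  "edge_rev e = (\<lambda>h. h ** mat2 0 1 fls_X 0) ` e"

text \<open>The origin of an edge is its image under the canonical map
  \<open>GL\<^sub>2(F\<^sub>\<infinity>)/Z(F\<^sub>\<infinity>)\<I>\<^sub>\<infinity> \<rightarrow> GL\<^sub>2(F\<^sub>\<infinity>)/Z(F\<^sub>\<infinity>)GL\<^sub>2(\<O>\<^sub>\<infinity>)\<close>. (The opposite convention
  yields the same harmonic cochains, because these are alternating.)\<close>

definition edge_origin :: "('k::finite_field fls^2^2) set \<Rightarrow> ('k fls^2^2) set" where
  "edge_origin e = {h ** k | h k. h \<in> e \<and> k \<in> GL2_Oinf}"

definition edge_terminus :: "('k::finite_field fls^2^2) set \<Rightarrow> ('k fls^2^2) set" where
  "edge_terminus e = edge_origin (edge_rev e)"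

definition edge_act ::
    "'k::finite_field fls^2^2 \<Rightarrow> ('k fls^2^2) set \<Rightarrow> ('k fls^2^2) set" where
  "edge_act g e = (\<lambda>h. g ** h) ` e"

section \<open>Harmonic cochains\<close>

text \<open>Functions on the set of edges are encoded as functions that vanish on all arguments
  that are not edges.\<close>

type_synonym ('k, 'r) cochain = "('k fls^2^2) set \<Rightarrow> 'r"

definition harmonic_cochain :: "('k::finite_field, 'r::comm_ring_1) cochain \<Rightarrow> bool" where
  "harmonic_cochain f \<longleftrightarrow>
     (\<forall>e. e \<notin> tree_edges \<longrightarrow> f e = 0) \<and>
     (\<forall>e\<in>tree_edges. f (edge_rev e) = - f e) \<and>
     (\<forall>v\<in>tree_vertices. (\<Sum>e | e \<in> tree_edges \<and> edge_terminus e = v. f e) = 0)"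

definition slash ::
    "('k::finite_field, 'r) cochain \<Rightarrow> 'k fls^2^2 \<Rightarrow> ('k, 'r) cochain" where
  "slash f g = (\<lambda>e. f (edge_act g e))"

definition finite_support_mod ::
    "('k::finite_field fls^2^2) set \<Rightarrow> ('k, 'r::zero) cochain \<Rightarrow> bool" where
  "finite_support_mod G f \<longleftrightarrow>
     finite ((\<lambda>e. (\<lambda>g. edge_act g e) ` G) ` {e \<in> tree_edges. f e \<noteq> 0})"

definition H0 :: "'k::finite_field poly \<Rightarrow> ('k, int) cochain monoid" where
  "H0 n = \<lparr>carrier = {f. harmonic_cochain f \<and> (\<forall>g\<in>Gamma0 n. slash f g = f) \<and>
                         finite_support_mod (Gamma0 n) f},
           monoid.mult = (\<lambda>f g e. f e + g e), one = (\<lambda>e. 0)\<rparr>"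

section \<open>Hecke operators\<close>

text \<open>The condition \<open>b = 0\<close> accounts for \<^term>\<open>degree 0 = 0\<close>: the zero polynomial is
  always an admissible \<open>b\<close>.\<close>

definition hecke_index :: "'k::finite_field poly \<Rightarrow> 'k poly \<Rightarrow> ('k poly \<times> 'k poly \<times> 'k poly) set"
  where "hecke_index n m =
    {(a, b, d). lead_coeff a = 1 \<and> lead_coeff d = 1 \<and> a * d = m \<and> coprime a n \<and>
                (b = 0 \<or> degree b < degree d)}"

definition hecke_op ::
    "'k::finite_field poly \<Rightarrow> 'k poly \<Rightarrow> ('k, int) cochain \<Rightarrow> ('k, int) cochain" where
  "hecke_op n m f = (\<lambda>e. \<Sum>(a, b, d)\<in>hecke_index n m.
     slash f (mat2 (A_to_Finf a) (A_to_Finf b) 0 (A_to_Finf d)) e)"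

text \<open>The endomorphism ring of an abelian group \<open>G\<close>, acting from the right:
  \<open>f|(s t) = (f|s)|t\<close>.\<close>

definition End_ring :: "'a monoid \<Rightarrow> ('a \<Rightarrow> 'a) ring" where
  "End_ring G = \<lparr>carrier = hom G G \<inter> extensional (carrier G),
     monoid.mult = (\<lambda>s t. \<lambda>f\<in>carrier G. t (s f)),
     one = (\<lambda>f\<in>carrier G. f),
     ring.zero = (\<lambda>f\<in>carrier G. \<one>\<^bsub>G\<^esub>),
     add = (\<lambda>s t. \<lambda>f\<in>carrier G. s f \<otimes>\<^bsub>G\<^esub> t f)\<rparr>"

definition hecke_T :: "'k::finite_field poly \<Rightarrow> 'k poly \<Rightarrow> ('k, int) cochain \<Rightarrow> ('k, int) cochain"
  where "hecke_T n m = (\<lambda>f\<in>carrier (H0 n). hecke_op n m f)"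

definition hecke_algebra ::
    "'k::finite_field poly \<Rightarrow> (('k, int) cochain \<Rightarrow> ('k, int) cochain) ring" where
  "hecke_algebra n = (End_ring (H0 n))\<lparr>carrier :=
     generate_ring (End_ring (H0 n)) {hecke_T n m | m. lead_coeff m = 1}\<rparr>"

definition hecke_algebra0 ::
    "'k::finite_field poly \<Rightarrow> (('k, int) cochain \<Rightarrow> ('k, int) cochain) ring" where
  "hecke_algebra0 n = (End_ring (H0 n))\<lparr>carrier :=
     generate_ring (End_ring (H0 n)) {hecke_T n m | m. lead_coeff m = 1 \<and> coprime m n}\<rparr>"

section \<open>Fourier coefficients\<close>

text \<open>The trace of \<open>\<bbbF>\<^sub>q\<close> over its prime field, as the sum of the conjugates
  \<open>x\<^bsup>p\<^sup>i\<^esup>\<close>; its values are taken in the prime field inside \<open>'k\<close>.\<close>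

definition abs_trace :: "'k::finite_field \<Rightarrow> 'k" where
  "abs_trace x = (\<Sum>i < (THE r. CARD('k) = CHAR('k) ^ r). x ^ (CHAR('k) ^ i))"

definition prime_subfield :: "'k::finite_field set" where
  "prime_subfield = range of_int"

definition nontrivial_character :: "('k::finite_field \<Rightarrow> complex) \<Rightarrow> bool" where
  "nontrivial_character \<eta>0 \<longleftrightarrow>
     (\<forall>x\<in>prime_subfield. \<eta>0 x \<noteq> 0) \<and>
     (\<forall>x\<in>prime_subfield. \<forall>y\<in>prime_subfield. \<eta>0 (x + y) = \<eta>0 x * \<eta>0 y) \<and>
     (\<exists>x\<in>prime_subfield. \<eta>0 x \<noteq> 1)"

definition eta_character :: "('k::finite_field \<Rightarrow> complex) \<Rightarrow> 'k fls \<Rightarrow> complex" where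
  "eta_character \<eta>0 x = \<eta>0 (abs_trace (fls_nth x 1))"

text \<open>Representatives of \<open>(\<pi>)/(\<pi>\<^sup>k)\<close>: the sums of \<open>c\<^sub>i \<pi>\<^sup>i\<close> over \<open>1 \<le> i < k\<close>.\<close>

definition pi_reps :: "nat \<Rightarrow> 'k::finite_field fls set" where
  "pi_reps k = {u. \<forall>i. fls_nth u i \<noteq> 0 \<longrightarrow> 1 \<le> i \<and> i < int k}"

definition fourier_coeff ::
    "('k::finite_field \<Rightarrow> complex) \<Rightarrow> ('k, int) cochain \<Rightarrow> 'k poly \<Rightarrow> complex" where
  "fourier_coeff \<eta>0 f m =
     1 / of_nat (CARD('k) ^ (1 + degree m)) *
     (\<Sum>u\<in>pi_reps (2 + degree m).
        of_int (f (edge_class (mat2 (fls_X ^ (2 + degree m)) u 0 1))) *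
        eta_character \<eta>0 (- (A_to_Finf m * u)))"

section \<open>Duality\<close>

text \<open>\<open>Hom(G, \<int>)\<close>\<close>

definition dual_group :: "('a, 'b) monoid_scheme \<Rightarrow> ('a \<Rightarrow> int) monoid" where
  "dual_group G = \<lparr>carrier = hom G integer_group \<inter> extensional (carrier G),
     monoid.mult = (\<lambda>\<phi> \<psi>. \<lambda>x\<in>carrier G. \<phi> x + \<psi> x),
     one = (\<lambda>x\<in>carrier G. 0)\<rparr>"

definition dual_act :: "('a, 'b) monoid_scheme \<Rightarrow> ('a \<Rightarrow> 'a) \<Rightarrow> ('a \<Rightarrow> int) \<Rightarrow> ('a \<Rightarrow> int)" where
  "dual_act G t \<phi> = (\<lambda>x\<in>carrier G. \<phi> (t x))"

definition perfect_pairing ::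
    "('a, 'c) monoid_scheme \<Rightarrow> ('b, 'd) monoid_scheme \<Rightarrow> ('a \<Rightarrow> 'b \<Rightarrow> int) \<Rightarrow> bool" where
  "perfect_pairing M N B \<longleftrightarrow>
     (\<lambda>x. \<lambda>y\<in>carrier N. B x y) \<in> iso M (dual_group N) \<and>
     (\<lambda>y. \<lambda>x\<in>carrier M. B x y) \<in> iso N (dual_group M)"

text \<open>The integer \<open>(f|t)\<^sup>*(1)\<close>; meaningful once this Fourier coefficient is known to be
  integral.\<close>

definition hecke_pairing ::
    "('k::finite_field \<Rightarrow> complex) \<Rightarrow> (('k, int) cochain \<Rightarrow> ('k, int) cochain) \<Rightarrow>
     ('k, int) cochain \<Rightarrow> int" where
  "hecke_pairing \<eta>0 t f = (THE k. of_int k = fourier_coeff \<eta>0 (t f) 1)"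

end

theory Submission
  imports Defs "HOL-Analysis.Determinants" "HOL-Number_Theory.Cong"
begin

unbundle no Formal_Power_Series.fps_syntax

text \<open>
  A cochain in \<open>\<H>\<^sub>0(\<nn>, \<int>)\<close> is determined by its values on the \<open>GL\<^sub>2(A)\<close>-translates of the
  standard edge, i.e. by a function of bottom rows \<open>(c : d) \<in> P\<^sup>1(A/\<nn>)\<close>. As \<open>deg \<nn> = 3\<close>, almost
  every such point has a representative with entries of degree at most one, and the harmonicity
  relations together with the vanishing along cusps express all values as integral combinations
  of \<open>x\<^sub>s = f(\<pi>\<^sup>3, \<pi> + s\<pi>\<^sup>2)\<close>, \<open>s \<in> \<bbbF>\<^sub>q\<close>. A computation with upper triangular matrices gives
  \<open>x\<^sub>s = (f|T\<^sub>P)\<^sup>*(1)\<close> for \<open>P = T - s\<close>. Hence \<open>f \<mapsto> (x\<^sub>s)\<close> embeds \<open>\<H>\<^sub>0(\<nn>, \<int>)\<close> as a saturated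
  sublattice of \<open>\<int>\<^sup>q\<close>, and duality, the perfect pairing and the spanning by the \<open>T\<^sub>P\<close> follow
  because all Hecke operators commute with the \<open>T\<^sub>P\<close>. Finally \<open>1 = - \<Sum> T\<^sub>P\<close>, and \<open>T\<^sub>P = 0\<close> when
  \<open>P\<^sup>2\<close> divides \<open>\<nn>\<close>, so at most one simple linear factor of \<open>\<nn>\<close> is harmless.
\<close>

subsection \<open>Two by two matrices\<close>

text \<open>Commutation with the \<open>T_P\<close> suffices because the coordinate of
  \<open>f|t\<close> at \<open>P\<close> is the first Fourier coefficient of
  \<open>f|t|T_P = f|T_P|t\<close>: an operator \<open>t\<close> is known once the functional
  sending \<open>f\<close> to the first coefficient of \<open>f|t\<close> is known. Saturation gives
  surjectivity: a functional on a saturated sublattice of Z^q extends to Z^q, so it is an integral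
  combination of coordinates, and the same combination of the \<open>T_P\<close> induces it. The
  obstacle is formed by the points of P^1(A/n) whose short vector is a multiple of a linear factor
  of n. There the relations determine values only after multiplication by q - 1 or q, and
  integrality survives because these factors cancel. Injectivity and saturation are proved as one
  statement: an integer m dividing all coordinates of f divides every value of f. The case m = 0 is
  injectivity. Finite support modulo \<open>Gamma0 n\<close> is hard to verify directly for
  quotients f/m and for Hecke images. It is replaced by finiteness of the set of values, which is
  equivalent for invariant harmonic cochains.\<close>

lemma mat2_nth [simp]:
  "mat2 a b c d $ 1 $ 1 = a" "mat2 a b c d $ 1 $ 2 = b"
  "mat2 a b c d $ 2 $ 1 = c" "mat2 a b c d $ 2 $ 2 = d"
  by (simp_all add: mat2_def)

lemma mat2_eta: "g = mat2 (g$1$1) (g$1$2) (g$2$1) (g$2$2)"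
  by (simp add: vec_eq_iff forall_2)

lemma mat2_cases: obtains a b c d where "g = mat2 a b c d"
  using mat2_eta by blast

lemma mat2_eq_iff [simp]:
  "mat2 a b c d = mat2 a' b' c' d' \<longleftrightarrow> a = a' \<and> b = b' \<and> c = c' \<and> d = d'"
  by (metis mat2_nth)

lemma mat2_mult:
  "mat2 a b c d ** mat2 a' b' c' d' =
   mat2 (a * a' + b * c') (a * b' + b * d') (c * a' + d * c') (c * b' + d * d')"
  for a :: "'a :: semiring_1"
  by (simp add: vec_eq_iff forall_2 matrix_matrix_mult_def sum_2)

lemma mat_eq_mat2: "mat z = mat2 z 0 0 z"
  by (simp add: vec_eq_iff forall_2 mat_def)

lemma map_matrix_mat2: "map_matrix f (mat2 a b c d) = mat2 (f a) (f b) (f c) (f d)"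
  by (simp add: vec_eq_iff forall_2 map_matrix_def)

lemma det_mat2: "det (mat2 a b c d) = a * d - b * c" for a :: "'a :: comm_ring_1"
  by (simp add: det_2)

lemma invertible_mat2_iff:
  "invertible (mat2 a b c d) \<longleftrightarrow> (a * d - b * c) dvd 1" for a :: "'a :: comm_ring_1"
proof
  assume "invertible (mat2 a b c d)"
  then obtain B where "mat2 a b c d ** B = mat 1"
    by (auto simp: invertible_def)
  then have "det (mat2 a b c d) * det B = 1"
    by (metis det_I det_mul)
  then show "(a * d - b * c) dvd 1"
    unfolding det_mat2 by (metis dvdI)
next
  assume "(a * d - b * c) dvd 1"
  then obtain e where e: "1 = (a * d - b * c) * e"
    by (auto elim: dvdE)
  have "mat2 a b c d ** mat2 (d * e) (- b * e) (- c * e) (a * e) = mat 1"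
       "mat2 (d * e) (- b * e) (- c * e) (a * e) ** mat2 a b c d = mat 1"
    using e by (auto simp: mat2_mult mat_eq_mat2 algebra_simps)
  then show "invertible (mat2 a b c d)"
    by (auto simp: invertible_def)
qed

lemma invertible_mat2_field_iff:
  "invertible (mat2 a b c d) \<longleftrightarrow> a * d - b * c \<noteq> 0" for a :: "'a :: field"
  by (simp add: invertible_mat2_iff dvd_field_iff)

lemma invertible_mult_iff:
  "invertible (a ** b) \<longleftrightarrow> invertible a \<and> invertible b" for a b :: "'a::field^'n^'n"
  unfolding invertible_det_nz det_mul by simp

lemma mat_mult_commute: "mat z ** g = g ** mat z" for z :: "'a :: comm_semiring_1"
  by (simp add: matrix_matrix_mult_def mat_def vec_eq_iff if_distrib[of "\<lambda>x. x * _"]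
      if_distrib[of "\<lambda>x. _ * x"] mult.commute cong: if_cong)

lemma mat_mult_mat: "mat z ** mat z' = mat (z * z')" for z :: "'a :: semiring_1"
  by (simp add: matrix_matrix_mult_def mat_def vec_eq_iff if_distrib[of "\<lambda>x. x * _"]
      if_distrib[of "\<lambda>x. _ * x"] cong: if_cong)

subsection \<open>Laurent series and the embedding of polynomials\<close>

text \<open>The fractional ideal generated by \<pi>^k. As a condition on coefficients it needs no
  exception for 0, whose \<open>fls_subdegree\<close> is the default value 0.\<close>

definition val_ge :: "int \<Rightarrow> 'k::field fls set" where
  "val_ge k = {x. \<forall>i<k. fls_nth x i = 0}"

lemma val_geI: "(\<And>i. i < k \<Longrightarrow> fls_nth x i = 0) \<Longrightarrow> x \<in> val_ge k"
  by (simp add: val_ge_def)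

lemma val_geD: "x \<in> val_ge k \<Longrightarrow> i < k \<Longrightarrow> fls_nth x i = 0"
  by (simp add: val_ge_def)

lemma val_ge_iff: "x \<in> val_ge k \<longleftrightarrow> x = 0 \<or> k \<le> fls_subdegree x"
proof (cases "x = 0")
  case False
  then show ?thesis
    using fls_subdegree_geI[of x k] by (auto simp: val_ge_def)
qed (simp add: val_ge_def)

lemma val_ge_0 [simp]: "0 \<in> val_ge k"
  and val_ge_1 [simp]: "1 \<in> val_ge 0"
  and val_ge_const [simp]: "fls_const c \<in> val_ge 0"
  and val_ge_X [simp]: "fls_X \<in> val_ge 1"
  by (auto simp: val_ge_def)

lemma val_ge_add: "x \<in> val_ge k \<Longrightarrow> y \<in> val_ge k \<Longrightarrow> x + y \<in> val_ge k"
  and val_ge_uminus: "x \<in> val_ge k \<Longrightarrow> - x \<in> val_ge k"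
  by (auto simp: val_ge_def)

lemma val_ge_mono: "x \<in> val_ge k \<Longrightarrow> l \<le> k \<Longrightarrow> x \<in> val_ge l"
  by (auto simp: val_ge_def)

lemma val_ge_mult: "x \<in> val_ge k \<Longrightarrow> y \<in> val_ge l \<Longrightarrow> x * y \<in> val_ge (k + l)"
proof (cases "x = 0 \<or> y = 0")
  case False
  assume "x \<in> val_ge k" "y \<in> val_ge l"
  with False show ?thesis
    using fls_subdegree_mult[of x y] by (auto simp: val_ge_iff)
qed auto

lemma val_ge_mult0: "x \<in> val_ge 0 \<Longrightarrow> y \<in> val_ge l \<Longrightarrow> x * y \<in> val_ge l"
  using val_ge_mult[of x 0 y l] by simp

lemma val_ge_mult0': "x \<in> val_ge l \<Longrightarrow> y \<in> val_ge 0 \<Longrightarrow> x * y \<in> val_ge l"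
  using val_ge_mult[of x l y 0] by simp

definition fls_unit :: "'k::field fls \<Rightarrow> bool" where
  "fls_unit x \<longleftrightarrow> x \<in> val_ge 0 \<and> fls_nth x 0 \<noteq> 0"

lemma fls_unit_iff: "fls_unit x \<longleftrightarrow> x \<noteq> 0 \<and> fls_subdegree x = 0"
proof (cases "x = 0")
  case False
  then show ?thesis
    using fls_subdegree_leI[of x 0] nth_fls_subdegree_nonzero[OF False]
    unfolding fls_unit_def val_ge_iff by (metis nle_le)
qed (simp add: fls_unit_def)

lemma fls_unit_mult: "fls_unit x \<Longrightarrow> fls_unit y \<Longrightarrow> fls_unit (x * y)"
  by (simp add: fls_unit_iff)

lemma fls_unit_inverse: "fls_unit x \<Longrightarrow> fls_unit (inverse x)"
  by (simp add: fls_unit_iff fls_inverse_subdegree)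

lemma fls_unit_uminus [simp]: "fls_unit (- x) \<longleftrightarrow> fls_unit x"
  by (auto simp: fls_unit_iff)

lemma fls_unit_const [simp]: "fls_unit (fls_const c) \<longleftrightarrow> c \<noteq> 0"
  by (simp add: fls_unit_def)

lemma fls_unit_1 [simp]: "fls_unit 1"
  by (simp add: fls_unit_iff)

lemma fls_unit_val_ge: "fls_unit x \<Longrightarrow> x \<in> val_ge 0"
  by (simp add: fls_unit_def)

lemma fls_unit_nonzero: "fls_unit x \<Longrightarrow> x \<noteq> 0"
  by (simp add: fls_unit_iff)

lemma fls_unit_add: "fls_unit x \<Longrightarrow> y \<in> val_ge 1 \<Longrightarrow> fls_unit (x + y)"
  by (auto simp: fls_unit_def val_ge_def)

lemma fls_unit_diff: "fls_unit x \<Longrightarrow> y \<in> val_ge 1 \<Longrightarrow> fls_unit (x - y)"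
  by (auto simp: fls_unit_def val_ge_def)

lemma val_ge_0_range: "x \<in> val_ge 0 \<longleftrightarrow> x \<in> range fps_to_fls"
proof
  assume "x \<in> val_ge 0"
  then have "x = fps_to_fls (fls_regpart x)"
    by (intro fls_eqI) (auto simp: val_ge_def)
  then show "x \<in> range fps_to_fls" by blast
qed (auto simp: val_ge_def)

lemma A_to_Finf_pCons:
  "A_to_Finf (pCons a p) = fls_const a + fls_X_inv * A_to_Finf p"
  by (cases "a = 0 \<and> p = 0") (auto simp: A_to_Finf_def map_poly_pCons)

lemma A_to_Finf_0 [simp]: "A_to_Finf 0 = 0"
  by (simp add: A_to_Finf_def)

lemma fls_nth_A_to_Finf:
  "fls_nth (A_to_Finf p) i = (if i \<le> 0 then coeff p (nat (- i)) else 0)"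
proof (induction p arbitrary: i)
  case (pCons a p)
  have "nat (- i) = Suc (nat (- (i + 1)))" if "i < 0"
    using that by auto
  then show ?case
    by (auto simp: A_to_Finf_pCons fls_X_inv_times_conv_shift pCons.IH)
qed auto

lemma A_to_Finf_eq_iff [simp]: "A_to_Finf p = A_to_Finf q \<longleftrightarrow> p = q"
proof
  assume *: "A_to_Finf p = A_to_Finf q"
  show "p = q"
  proof (rule poly_eqI)
    fix i
    show "coeff p i = coeff q i"
      using arg_cong[OF *, of "\<lambda>x. fls_nth x (- int i)"] by (simp add: fls_nth_A_to_Finf)
  qed
qed auto

lemma A_to_Finf_add [simp]: "A_to_Finf (p + q) = A_to_Finf p + A_to_Finf q"
  by (rule fls_eqI) (simp add: fls_nth_A_to_Finf)

lemma A_to_Finf_diff [simp]: "A_to_Finf (p - q) = A_to_Finf p - A_to_Finf q"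
  by (rule fls_eqI) (simp add: fls_nth_A_to_Finf)

lemma A_to_Finf_uminus [simp]: "A_to_Finf (- p) = - A_to_Finf p"
  by (rule fls_eqI) (simp add: fls_nth_A_to_Finf)

lemma A_to_Finf_const [simp]: "A_to_Finf [:c:] = fls_const c"
  by (simp add: A_to_Finf_pCons)

lemma A_to_Finf_1 [simp]: "A_to_Finf 1 = 1"
  by (simp add: one_pCons)

lemma A_to_Finf_smult [simp]: "A_to_Finf (smult c p) = fls_const c * A_to_Finf p"
  by (rule fls_eqI) (simp add: fls_nth_A_to_Finf)

lemma A_to_Finf_mult [simp]: "A_to_Finf (p * q) = A_to_Finf p * A_to_Finf q"
proof (induction p)
  case (pCons a p)
  have "A_to_Finf (pCons a p * q) = A_to_Finf (smult a q) + A_to_Finf (pCons 0 (p * q))"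
    by simp
  then show ?case
    by (simp only: A_to_Finf_pCons pCons.IH A_to_Finf_smult) (simp add: algebra_simps)
qed auto

lemma A_to_Finf_eq_0_iff [simp]: "A_to_Finf p = 0 \<longleftrightarrow> p = 0"
  using A_to_Finf_eq_iff[of p 0] by simp

lemma A_to_Finf_monom: "A_to_Finf (monom c k) = fls_const c * fls_X_inv ^ k"
  by (induction k) (simp_all add: monom_0 monom_Suc A_to_Finf_pCons mult_ac)

lemma A_to_Finf_linear: "A_to_Finf [:c, 1:] = fls_const c + fls_X_inv"
  by (simp add: A_to_Finf_pCons)

lemma A_to_Finf_val_ge: "degree p \<le> k \<Longrightarrow> A_to_Finf p \<in> val_ge (- int k)"
  by (rule val_geI) (auto simp: fls_nth_A_to_Finf coeff_eq_0)

text \<open>The terms of nonpositive order form a polynomial in T = 1/\<pi>. It plays the role of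
  the quotient in the Euclidean step of the reduction of edges.\<close>

lemma fls_polynomial_part: obtains p where "u - A_to_Finf p \<in> val_ge 1"
proof
  show "u - A_to_Finf (fls_prpart u + [:fls_nth u 0:]) \<in> val_ge 1"
    by (rule val_geI) (auto simp: fls_nth_A_to_Finf coeff_pCons split: nat.splits)
qed

lemma fls_X_times_X_inv [simp]:
  "(fls_X :: 'k::field fls) * fls_X_inv = 1" "fls_X_inv * (fls_X :: 'k::field fls) = 1"
  by (rule fls_eqI; simp add: fls_X_times_conv_shift fls_X_inv_times_conv_shift)+

subsection \<open>The Iwahori subgroup and the edges of the tree\<close>

lemma fls_unit_fps_to_fls: "fls_unit (fps_to_fls x) \<longleftrightarrow> x dvd 1"
  by (auto simp: fls_unit_def val_ge_def)

lemma GL2_Oinf_mat2_iff: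
  "mat2 a b c d \<in> GL2_Oinf \<longleftrightarrow>
     a \<in> val_ge 0 \<and> b \<in> val_ge 0 \<and> c \<in> val_ge 0 \<and> d \<in> val_ge 0 \<and> fls_unit (a * d - b * c)"
proof
  assume "mat2 a b c d \<in> GL2_Oinf"
  then obtain k where k: "mat2 a b c d = map_matrix fps_to_fls k" "invertible k"
    by (auto simp: GL2_Oinf_def)
  obtain a' b' c' d' where k': "k = mat2 a' b' c' d'"
    by (rule mat2_cases)
  have "fps_to_fls (a' * d' - b' * c') = a * d - b * c"
    using k(1) by (simp add: k' map_matrix_mat2 fls_times_fps_to_fls)
  moreover have "fls_unit (fps_to_fls (a' * d' - b' * c'))"
    using k(2) unfolding k' invertible_mat2_iff fls_unit_fps_to_fls .
  ultimately show "a \<in> val_ge 0 \<and> b \<in> val_ge 0 \<and> c \<in> val_ge 0 \<and> d \<in> val_ge 0 \<and>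
      fls_unit (a * d - b * c)"
    using k(1) by (auto simp: k' map_matrix_mat2 val_ge_0_range)
next
  assume *: "a \<in> val_ge 0 \<and> b \<in> val_ge 0 \<and> c \<in> val_ge 0 \<and> d \<in> val_ge 0 \<and>
      fls_unit (a * d - b * c)"
  then obtain a' b' c' d' where abcd: "a = fps_to_fls a'" "b = fps_to_fls b'"
    "c = fps_to_fls c'" "d = fps_to_fls d'"
    by (auto simp: val_ge_0_range)
  have "fls_unit (fps_to_fls (a' * d' - b' * c'))"
    using * by (simp add: abcd fls_times_fps_to_fls)
  then have "invertible (mat2 a' b' c' d')"
    unfolding invertible_mat2_iff fls_unit_fps_to_fls .
  moreover have "mat2 a b c d = map_matrix fps_to_fls (mat2 a' b' c' d')"
    by (simp add: abcd map_matrix_mat2)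
  ultimately show "mat2 a b c d \<in> GL2_Oinf"
    by (auto simp: GL2_Oinf_def)
qed

lemma fps_X_dvd_iff: "fps_X dvd x \<longleftrightarrow> fps_to_fls x \<in> val_ge 1"
  for x :: "'k :: field fps"
proof
  assume "fps_X dvd x"
  then show "fps_to_fls x \<in> val_ge 1"
    by (auto elim!: dvdE simp: fls_times_fps_to_fls val_ge_mult0' val_ge_def)
next
  assume "fps_to_fls x \<in> val_ge 1"
  then have "fps_nth x 0 = 0"
    using val_geD[of "fps_to_fls x" 1 0] by simp
  then have "x = fps_X * fps_shift 1 x"
    by (intro fps_ext) (auto simp: fps_X_mult_nth)
  then show "fps_X dvd x"
    by (metis dvd_triv_left)
qed

text \<open>Modulo \<pi> the matrix is upper triangular, so its determinant is a unit exactly when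
  both diagonal entries are. Membership thus becomes four independent conditions on the
  entries.\<close>

lemma Iwahori_mat2_iff:
  "mat2 a b c d \<in> Iwahori \<longleftrightarrow> fls_unit a \<and> b \<in> val_ge 0 \<and> c \<in> val_ge 1 \<and> fls_unit d"
proof -
  have "mat2 a b c d \<in> Iwahori \<longleftrightarrow> mat2 a b c d \<in> GL2_Oinf \<and> c \<in> val_ge 1"
  proof
    assume "mat2 a b c d \<in> Iwahori"
    then obtain k where k: "mat2 a b c d = map_matrix fps_to_fls k" "invertible k" "fps_X dvd k$2$1"
      by (auto simp: Iwahori_def)
    then have "c = fps_to_fls (k$2$1)"
      by (subst (asm) mat2_eta[of k]) (simp add: map_matrix_mat2)
    with k show "mat2 a b c d \<in> GL2_Oinf \<and> c \<in> val_ge 1"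
      by (auto simp: GL2_Oinf_def fps_X_dvd_iff)
  next
    assume *: "mat2 a b c d \<in> GL2_Oinf \<and> c \<in> val_ge 1"
    then obtain k where k: "mat2 a b c d = map_matrix fps_to_fls k" "invertible k"
      by (auto simp: GL2_Oinf_def)
    then have "c = fps_to_fls (k$2$1)"
      by (subst (asm) mat2_eta[of k]) (simp add: map_matrix_mat2)
    with k * show "mat2 a b c d \<in> Iwahori"
      by (auto simp: Iwahori_def fps_X_dvd_iff)
  qed
  also have "\<dots> \<longleftrightarrow> fls_unit a \<and> b \<in> val_ge 0 \<and> c \<in> val_ge 1 \<and> fls_unit d"
  proof
    assume "mat2 a b c d \<in> GL2_Oinf \<and> c \<in> val_ge 1"
    then have *: "a \<in> val_ge 0" "b \<in> val_ge 0" "c \<in> val_ge 1" "d \<in> val_ge 0"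
      "fls_unit (a * d - b * c)"
      by (auto simp: GL2_Oinf_mat2_iff)
    have "fls_unit (a * d)"
      using fls_unit_add[OF *(5) val_ge_mult0[OF *(2,3)]] by simp
    then have "a \<noteq> 0" "d \<noteq> 0" "fls_subdegree a + fls_subdegree d = 0"
      by (auto simp: fls_unit_iff)
    with * show "fls_unit a \<and> b \<in> val_ge 0 \<and> c \<in> val_ge 1 \<and> fls_unit d"
      by (auto simp: fls_unit_iff val_ge_iff)
  next
    assume *: "fls_unit a \<and> b \<in> val_ge 0 \<and> c \<in> val_ge 1 \<and> fls_unit d"
    then have "fls_unit (a * d - b * c)"
      by (intro fls_unit_diff fls_unit_mult val_ge_mult0) auto
    with * show "mat2 a b c d \<in> GL2_Oinf \<and> c \<in> val_ge 1"
      by (auto simp: GL2_Oinf_mat2_iff fls_unit_val_ge intro: val_ge_mono)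
  qed
  finally show ?thesis .
qed

lemma Iwahori_subset: "Iwahori \<subseteq> GL2_Oinf"
  by (auto simp: Iwahori_def GL2_Oinf_def)

lemma GL2_Oinf_mult: "x \<in> GL2_Oinf \<Longrightarrow> y \<in> GL2_Oinf \<Longrightarrow> x ** y \<in> GL2_Oinf"
proof (cases x rule: mat2_cases, cases y rule: mat2_cases)
  fix a b c d a' b' c' d'
  assume *: "x \<in> GL2_Oinf" "y \<in> GL2_Oinf" "x = mat2 a b c d" "y = mat2 a' b' c' d'"
  have "(a * a' + b * c') * (c * b' + d * d') - (a * b' + b * d') * (c * a' + d * c')
       = (a * d - b * c) * (a' * d' - b' * c')"
    by (simp add: algebra_simps)
  with * show ?thesis
    by (auto simp: GL2_Oinf_mat2_iff mat2_mult intro!: fls_unit_mult val_ge_add val_ge_mult0)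
qed

lemma GL2_Oinf_inverse:
  assumes "x \<in> GL2_Oinf"
  obtains y where "y \<in> GL2_Oinf" "x ** y = mat 1" "y ** x = mat 1"
proof -
  obtain a b c d where x: "x = mat2 a b c d" by (rule mat2_cases)
  define e where "e = inverse (a * d - b * c)"
  have u: "fls_unit (a * d - b * c)"
    using assms by (simp add: x GL2_Oinf_mat2_iff)
  have e: "e * (a * d - b * c) = 1" "e * (a * d) = 1 + e * (b * c)"
    using fls_unit_nonzero[OF u] by (auto simp: e_def field_simps)
  have "e * d * (e * a) - e * (- b) * (e * (- c)) = e * (e * (a * d - b * c))"
    by (simp add: algebra_simps)
  then have "e * d * (e * a) - e * (- b) * (e * (- c)) = e"
    by (simp only: e mult_1_right)
  then have "mat2 (e * d) (e * (- b)) (e * (- c)) (e * a) \<in> GL2_Oinf"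
    using assms fls_unit_inverse[OF u] fls_unit_val_ge[OF fls_unit_inverse[OF u]]
    unfolding x GL2_Oinf_mat2_iff e_def[symmetric]
    by (simp add: val_ge_mult0 val_ge_uminus)
  moreover have "x ** mat2 (e * d) (e * (- b)) (e * (- c)) (e * a) = mat 1"
    "mat2 (e * d) (e * (- b)) (e * (- c)) (e * a) ** x = mat 1"
    using e(2) by (auto simp: x mat2_mult mat_eq_mat2 algebra_simps)
  ultimately show ?thesis using that by blast
qed

lemma Iwahori_mult: "x \<in> Iwahori \<Longrightarrow> y \<in> Iwahori \<Longrightarrow> x ** y \<in> Iwahori"
proof (cases x rule: mat2_cases, cases y rule: mat2_cases)
  fix a b c d a' b' c' d'
  assume *: "x \<in> Iwahori" "y \<in> Iwahori" "x = mat2 a b c d" "y = mat2 a' b' c' d'"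
  have "fls_unit (d * d' + c * b')"
    using * by (intro fls_unit_add fls_unit_mult val_ge_mult0') (auto simp: Iwahori_mat2_iff)
  with * show ?thesis
    by (simp add: Iwahori_mat2_iff mat2_mult fls_unit_val_ge add.commute[of "c * b'"]
        fls_unit_mult fls_unit_add val_ge_add val_ge_mult0 val_ge_mult0')
qed

lemma Iwahori_inverse:
  assumes "x \<in> Iwahori"
  obtains y where "y \<in> Iwahori" "x ** y = mat 1" "y ** x = mat 1"
proof -
  obtain a b c d where x: "x = mat2 a b c d" by (rule mat2_cases)
  obtain y where y: "y \<in> GL2_Oinf" "x ** y = mat 1" "y ** x = mat 1"
    using GL2_Oinf_inverse assms Iwahori_subset by blast
  obtain a' b' c' d' where y': "y = mat2 a' b' c' d'" by (rule mat2_cases)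
  have *: "fls_unit a" "b \<in> val_ge 0" "c \<in> val_ge 1" "fls_unit d"
    using assms by (auto simp: x Iwahori_mat2_iff)
  have v: "a' \<in> val_ge 0" "b' \<in> val_ge 0" "c' \<in> val_ge 0" "d' \<in> val_ge 0"
    using y(1) by (auto simp: y' GL2_Oinf_mat2_iff)
  have eqs: "c * a' + d * c' = 0" "c * b' + d * d' = 1" "a' * a + b' * c = 1"
    using y(2,3) by (auto simp: x y' mat2_mult mat_eq_mat2)
  have "c' = inverse d * (- (c * a'))"
    using eqs(1) fls_unit_nonzero[OF *(4)] by (simp add: field_simps eq_neg_iff_add_eq_0)
  then have "c' \<in> val_ge 1"
    using * v by (simp add: val_ge_mult0 val_ge_mult0' val_ge_uminus fls_unit_val_ge
        fls_unit_inverse)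
  moreover have "d' = inverse d * (1 - c * b')"
    using eqs(2) fls_unit_nonzero[OF *(4)] by (simp add: field_simps)
  then have "fls_unit d'"
    using * v by (simp add: fls_unit_mult fls_unit_inverse fls_unit_diff val_ge_mult0')
  moreover have "a' = inverse a * (1 - b' * c)"
    using eqs(3) fls_unit_nonzero[OF *(1)] by (simp add: field_simps)
  then have "fls_unit a'"
    using * v by (simp add: fls_unit_mult fls_unit_inverse fls_unit_diff val_ge_mult0)
  ultimately have "y \<in> Iwahori"
    using v by (simp add: y' Iwahori_mat2_iff)
  with y(2,3) that show ?thesis by blast
qed

text \<open>Scalars are central and \<open>K\<close> is closed under products and right inverses, so
  the factor \<open>z k\<close> is absorbed. A general \<open>K\<close> serves both the edge classes
  and the vertex classes.\<close>

lemma coset_eq: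
  fixes g :: "'a::field^2^2"
  assumes mult: "\<And>x y. x \<in> K \<Longrightarrow> y \<in> K \<Longrightarrow> x ** y \<in> K"
    and inverse: "\<And>x. x \<in> K \<Longrightarrow> \<exists>y\<in>K. x ** y = mat 1"
    and "k \<in> K" "z \<noteq> 0"
  shows "{g ** mat z ** k ** mat z' ** k' | z' k'. z' \<noteq> 0 \<and> k' \<in> K} =
         {g ** mat z' ** k' | z' k'. z' \<noteq> 0 \<and> k' \<in> K}"
proof -
  have *: "g ** mat z ** k ** mat z' ** k' = g ** mat (z * z') ** (k ** k')" for z' k'
  proof -
    have "g ** mat z ** k ** mat z' ** k' = g ** (mat z ** (k ** mat z') ** k')"
      by (simp add: matrix_mul_assoc)
    also have "\<dots> = g ** (mat z ** mat z' ** (k ** k'))"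
      by (simp add: mat_mult_commute[of z' k, symmetric] matrix_mul_assoc)
    finally show ?thesis
      by (simp add: mat_mult_mat matrix_mul_assoc)
  qed
  show ?thesis
  proof (intro equalityI subsetI)
    fix x
    assume "x \<in> {g ** mat z ** k ** mat z' ** k' | z' k'. z' \<noteq> 0 \<and> k' \<in> K}"
    then obtain z' k' where "x = g ** mat (z * z') ** (k ** k')" "z' \<noteq> 0" "k' \<in> K"
      unfolding * by blast
    then show "x \<in> {g ** mat z' ** k' | z' k'. z' \<noteq> 0 \<and> k' \<in> K}"
      using mult[OF \<open>k \<in> K\<close>, of k'] \<open>z \<noteq> 0\<close>
      by (intro CollectI exI[of _ "z * z'"] exI[of _ "k ** k'"]) simp
  next
    obtain y where y: "y \<in> K" "k ** y = mat 1" using assms by blast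
    fix x
    assume "x \<in> {g ** mat z' ** k' | z' k'. z' \<noteq> 0 \<and> k' \<in> K}"
    then obtain z' k' where x: "x = g ** mat z' ** k'" "z' \<noteq> 0" "k' \<in> K" by blast
    have "x = g ** mat z ** k ** mat (z' / z) ** (y ** k')"
      unfolding * using y(2) \<open>z \<noteq> 0\<close> by (simp add: x matrix_mul_assoc)
    with x y mult \<open>z \<noteq> 0\<close> show "x \<in> {g ** mat z ** k ** mat z' ** k' | z' k'. z' \<noteq> 0 \<and> k' \<in> K}"
      by (intro CollectI exI[of _ "z' / z"] exI[of _ "y ** k'"]) simp
  qed
qed

lemma edge_class_mult:
  "k \<in> Iwahori \<Longrightarrow> z \<noteq> 0 \<Longrightarrow> edge_class (g ** mat z ** k) = edge_class g"
  unfolding edge_class_def by (rule coset_eq) (auto intro: Iwahori_mult elim: Iwahori_inverse)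

lemma vertex_class_mult:
  "k \<in> GL2_Oinf \<Longrightarrow> z \<noteq> 0 \<Longrightarrow> vertex_class (g ** mat z ** k) = vertex_class g"
  unfolding vertex_class_def
  by (rule coset_eq) (auto intro: GL2_Oinf_mult elim: GL2_Oinf_inverse)

text \<open>The form in which equality of edges is checked throughout: the right factor is displayed
  as a scalar \<open>z\<close> times an Iwahori matrix with explicit entries.\<close>

lemma edge_class_eqI:
  assumes "h = g ** mat2 (z * a) (z * b) (z * c) (z * d)"
    and "z \<noteq> 0" "fls_unit a" "b \<in> val_ge 0" "c \<in> val_ge 1" "fls_unit d"
  shows "edge_class h = edge_class g"
proof -
  have "mat2 (z * a) (z * b) (z * c) (z * d) = mat z ** mat2 a b c d"
    by (simp add: mat2_mult mat_eq_mat2)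
  then have "h = g ** mat z ** mat2 a b c d"
    by (simp add: assms(1) matrix_mul_assoc)
  then show ?thesis
    using assms by (simp add: edge_class_mult Iwahori_mat2_iff)
qed

lemma mat_1_in_Iwahori: "mat 1 \<in> Iwahori"
  by (simp add: mat_eq_mat2 Iwahori_mat2_iff)

lemma edge_class_self: "g \<in> edge_class g"
  unfolding edge_class_def using mat_1_in_Iwahori
  by (auto intro!: exI[of _ 1] exI[of _ "mat 1"])

lemma vertex_class_self: "g \<in> vertex_class g"
  unfolding vertex_class_def using mat_1_in_Iwahori Iwahori_subset
  by (auto intro!: exI[of _ 1] exI[of _ "mat 1"])

lemma edge_class_eqD:
  assumes "edge_class h = edge_class g"
  obtains z k where "z \<noteq> 0" "k \<in> Iwahori" "h = g ** mat z ** k"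
  using edge_class_self[of h] assms unfolding edge_class_def by blast

lemma edge_act_edge_class: "edge_act a (edge_class g) = edge_class (a ** g)"
proof -
  have "{a ** g ** mat z ** k | z k. z \<noteq> 0 \<and> k \<in> Iwahori}
      = {a ** (g ** mat z ** k) | z k. z \<noteq> 0 \<and> k \<in> Iwahori}"
    by (simp add: matrix_mul_assoc)
  then show ?thesis
    unfolding edge_act_def edge_class_def by blast
qed

abbreviation rev_mat :: "'k::finite_field fls^2^2" where
  "rev_mat \<equiv> mat2 0 1 fls_X 0"

text \<open>\<open>rev_mat\<close> normalizes the Iwahori subgroup: moving it past a matrix swaps
  the diagonal entries and replaces \<open>b\<close>, \<open>c\<close> by \<open>c/\<pi>\<close>,
  \<open>b \<pi>\<close>.\<close>

lemma edge_rev_edge_class: "edge_rev (edge_class g) = edge_class (g ** rev_mat)"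
proof (intro equalityI subsetI)
  have X: "c * (fls_X * fls_X_inv) = c" for c :: "'a fls"
    by simp
  fix x assume "x \<in> edge_rev (edge_class g)"
  then obtain z k where x: "x = g ** mat z ** k ** rev_mat" "z \<noteq> 0" "k \<in> Iwahori"
    by (auto simp: edge_rev_def edge_class_def)
  obtain a b c d where k: "k = mat2 a b c d" by (rule mat2_cases)
  have "mat z ** k ** rev_mat = rev_mat ** mat z ** mat2 d (c * fls_X_inv) (b * fls_X) a"
    using X[of "c * z"] by (simp add: k mat_eq_mat2 mat2_mult)
  then have "x = g ** rev_mat ** mat z ** mat2 d (c * fls_X_inv) (b * fls_X) a"
    using x(1) by (metis matrix_mul_assoc)
  moreover have "mat2 d (c * fls_X_inv) (b * fls_X) a \<in> Iwahori"
    using x(3) val_ge_mult[of c 1 fls_X_inv "-1"]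
    by (auto simp: k Iwahori_mat2_iff val_ge_mult0 val_ge_iff[of fls_X_inv])
  ultimately show "x \<in> edge_class (g ** rev_mat)"
    using x(2) by (auto simp: edge_class_def)
next
  have X: "c * (fls_X * fls_X_inv) = c" for c :: "'a fls"
    by simp
  fix x assume "x \<in> edge_class (g ** rev_mat)"
  then obtain z k where x: "x = g ** rev_mat ** mat z ** k" "z \<noteq> 0" "k \<in> Iwahori"
    by (auto simp: edge_class_def)
  obtain a b c d where k: "k = mat2 a b c d" by (rule mat2_cases)
  have "rev_mat ** mat z ** k = mat z ** mat2 d (c * fls_X_inv) (b * fls_X) a ** rev_mat"
    using X[of "b * z"] X[of "c * z"] by (simp add: k mat_eq_mat2 mat2_mult)
  then have "x = g ** mat z ** mat2 d (c * fls_X_inv) (b * fls_X) a ** rev_mat"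
    using x(1) by (metis matrix_mul_assoc)
  moreover have "mat2 d (c * fls_X_inv) (b * fls_X) a \<in> Iwahori"
    using x(3) val_ge_mult[of c 1 fls_X_inv "-1"]
    by (auto simp: k Iwahori_mat2_iff val_ge_mult0 val_ge_iff[of fls_X_inv])
  ultimately show "x \<in> edge_rev (edge_class g)"
    using x(2) by (auto simp: edge_class_def edge_rev_def)
qed

lemma rev_mat_square: "rev_mat ** rev_mat = mat fls_X"
  by (simp add: mat2_mult mat_eq_mat2)

lemma edge_class_mat: "z \<noteq> 0 \<Longrightarrow> edge_class (g ** mat z) = edge_class g"
  using edge_class_mult[OF mat_1_in_Iwahori, of z g] by simp

lemma edge_class_rev_rev: "edge_class (g ** rev_mat ** rev_mat) = edge_class g"
  by (metis edge_class_mat fls_X_nonzero matrix_mul_assoc rev_mat_square)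

lemma edge_origin_edge_class: "edge_origin (edge_class g) = vertex_class g"
proof (intro equalityI subsetI)
  fix x assume "x \<in> edge_origin (edge_class g)"
  then obtain z i k where "x = g ** mat z ** i ** k" "z \<noteq> 0" "i \<in> Iwahori" "k \<in> GL2_Oinf"
    by (auto simp: edge_class_def edge_origin_def)
  then show "x \<in> vertex_class g"
    using GL2_Oinf_mult[of i k] Iwahori_subset
    by (auto simp: vertex_class_def matrix_mul_assoc[symmetric])
next
  fix x assume "x \<in> vertex_class g"
  then obtain z k where "x = g ** mat z ** k" "z \<noteq> 0" "k \<in> GL2_Oinf"
    by (auto simp: vertex_class_def)
  moreover from this have "g ** mat z \<in> edge_class g"
    using mat_1_in_Iwahori by (auto simp: edge_class_def intro!: exI[of _ z] exI[of _ "mat 1"])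
  ultimately show "x \<in> edge_origin (edge_class g)"
    by (auto simp: edge_origin_def)
qed

lemma edge_terminus_edge_class: "edge_terminus (edge_class g) = vertex_class (g ** rev_mat)"
  by (simp add: edge_terminus_def edge_rev_edge_class edge_origin_edge_class)

lemma GL2_Finf_mult: "a \<in> GL2_Finf \<Longrightarrow> b \<in> GL2_Finf \<Longrightarrow> a ** b \<in> GL2_Finf"
  by (simp add: GL2_Finf_def invertible_mult_iff)

lemma GL2_Finf_mat2_iff: "mat2 a b c d \<in> GL2_Finf \<longleftrightarrow> a * d - b * c \<noteq> 0"
  by (simp add: GL2_Finf_def invertible_mat2_field_iff)

lemma rev_mat_in_GL2: "rev_mat \<in> GL2_Finf"
  by (simp add: GL2_Finf_mat2_iff)

lemma edge_class_in_edges: "g \<in> GL2_Finf \<Longrightarrow> edge_class g \<in> tree_edges"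
  by (simp add: tree_edges_def)

lemma GL2_Finf_inverse:
  assumes "g \<in> GL2_Finf"
  obtains h where "h \<in> GL2_Finf" "g ** h = mat 1" "h ** g = mat 1"
  using assms unfolding GL2_Finf_def by (metis invertible_def mem_Collect_eq)

subsection \<open>Harmonic cochains\<close>

text \<open>The cosets of the Iwahori subgroup in GL_2 of the integers form the projective line over
  the residue field, read off from the first column modulo \<pi>. If the lower left entry is no unit
  the coset is trivial; otherwise the point is the residue of \<open>a / c\<close>.\<close>

lemma GL2_Oinf_cosets:
  assumes "k \<in> GL2_Oinf"
  obtains "k \<in> Iwahori" | c i where "i \<in> Iwahori" "k = mat2 (fls_const c) 1 1 0 ** i"
proof -
  obtain a b c d where k: "k = mat2 a b c d" by (rule mat2_cases)
  have v: "a \<in> val_ge 0" "b \<in> val_ge 0" "c \<in> val_ge 0" "d \<in> val_ge 0" "fls_unit (a * d - b * c)"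
    using assms by (auto simp: k GL2_Oinf_mat2_iff)
  show ?thesis
  proof (cases "fls_unit c")
    case False
    then have c: "c \<in> val_ge 1"
      using v(3) by (cases "c = 0") (auto simp: val_ge_iff fls_unit_iff)
    have "fls_unit (a * d)"
      using fls_unit_add[OF v(5) val_ge_mult0[OF v(2) c]] by simp
    then have "a \<noteq> 0" "d \<noteq> 0" "fls_subdegree a + fls_subdegree d = 0"
      by (auto simp: fls_unit_iff)
    with v have "fls_unit a \<and> fls_unit d"
      by (auto simp: fls_unit_iff val_ge_iff)
    with v c have "k \<in> Iwahori"
      by (simp add: k Iwahori_mat2_iff)
    with that(1) show ?thesis .
  next
    case True
    define t where "t = fls_nth (a / c) 0"
    define i where "i = mat2 c d (a - fls_const t * c) (b - fls_const t * d)"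
    have ac: "a / c \<in> val_ge 0"
      using v(1) fls_unit_val_ge[OF fls_unit_inverse[OF True]]
      by (simp add: divide_inverse val_ge_mult0)
    have "a / c - fls_const t \<in> val_ge 1"
      using ac by (auto simp: val_ge_def t_def)
    then have *: "c * (a / c - fls_const t) \<in> val_ge 1"
      using v(3) val_ge_mult0 by blast
    have "c * (a / c - fls_const t) = a - fls_const t * c"
      using fls_unit_nonzero[OF True] by (simp add: field_simps)
    with * have 1: "a - fls_const t * c \<in> val_ge 1"
      by simp
    have "c * (b - fls_const t * d) = - (a * d - b * c) + (a - fls_const t * c) * d"
      by (simp add: algebra_simps)
    moreover have "fls_unit \<dots>"
      using v 1 by (intro fls_unit_add val_ge_mult0') (simp_all only: fls_unit_uminus)
    ultimately have "fls_unit (c * (b - fls_const t * d))"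
      by simp
    then have "fls_unit (b - fls_const t * d)"
      using True by (auto simp: fls_unit_iff)
    then have "i \<in> Iwahori"
      using True v 1 by (simp add: i_def Iwahori_mat2_iff)
    moreover have "k = mat2 (fls_const t) 1 1 0 ** i"
      by (simp add: k i_def mat2_mult)
    ultimately show ?thesis
      using that(2) by blast
  qed
qed

text \<open>\<open>'k option\<close> models the projective line over the residue field, with
  \<open>None\<close> for the trivial coset, so that sums over the q + 1 edges at a vertex become
  sums over a finite type.\<close>

definition origin_rep :: "'k::finite_field option \<Rightarrow> 'k fls^2^2" where
  "origin_rep r = (case r of None \<Rightarrow> mat 1 | Some c \<Rightarrow> mat2 (fls_const c) 1 1 0)"

lemma origin_rep_simps [simp]:
  "origin_rep None = mat 1" "origin_rep (Some c) = mat2 (fls_const c) 1 1 0"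
  by (simp_all add: origin_rep_def)

lemma origin_rep_in: "origin_rep r \<in> GL2_Oinf"
  by (cases r) (simp_all add: GL2_Oinf_mat2_iff mat_eq_mat2)

lemma origin_rep_inj:
  assumes "origin_rep r' = origin_rep r ** mat z ** i" "i \<in> Iwahori" "z \<noteq> 0"
  shows "r' = r"
proof -
  obtain a b c d where i: "i = mat2 a b c d" by (rule mat2_cases)
  have v: "fls_unit a" "b \<in> val_ge 0" "c \<in> val_ge 1" "fls_unit d"
    using assms(2) by (auto simp: i Iwahori_mat2_iff)
  have nz: "a \<noteq> 0" "d \<noteq> 0"
    using v by (auto simp: fls_unit_iff)
  show ?thesis
  proof (cases r)
    case None
    show ?thesis
    proof (cases r')
      case (Some t)
      have eqs: "fls_const t = z * a" "1 = z * c"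
        using assms(1) by (auto simp: None Some i mat_eq_mat2 mat2_mult)
      have "z = fls_const t * inverse a"
        using eqs(1) nz by (simp add: field_simps)
      then have "z \<in> val_ge 0"
        using v(1) by (simp add: val_ge_mult0 fls_unit_val_ge fls_unit_inverse)
      then have "z * c \<in> val_ge 1"
        using v(3) by (rule val_ge_mult0)
      then show ?thesis
        using eqs(2) by (auto simp: val_ge_iff)
    qed (simp add: None)
  next
    case (Some t)
    show ?thesis
    proof (cases r')
      case None
      have "z * a = 0"
        using assms(1) by (auto simp: None Some i mat_eq_mat2 mat2_mult)
      then show ?thesis
        using assms nz by simp
    next
      case (Some t')
      have eqs: "fls_const t' = fls_const t * (z * a) + z * c" "z * a = 1"
        using assms(1) by (auto simp: \<open>r = Some t\<close> Some i mat_eq_mat2 mat2_mult algebra_simps)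
      have "z = inverse a"
        using eqs(2) nz by (simp add: field_simps)
      then have "z * c \<in> val_ge 1"
        using v by (simp add: val_ge_mult0 fls_unit_val_ge fls_unit_inverse)
      then have "fls_nth (fls_const t') 0 = fls_nth (fls_const t) 0"
        using eqs by (simp add: val_ge_def)
      then show ?thesis
        by (simp add: Some \<open>r = Some t\<close>)
    qed
  qed
qed

lemma GL2_Finf_cancel:
  assumes "g \<in> GL2_Finf" "g ** x = g ** y" shows "x = y"
  by (metis GL2_Finf_inverse assms matrix_mul_assoc matrix_mul_lid)

text \<open>The coset representatives describe the edges leaving the vertex, whereas harmonicity is
  a condition on the edges ending there; hence the reversal.\<close>

lemma edges_at_vertex:
  assumes g: "g \<in> GL2_Finf"
  shows "{e \<in> tree_edges. edge_terminus e = vertex_class g} =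
         (\<lambda>r. edge_rev (edge_class (g ** origin_rep r))) ` UNIV"
proof (intro equalityI subsetI)
  fix e assume "e \<in> {e \<in> tree_edges. edge_terminus e = vertex_class g}"
  then obtain h where h: "e = edge_class h" "h \<in> GL2_Finf" "vertex_class (h ** rev_mat) = vertex_class g"
    by (auto simp: tree_edges_def edge_terminus_edge_class)
  obtain z k where k: "h ** rev_mat = g ** mat z ** k" "z \<noteq> 0" "k \<in> GL2_Oinf"
    using vertex_class_self[of "h ** rev_mat"] unfolding h(3) by (auto simp: vertex_class_def)
  obtain r i where r: "k = origin_rep r ** i" "i \<in> Iwahori"
    using GL2_Oinf_cosets[OF k(3)] origin_rep_simps matrix_mul_lid by metis
  have "h ** rev_mat = g ** origin_rep r ** mat z ** i"
    unfolding k(1) r(1) by (metis mat_mult_commute matrix_mul_assoc)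
  then have "edge_class (h ** rev_mat) = edge_class (g ** origin_rep r)"
    using edge_class_mult k(2) r(2) by metis
  moreover have "e = edge_rev (edge_class (h ** rev_mat))"
    by (simp add: edge_rev_edge_class edge_class_rev_rev h(1))
  ultimately show "e \<in> range (\<lambda>r. edge_rev (edge_class (g ** origin_rep r)))"
    by simp
next
  fix e assume "e \<in> range (\<lambda>r. edge_rev (edge_class (g ** origin_rep r)))"
  then obtain r where r: "e = edge_class (g ** origin_rep r ** rev_mat)"
    by (auto simp: edge_rev_edge_class)
  have inv: "origin_rep r \<in> GL2_Finf"
    by (cases r) (simp_all add: GL2_Finf_mat2_iff mat_eq_mat2)
  have "g ** origin_rep r ** rev_mat ** rev_mat = g ** mat fls_X ** origin_rep r"
    by (metis mat_mult_commute matrix_mul_assoc rev_mat_square)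
  then have "edge_terminus e = vertex_class g"
    using vertex_class_mult[OF origin_rep_in[of r], of fls_X g]
    by (simp add: r edge_terminus_edge_class)
  moreover have "e \<in> tree_edges"
    unfolding r by (intro edge_class_in_edges GL2_Finf_mult g inv rev_mat_in_GL2)
  ultimately show "e \<in> {e \<in> tree_edges. edge_terminus e = vertex_class g}"
    by simp
qed

lemma edges_at_vertex_inj:
  assumes g: "g \<in> GL2_Finf"
  shows "inj (\<lambda>r. edge_rev (edge_class (g ** origin_rep r)))"
proof (rule injI)
  fix r r'
  assume "edge_rev (edge_class (g ** origin_rep r')) = edge_rev (edge_class (g ** origin_rep r))"
  then have "edge_rev (edge_rev (edge_class (g ** origin_rep r'))) =
      edge_rev (edge_rev (edge_class (g ** origin_rep r)))"
    by simp
  then have "edge_class (g ** origin_rep r') = edge_class (g ** origin_rep r)"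
    unfolding edge_rev_edge_class edge_class_rev_rev .
  then obtain z i where "z \<noteq> 0" "i \<in> Iwahori" "g ** origin_rep r' = g ** origin_rep r ** mat z ** i"
    by (rule edge_class_eqD)
  then show "r' = r"
    using GL2_Finf_cancel[OF g, of "origin_rep r'" "origin_rep r ** mat z ** i"] origin_rep_inj
    by (metis matrix_mul_assoc)
qed

lemma harmonic_rev:
  "harmonic_cochain f \<Longrightarrow> g \<in> GL2_Finf \<Longrightarrow> f (edge_class (g ** rev_mat)) = - f (edge_class g)"
  by (auto simp: harmonic_cochain_def edge_rev_edge_class[symmetric] edge_class_in_edges)

lemma sum_option: "(\<Sum>r\<in>UNIV. h r) = h None + (\<Sum>c\<in>UNIV. h (Some c))"
  for h :: "'a::finite option \<Rightarrow> 'b::comm_monoid_add"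
  by (simp add: UNIV_option_conv sum.reindex)

lemma harmonic_origin_sum:
  fixes f :: "('k::finite_field, 'r::comm_ring_1) cochain"
  assumes f: "harmonic_cochain f" and g: "g \<in> GL2_Finf"
  shows "f (edge_class g) + (\<Sum>c\<in>UNIV. f (edge_class (g ** mat2 (fls_const c) 1 1 0))) = 0"
proof -
  have inv: "g ** origin_rep r \<in> GL2_Finf" for r :: "'k option"
    using g by (cases r) (simp_all add: GL2_Finf_mat2_iff mat_eq_mat2 GL2_Finf_mult)
  have "0 = (\<Sum>e | e \<in> tree_edges \<and> edge_terminus e = vertex_class g. f e)"
    using f g by (auto simp: harmonic_cochain_def tree_vertices_def)
  also have "\<dots> = (\<Sum>r\<in>UNIV. f (edge_rev (edge_class (g ** origin_rep r))))"
    unfolding edges_at_vertex[OF g] by (simp add: sum.reindex[OF edges_at_vertex_inj[OF g]])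
  also have "\<dots> = - (\<Sum>r\<in>UNIV. f (edge_class (g ** origin_rep r)))"
    unfolding edge_rev_edge_class harmonic_rev[OF f inv] by (rule sum_negf)
  also have "(\<Sum>r\<in>UNIV. f (edge_class (g ** origin_rep r))) =
      f (edge_class g) + (\<Sum>c\<in>UNIV. f (edge_class (g ** mat2 (fls_const c) 1 1 0)))"
    by (simp add: sum_option)
  finally show ?thesis by (simp only: neg_0_equal_iff_equal)
qed

text \<open>Flow conservation at the origin of the edge: its reverse and q further edges end there,
  so by alternation the value leaving through \<open>g\<close> is the sum of the values entering
  through the others.\<close>

lemma harmonic_split:
  fixes f :: "('k::finite_field, 'r::comm_ring_1) cochain"
  assumes f: "harmonic_cochain f" and g: "g \<in> GL2_Finf"
  shows "f (edge_class g) = (\<Sum>c\<in>UNIV. f (edge_class (g ** mat2 fls_X (fls_const c) 0 1)))"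
proof -
  have inv: "g ** mat2 (fls_const c) 1 1 0 \<in> GL2_Finf" for c :: 'k
    using g by (intro GL2_Finf_mult) (simp_all add: GL2_Finf_mat2_iff)
  have *: "mat2 (fls_const c) 1 1 0 ** rev_mat = mat2 fls_X (fls_const c) 0 1" for c :: 'k
    by (simp add: mat2_mult)
  have "f (edge_class (g ** mat2 fls_X (fls_const c) 0 1)) =
      - f (edge_class (g ** mat2 (fls_const c) 1 1 0))" for c
    using harmonic_rev[OF f inv] unfolding matrix_mul_assoc[symmetric] * .
  then have "(\<Sum>c\<in>UNIV. f (edge_class (g ** mat2 fls_X (fls_const c) 0 1))) =
      - (\<Sum>c\<in>UNIV. f (edge_class (g ** mat2 (fls_const c) 1 1 0)))"
    by (simp only: sum_negf)
  then show ?thesis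
    using harmonic_origin_sum[OF f g] by (metis add.inverse_unique add.commute)
qed

lemma edge_act_mult: "edge_act (a ** b) e = edge_act a (edge_act b e)"
  by (simp add: edge_act_def matrix_mul_assoc image_image)

lemma edge_act_1 [simp]: "edge_act (mat 1) e = e"
  by (simp add: edge_act_def)

lemma edge_act_in_edges_iff:
  assumes "a \<in> GL2_Finf" shows "edge_act a e \<in> tree_edges \<longleftrightarrow> e \<in> tree_edges"
proof -
  have *: "edge_act b e \<in> tree_edges" if "b \<in> GL2_Finf" "e \<in> tree_edges" for b and e :: "('a fls^2^2) set"
    using that by (auto simp: tree_edges_def edge_act_edge_class intro: GL2_Finf_mult)
  obtain b where "b \<in> GL2_Finf" "b ** a = mat 1"
    using GL2_Finf_inverse[OF assms] .
  then show ?thesis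
    using * assms by (metis edge_act_1 edge_act_mult)
qed

text \<open>Left multiplication by \<open>a\<close> commutes with reversal and carries the edges
  ending at the vertex of \<open>g\<close> bijectively to those ending at the vertex of
  \<open>a ** g\<close>.\<close>

lemma harmonic_slash:
  assumes f: "harmonic_cochain f" and a: "a \<in> GL2_Finf"
  shows "harmonic_cochain (slash f a)"
  unfolding harmonic_cochain_def
proof (intro conjI allI ballI impI)
  fix e :: "('a fls^2^2) set" assume "e \<notin> tree_edges"
  then show "slash f a e = 0"
    using f edge_act_in_edges_iff[OF a] by (simp add: slash_def harmonic_cochain_def)
next
  fix e :: "('a fls^2^2) set" assume e: "e \<in> tree_edges"
  have "edge_act a (edge_rev e) = edge_rev (edge_act a e)"
    by (auto simp: edge_act_def edge_rev_def matrix_mul_assoc image_image)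
  then show "slash f a (edge_rev e) = - slash f a e"
    using f e edge_act_in_edges_iff[OF a] by (simp add: slash_def harmonic_cochain_def)
next
  fix v :: "('a fls^2^2) set" assume "v \<in> tree_vertices"
  then obtain g where g: "g \<in> GL2_Finf" "v = vertex_class g"
    by (auto simp: tree_vertices_def)
  have ag: "a ** g \<in> GL2_Finf"
    using a g by (simp add: GL2_Finf_mult)
  have "(\<Sum>e | e \<in> tree_edges \<and> edge_terminus e = v. slash f a e)
      = (\<Sum>r\<in>UNIV. slash f a (edge_rev (edge_class (g ** origin_rep r))))"
    unfolding edges_at_vertex[OF g(1)] g(2) by (simp add: sum.reindex[OF edges_at_vertex_inj[OF g(1)]])
  also have "\<dots> = (\<Sum>r\<in>UNIV. f (edge_rev (edge_class (a ** g ** origin_rep r))))"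
    by (simp add: slash_def edge_rev_edge_class edge_act_edge_class matrix_mul_assoc)
  also have "\<dots> = (\<Sum>e | e \<in> tree_edges \<and> edge_terminus e = vertex_class (a ** g). f e)"
    unfolding edges_at_vertex[OF ag] by (simp add: sum.reindex[OF edges_at_vertex_inj[OF ag]])
  also have "\<dots> = 0"
    using f ag by (auto simp: harmonic_cochain_def tree_vertices_def)
  finally show "(\<Sum>e | e \<in> tree_edges \<and> edge_terminus e = v. slash f a e) = 0" .
qed

lemma harmonic_sum:
  assumes "\<And>i. i \<in> I \<Longrightarrow> harmonic_cochain (f i)"
  shows "harmonic_cochain (\<lambda>e. \<Sum>i\<in>I. f i e)"
  using assms unfolding harmonic_cochain_def
  by (simp add: sum_negf) (simp add: sum.swap[of _ I])

subsection \<open>Polynomials over a finite field\<close>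

text \<open>A system of residues modulo a polynomial of degree \<open>m\<close>. The clause for 0
  keeps the count q^m correct for \<open>m = 0\<close>, where only 0 remains.\<close>

definition polys_below :: "nat \<Rightarrow> 'k::finite_field poly set" where
  "polys_below m = {p. p = 0 \<or> degree p < m}"

lemma polys_below_0: "polys_below 0 = {0}"
  by (auto simp: polys_below_def)

lemma polys_below_Suc: "polys_below (Suc m) = (\<lambda>(a, p). pCons a p) ` (UNIV \<times> polys_below m)"
proof (intro equalityI subsetI)
  fix x :: "'a poly" assume x: "x \<in> polys_below (Suc m)"
  obtain a p where p: "x = pCons a p" by (rule pCons_cases)
  have "p \<in> polys_below m"
    using x by (auto simp: p polys_below_def split: if_splits)
  then show "x \<in> (\<lambda>(a, p). pCons a p) ` (UNIV \<times> polys_below m)"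
    by (auto simp: p)
next
  fix x :: "'a poly" assume "x \<in> (\<lambda>(a, p). pCons a p) ` (UNIV \<times> polys_below m)"
  then show "x \<in> polys_below (Suc m)"
    by (auto simp: polys_below_def degree_pCons_eq_if split: if_splits)
qed

lemma finite_polys_below [simp]: "finite (polys_below m)"
  by (induction m) (auto simp: polys_below_0 polys_below_Suc)

lemma card_polys_below: "card (polys_below m :: 'k::finite_field poly set) = CARD('k) ^ m"
proof (induction m)
  case (Suc m)
  have "inj_on (\<lambda>(a, p :: 'k poly). pCons a p) (UNIV \<times> polys_below m)"
    by (auto simp: inj_on_def)
  then show ?case
    by (simp add: polys_below_Suc card_image card_cartesian_product Suc)
qed (simp add: polys_below_0)

lemma card_field_ge_2: "CARD('k::finite_field) \<ge> 2"
  using card_mono[of UNIV "{0, 1 :: 'k}"] by simp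

text \<open>A nonzero element of least degree in the ideal generated by \<open>a\<close> and
  \<open>b\<close>, made monic. The cofactors are part of the conclusion because
  \<open>(a', b')\<close> later becomes the first column of an element of
  \<open>Gamma0 n\<close>.\<close>

lemma bezout_gcd_poly:
  fixes a b :: "'k::field poly"
  assumes "a \<noteq> 0 \<or> b \<noteq> 0"
  obtains g x y a' b' where "lead_coeff g = 1" "a = g * a'" "b = g * b'" "x * a' + y * b' = 1"
proof -
  define I where "I = {x * a + y * b | x y. True}"
  have ab: "a \<in> I" "b \<in> I"
    using mult_1[of a] mult_1[of b] mult_zero_left[of a] mult_zero_left[of b]
    unfolding I_def by (metis (mono_tags, lifting) add_0 add_0_right mem_Collect_eq)+
  then have nz: "\<exists>g. g \<in> I \<and> g \<noteq> 0"
    using assms by blast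
  obtain g where g: "g \<in> I" "g \<noteq> 0" "\<And>h. h \<in> I \<Longrightarrow> h \<noteq> 0 \<Longrightarrow> degree g \<le> degree h"
    using exE_some[OF nz] ex_has_least_nat[of "\<lambda>g. g \<in> I \<and> g \<noteq> 0" _ degree] nz by metis
  obtain x y where xy: "g = x * a + y * b"
    using g(1) by (auto simp: I_def)
  have dvd: "g dvd h" if h: "h \<in> I" for h
  proof -
    obtain x' y' where "h = x' * a + y' * b"
      using h unfolding I_def by blast
    then have "h mod g = (x' - (h div g) * x) * a + (y' - (h div g) * y) * b"
      by (simp add: minus_div_mult_eq_mod[symmetric] xy algebra_simps)
    then have "h mod g \<in> I"
      by (auto simp: I_def)
    then have "h mod g = 0"
      using g(3)[of "h mod g"] degree_mod_less'[OF g(2), of h] by (meson not_le)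
    then show ?thesis by auto
  qed
  obtain a' b' where ab': "a = g * a'" "b = g * b'"
    using dvd ab by (metis dvdE)
  have "x * a + y * b = g * (x * a' + y * b')"
    unfolding ab' by (simp add: algebra_simps)
  then have "g * 1 = g * (x * a' + y * b')"
    using xy by simp
  then have 1: "x * a' + y * b' = 1"
    using g(2) by (metis mult_left_cancel)
  define c where "c = lead_coeff g"
  have c: "c \<noteq> 0" using g(2) by (simp add: c_def)
  show ?thesis
  proof (rule that[of "smult (inverse c) g" "smult c a'" "smult c b'" "smult (inverse c) x" "smult (inverse c) y"])
    show "lead_coeff (smult (inverse c) g) = 1"
      using c by (simp add: c_def)
  qed (use c 1 ab' in simp_all)
qed

lemma bezout_poly:
  fixes a b :: "'k::field poly"
  assumes "coprime a b"
  obtains x y where "x * a + y * b = 1"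
proof -
  have "a \<noteq> 0 \<or> b \<noteq> 0" using assms by auto
  then obtain g x y a' b' where g: "a = g * a'" "b = g * b'" "x * a' + y * b' = 1"
    by (rule bezout_gcd_poly)
  have "g dvd 1"
    using assms g(1,2) by (meson coprime_common_divisor dvd_triv_left)
  then obtain u where u: "1 = g * u" ..
  have "(x * u) * a + (y * u) * b = (g * u) * (x * a' + y * b')"
    unfolding g(1,2) by (simp add: algebra_simps)
  then have "(x * u) * a + (y * u) * b = 1"
    by (simp add: g(3) u[symmetric])
  with that show ?thesis by blast
qed

lemma coprime_polyI: "(x * a + y * b) dvd 1 \<Longrightarrow> coprime a b"
  for a :: "'k::field poly"
  by (meson coprimeI dvd_add dvd_mult dvd_trans)

lemma coprime_add_mult: "coprime c (d + x * c) \<longleftrightarrow> coprime c d" for c :: "'k::field poly"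
proof -
  have *: "coprime c (d + x * c)" if "coprime c d" for d x
  proof (rule coprimeI)
    fix e assume "e dvd c" "e dvd d + x * c"
    then have "e dvd d"
      by (metis dvd_add_left_iff dvd_mult)
    then show "is_unit e"
      using \<open>e dvd c\<close> that by (meson coprime_common_divisor)
  qed
  show ?thesis
    using *[of d x] *[of "d + x * c" "- x"] by auto
qed

definition lin :: "'k::field \<Rightarrow> 'k poly" where
  "lin r = [:- r, 1:]"

lemma degree_lin [simp]: "degree (lin r) = 1"
  and lead_coeff_lin: "lead_coeff (lin r) = 1"
  and lin_nonzero [simp]: "lin r \<noteq> 0"
  and poly_lin [simp]: "poly (lin r) x = x - r"
  by (simp_all add: lin_def)

lemma coeff_lin [simp]: "coeff (lin r) (Suc 0) = 1"
  by (simp add: lin_def)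

lemma lin_not_unit: "\<not> is_unit (lin r)"
  by (simp add: is_unit_iff_degree)

lemma linear_dvd_iff: "lin r dvd p \<longleftrightarrow> poly p r = 0" for r :: "'k::field"
  by (simp add: poly_eq_0_iff_dvd lin_def)

lemma coprime_linear_iff: "coprime (lin r) p \<longleftrightarrow> poly p r \<noteq> 0" for r :: "'k::field"
proof
  assume "coprime (lin r) p"
  then show "poly p r \<noteq> 0"
    unfolding linear_dvd_iff[symmetric]
    by (metis coprime_common_divisor dvd_refl lin_not_unit)
next
  assume *: "poly p r \<noteq> 0"
  have "lin r dvd p - [:poly p r:]"
    by (simp add: linear_dvd_iff)
  then obtain q where "p - [:poly p r:] = lin r * q" ..
  then have "p = [:poly p r:] + lin r * q"
    by (metis add.commute diff_add_cancel)
  then have "(- q) * lin r + 1 * p = [:poly p r:]"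
    by (metis (no_types, lifting) add.commute add_diff_cancel_right' mult.commute mult_1
        mult_minus_left uminus_add_conv_diff)
  moreover have "[:poly p r:] dvd 1"
    using * by (simp add: is_unit_iff_degree)
  ultimately show "coprime (lin r) p"
    by (metis coprime_polyI)
qed

lemma dvd_linear_mult_cancel:
  fixes n :: "'k::field poly"
  assumes "n dvd lin r * x" "poly n r \<noteq> 0"
  shows "n dvd x"
proof -
  obtain y where y: "lin r * x = n * y"
    using assms(1) ..
  have "poly (lin r * x) r = 0"
    by simp
  then have "poly y r = 0"
    using assms(2) unfolding y by simp
  then obtain y' where "y = lin r * y'"
    unfolding linear_dvd_iff[symmetric] ..
  then have "lin r * x = lin r * (n * y')"
    using y by (simp add: mult_ac)
  then have "x = n * y'"
    by (subst (asm) mult_cancel_left) auto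
  then show ?thesis ..
qed

lemma monic_dvd_factor:
  fixes n g :: "'k::field poly"
  assumes "lead_coeff n = 1" "lead_coeff g = 1" "g dvd n"
  obtains h where "n = g * h" "lead_coeff h = 1" "degree n = degree g + degree h"
proof -
  obtain h where h: "n = g * h" using assms(3) ..
  have "lead_coeff h = 1"
    using assms by (simp add: h lead_coeff_mult)
  moreover from this have "degree n = degree g + degree h"
    using assms by (auto simp: h intro!: degree_mult_eq)
  ultimately show ?thesis using h that by blast
qed

lemma degree_le_1_cases:
  fixes p :: "'k::zero poly"
  assumes "degree p \<le> 1"
  obtains a b where "p = [:a, b:]"
proof -
  obtain a p' where p: "p = pCons a p'" by (rule pCons_cases)
  have "degree p' = 0"
    using assms by (auto simp: p split: if_splits)
  then obtain b where "p' = [:b:]" by (rule degree_eq_zeroE)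
  with p that show ?thesis by blast
qed

lemma degree_1_monic: "lead_coeff p = 1 \<Longrightarrow> degree p = 1 \<Longrightarrow> \<exists>c. p = [:c, 1:]"
  for p :: "'k::comm_semiring_1 poly"
proof -
  assume p: "lead_coeff p = 1" "degree p = 1"
  obtain a p' where p': "p = pCons a p'" by (rule pCons_cases)
  have "p' \<noteq> 0" using p by (auto simp: p')
  then have "degree p' = 0" "lead_coeff p' = 1"
    using p by (auto simp: p')
  then have "p' = 1"
    by (metis degree_eq_zeroE lead_coeff_pCons(2) one_pCons)
  then show ?thesis by (auto simp: p' one_pCons)
qed

subsection \<open>Symbols of level three\<close>

text \<open>The value \<open>W k c d\<close> is that of a cochain on the edge
  \<open>\<gamma> diag(T\<^sup>k, 1)\<close> where \<open>\<gamma>\<close> has bottom row \<open>(c, d)\<close>.\<close>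

locale manin_symbols =
  fixes n :: "'k::finite_field poly" and W :: "nat \<Rightarrow> 'k poly \<Rightarrow> 'k poly \<Rightarrow> int"
  assumes monic: "lead_coeff n = 1"
    and cong: "\<And>k c d c' d'. coprime c d \<Longrightarrow> coprime c' d' \<Longrightarrow> n dvd c * d' - c' * d \<Longrightarrow>
        W k c d = W k c' d'"
    and triangular: "\<And>k c d \<alpha> \<beta> \<delta>. coprime c d \<Longrightarrow> \<alpha> \<noteq> 0 \<Longrightarrow> \<delta> \<noteq> 0 \<Longrightarrow> degree \<beta> \<le> k \<Longrightarrow>
        W k (smult \<alpha> c) (\<beta> * c + smult \<delta> d) = W k c d"
    and split: "\<And>k c d. coprime c d \<Longrightarrow>
        W (Suc k) c d = (\<Sum>t\<in>UNIV. W k c (d + monom t (Suc k) * c))"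
    and vertex: "\<And>c d. coprime c d \<Longrightarrow> W 0 c d + (\<Sum>t\<in>UNIV. W 0 (smult t c + d) c) = 0"
    and bounded: "\<exists>B. \<forall>k c d. \<bar>W k c d\<bar> \<le> B"
begin

text \<open>Along a cusp of width \<open>degree w\<close> the values are eventually multiplied by \<open>q\<close> in each step,
  hence they vanish.\<close>

lemma cusp:
  assumes cd: "coprime c d" and w: "lead_coeff w = 1" "degree w \<le> Suc k" "n dvd w * c\<^sup>2"
  shows "W k c d = 0"
proof -
  have step: "W (Suc j) c d = int CARD('k) * W j c d" if "k \<le> j" for j
  proof -
    have "W j c (d + monom t (Suc j) * c) = W j c d" for t
    proof -
      \<comment> \<open>\<open>x\<close> is a multiple of \<open>w\<close> with leading term t
        T^(j+1). Since n divides x c^2, translation by \<open>x\<close> fixes the point of P^1(A/n);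
        the difference \<open>\<beta>\<close> has degree at most \<open>j\<close> and is absorbed by
        \<open>triangular\<close>. So all q summands of \<open>split\<close> agree.\<close>
      define x where "x = monom t (Suc j - degree w) * w"
      define \<beta> where "\<beta> = monom t (Suc j) - x"
      have deg: "degree w \<le> Suc j"
        using w(2) that by simp
      have "degree \<beta> \<le> j"
      proof (rule degree_le, intro allI impI)
        fix i assume "j < i"
        show "coeff \<beta> i = 0"
        proof (cases "i = Suc j")
          case True
          then show ?thesis
            using w(1) deg by (simp add: \<beta>_def x_def coeff_monom_mult)
        next
          case False
          then show ?thesis
            using \<open>j < i\<close> deg by (simp add: \<beta>_def x_def coeff_monom_mult coeff_eq_0)
        qed
      qed
      have co: "coprime c (d + x * c)"
        using cd by (simp add: coprime_add_mult)
      have "W j c (d + monom t (Suc j) * c) = W j (smult 1 c) (\<beta> * c + smult 1 (d + x * c))"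
        by (simp add: \<beta>_def algebra_simps)
      also have "\<dots> = W j c (d + x * c)"
        using co \<open>degree \<beta> \<le> j\<close> by (intro triangular) auto
      also have "n dvd c * d - c * (d + x * c)"
      proof -
        have "c * d - c * (d + x * c) = - monom t (Suc j - degree w) * (w * c\<^sup>2)"
          by (simp add: x_def algebra_simps power2_eq_square)
        then show ?thesis
          using w(3) by (simp del: mult_minus_left)
      qed
      then have "W j c (d + x * c) = W j c d"
        using cong[OF co cd] by (simp add: mult.commute)
      finally show ?thesis .
    qed
    then show ?thesis
      by (simp add: split[OF cd])
  qed
  have pow: "W (k + i) c d = int CARD('k) ^ i * W k c d" for i
    by (induction i) (simp_all add: step)
  obtain B where B: "\<And>k c d. \<bar>W k c d\<bar> \<le> B"
    using bounded by blast
  show ?thesis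
  proof (rule ccontr)
    assume "W k c d \<noteq> 0"
    have "int i < B + 1" for i
    proof -
      have "i < 2 ^ i" by (rule less_exp)
      also have "2 ^ i \<le> CARD('k) ^ i"
        using card_field_ge_2 by (rule power_mono) simp
      finally have "int i \<le> int (CARD('k) ^ i)"
        by simp
      also have "\<dots> \<le> int CARD('k) ^ i * \<bar>W k c d\<bar>"
        using \<open>W k c d \<noteq> 0\<close> by (simp add: mult_le_cancel_left1)
      also have "\<dots> = \<bar>W (k + i) c d\<bar>"
        by (simp add: pow abs_mult)
      finally show ?thesis
        using B[of "k + i" c d] by linarith
    qed
    from this[of "nat (B + 1)"] show False by linarith
  qed
qed

lemma cusp_infinity: "W k 0 1 = 0"
  by (rule cusp[of _ _ 1]) auto

text \<open>In the vertex relation at (0, 1) all q summands are \<open>W 0 1 0\<close>, and the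
  remaining term is a value at infinity.\<close>

lemma cusp_zero: "W 0 1 0 = 0"
  using vertex[of 0 1] cusp_infinity[of 0] card_field_ge_2[where ?'k = 'k] by simp

text \<open>The vertex relation at (1, T). Up to column operations this is the only short vector
  that is neither a cusp nor of the form (T - s, 1).\<close>

lemma symbol_one_T: "W 0 1 [:0, 1:] = - (\<Sum>t\<in>UNIV. W 0 (lin t) 1)"
proof -
  have "W 0 1 [:0, 1:] + (\<Sum>t\<in>UNIV. W 0 (smult t 1 + [:0, 1:]) 1) = 0"
    by (rule vertex) simp
  moreover have "(\<Sum>t\<in>UNIV. W 0 (smult t 1 + [:0, 1:]) 1) = (\<Sum>t\<in>UNIV. W 0 (lin t) 1)"
    by (rule sum.reindex_bij_witness[of _ uminus uminus]) (auto simp: one_pCons lin_def)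
  ultimately show ?thesis by simp
qed

section \<open>Points that degenerate at a linear factor of the level\<close>

lemma cusp_multiple:
  assumes "n = lin r * h" "coprime c d" "h dvd c"
  shows "W 0 c d = 0"
proof (rule cusp)
  show "n dvd lin r * c\<^sup>2"
    using assms by (simp add: power2_eq_square mult_dvd_mono)
qed (use assms in \<open>auto simp: lead_coeff_lin\<close>)

text \<open>The cofactor of (T - r)^2 in the level is linear, so the cusp at (T - r : 1) has width
  at most one and the vanishing starts at level 0.\<close>

lemma double_root:
  assumes n: "n = lin r * h" and deg: "degree n = 3" and r: "poly h r = 0"
  shows "W 0 (lin r) 1 = 0"
proof -
  obtain w where w: "h = lin r * w"
    using r unfolding linear_dvd_iff[symmetric] ..
  have nw: "n = (lin r * lin r) * w"
    by (simp add: n w mult_ac)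
  obtain w' where w': "n = (lin r * lin r) * w'" "lead_coeff w' = 1" "degree n = degree (lin r * lin r) + degree w'"
    by (rule monic_dvd_factor[of n "lin r * lin r"])
      (use monic nw in \<open>simp_all only: lead_coeff_mult lead_coeff_lin mult_1 dvd_triv_left\<close>)
  show ?thesis
  proof (rule cusp)
    show "n dvd w' * (lin r)\<^sup>2"
      by (simp only: w'(1) power2_eq_square mult.commute dvd_refl)
    show "degree w' \<le> Suc 0"
      using w'(3) deg by (simp add: degree_mult_eq)
  qed (use w' in auto)
qed

text \<open>The multiples of \<open>h\<close> modulo \<open>n\<close> form a line over F_q, so once
  \<open>h\<close> divides \<open>d\<close> the class depends only on \<open>c(r)\<close> and on the
  value of \<open>d/h\<close> at \<open>r\<close>. Rescaling by constants leaves the three points (T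
  - r : h), (1 : 0) and (1 : h).\<close>

lemma degenerate_symbol:
  assumes n: "n = lin r * h" and cd: "coprime c d" "h dvd d"
  shows "poly c r = 0 \<Longrightarrow> W 0 c d = W 0 (lin r) h"
    and "poly c r \<noteq> 0 \<Longrightarrow> n dvd d \<Longrightarrow> W 0 c d = 0"
    and "poly c r \<noteq> 0 \<Longrightarrow> \<not> n dvd d \<Longrightarrow> W 0 c d = W 0 1 h"
proof -
  obtain e where e: "d = h * e"
    using cd(2) ..
  show "W 0 c d = W 0 (lin r) h" if r: "poly c r = 0"
  proof (rule cong)
    obtain c' where c': "c = lin r * c'"
      using r unfolding linear_dvd_iff[symmetric] ..
    have "poly h r \<noteq> 0"
    proof
      assume "poly h r = 0"
      then have "lin r dvd d" "lin r dvd c"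
        using r by (simp_all add: linear_dvd_iff e)
      then have "is_unit (lin r)"
        using cd(1) by (meson coprime_common_divisor)
      then show False
        by (simp add: lin_not_unit)
    qed
    then show "coprime (lin r) h"
      by (simp only: coprime_linear_iff not_False_eq_True)
    have "c * h - lin r * d = n * (c' - e)"
      by (simp only: c' e n ring_distribs mult_ac)
    then show "n dvd c * h - lin r * d" ..
  qed fact
  show "W 0 c d = 0" if "n dvd d"
  proof -
    have "W 0 c d = W 0 1 0"
      using that by (intro cong cd) auto
    then show ?thesis
      by (simp add: cusp_zero)
  qed
  show "W 0 c d = W 0 1 h" if r: "poly c r \<noteq> 0" and nd: "\<not> n dvd d"
  proof -
    \<comment> \<open>\<open>\<kappa>\<close> makes \<open>\<kappa> c - e\<close> vanish at
      \<open>r\<close>; multiplied by \<open>h\<close> this difference is divisible by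
      \<open>n\<close>, which moves (c : d) to (1 : \<kappa> h).\<close>
    define \<kappa> where "\<kappa> = poly e r / poly c r"
    have "poly e r \<noteq> 0"
    proof
      assume "poly e r = 0"
      then obtain e' where e': "e = lin r * e'"
        unfolding linear_dvd_iff[symmetric] ..
      have "d = n * e'"
        by (simp only: e e' n mult_ac)
      with nd show False by simp
    qed
    then have "\<kappa> \<noteq> 0"
      using r by (simp add: \<kappa>_def)
    have "poly (smult \<kappa> c - e) r = 0"
      using r by (simp add: \<kappa>_def)
    then obtain x where x: "smult \<kappa> c - e = lin r * x"
      unfolding linear_dvd_iff[symmetric] ..
    have "c * smult \<kappa> h - 1 * d = h * (smult \<kappa> c - e)"
      by (simp add: e algebra_simps)
    also have "\<dots> = n * x"
      by (simp only: x n mult_ac)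
    finally have "n dvd c * smult \<kappa> h - 1 * d"
      by simp
    then have "W 0 c d = W 0 1 (smult \<kappa> h)"
      by (intro cong cd) auto
    also have "\<dots> = W 0 (smult 1 1) (0 * 1 + smult \<kappa> h)"
      by (simp add: one_pCons)
    also have "\<dots> = W 0 1 h"
      using \<open>\<kappa> \<noteq> 0\<close> by (intro triangular) auto
    finally show ?thesis .
  qed
qed

text \<open>The cusp of (T - r : h) may have width two, so vanishing is only guaranteed from level 1
  on. Splitting the zero at level 1 gives q values at level 0 with sum 0, and all of them except the
  one for \<open>b = 0\<close> equal \<open>W 0 (lin r) 1\<close>.\<close>

lemma symbol_linear_cofactor_simple:
  assumes n: "n = lin r * h" and h: "lead_coeff h = 1" "degree h = 2" and r: "poly h r \<noteq> 0"
  shows "W 0 (lin r) h = - (int CARD('k) - 1) * W 0 (lin r) 1"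
proof -
  define h0 where "h0 = poly h r"
  have "lin r dvd h - [:h0:]"
    by (simp add: linear_dvd_iff h0_def)
  then obtain l where l: "h = lin r * l + [:h0:]"
    by (metis diff_add_cancel dvdE)
  have "degree [:h0:] < degree h"
    using h by simp
  then have "degree (h + - [:h0:]) = 2"
    using h by (subst degree_add_eq_left) auto
  then have "degree (h - [:h0:]) = 2"
    by (simp only: add_uminus_conv_diff)
  moreover from this have "lead_coeff (h - [:h0:]) = 1"
    using h by (simp add: coeff_pCons numeral_2_eq_2)
  moreover have "h - [:h0:] = lin r * l"
    using l by simp
  moreover from \<open>degree (h - [:h0:]) = 2\<close> this have "l \<noteq> 0"
    by auto
  ultimately have "lead_coeff (lin r * l) = 1" "degree l = 1"
    by (auto simp: degree_mult_eq)
  then have "lead_coeff l = 1" "degree l = 1"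
    by (simp_all only: lead_coeff_mult lead_coeff_lin mult_1)
  then obtain l0 where l0: "l = [:l0, 1:]"
    using degree_1_monic by blast
  have co: "coprime (lin r) h"
    using r by (simp only: coprime_linear_iff not_False_eq_True)
  have "W 1 (lin r) h = 0"
  proof (rule cusp)
    show "n dvd h * (lin r)\<^sup>2"
      by (simp add: n power2_eq_square mult.commute[of h] mult_dvd_mono)
  qed (use h co in auto)
  then have sum0: "(\<Sum>b\<in>UNIV. W 0 (lin r) (h + monom b 1 * lin r)) = 0"
    using split[OF co, of 0] by simp
  have other: "W 0 (lin r) (h + monom b 1 * lin r) = W 0 (lin r) 1" if "b \<noteq> 0" for b
  proof -
    have "h0 \<noteq> 0" using r by (simp add: h0_def)
    \<comment> \<open>From h = (T - r)(T + l0) + h0 one gets h + b T (T - r) = (1 + b) h - b l0 (T -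
      r) - b h0. The term (1 + b) h disappears because (T - r) h = n, and what is left is a
      triangular image of (T - r, 1).\<close>
    have "W 0 (lin r) 1 =
        W 0 (smult 1 (lin r)) ([:- b * l0:] * lin r + smult (- b * h0) 1)"
      using that \<open>h0 \<noteq> 0\<close> by (intro triangular[symmetric]) auto
    also have "\<dots> = W 0 (lin r) (h + monom b 1 * lin r)"
    proof (rule cong)
      show "coprime (smult 1 (lin r)) ([:- b * l0:] * lin r + smult (- b * h0) 1)"
        using that \<open>h0 \<noteq> 0\<close> by (simp add: coprime_linear_iff)
      show "coprime (lin r) (h + monom b 1 * lin r)"
        using co by (simp only: coprime_add_mult)
      have "smult 1 (lin r) * (h + monom b 1 * lin r) -
         lin r * ([:- b * l0:] * lin r + smult (- b * h0) 1) = n * [:1 + b:]"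
        unfolding n l l0 lin_def by (simp add: monom_altdef algebra_simps one_pCons)
      then show "n dvd smult 1 (lin r) * (h + monom b 1 * lin r) -
         lin r * ([:- b * l0:] * lin r + smult (- b * h0) 1)" ..
    qed
    finally show ?thesis by simp
  qed
  have "(\<Sum>b\<in>UNIV. W 0 (lin r) (h + monom b 1 * lin r)) =
      W 0 (lin r) (h + monom 0 1 * lin r) +
      (\<Sum>b\<in>UNIV - {0}. W 0 (lin r) (h + monom b 1 * lin r))"
    by (rule sum.remove) auto
  also have "(\<Sum>b\<in>UNIV - {0}. W 0 (lin r) (h + monom b 1 * lin r)) =
      (\<Sum>b\<in>UNIV - {0::'k}. W 0 (lin r) 1)"
    using other by (intro sum.cong) auto
  finally show ?thesis
    using sum0 card_field_ge_2[where ?'k = 'k] by (simp add: card_Diff_singleton of_nat_diff algebra_simps)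
qed

text \<open>The vertex relation at (h, 1): that symbol is a vanishing cusp value, and every (t h +
  1, h) is degenerate. If h(r) = 0 all summands agree. Otherwise one summand is
  \<open>W 0 (lin r) h = - (q - 1) W 0 (lin r) 1\<close> and the other q - 1 equal
  \<open>W 0 1 h\<close>; cancelling q - 1 keeps the relation integral.\<close>

lemma symbol_one_cofactor:
  assumes n: "n = lin r * h" and h: "lead_coeff h = 1" "degree h = 2"
  shows "W 0 1 h = (if poly h r = 0 then 0 else W 0 (lin r) 1)"
proof -
  have co: "coprime (smult t h + 1) h" for t
    by (rule coprime_polyI[of 1 _ "- [:t:]"]) simp
  have ndvd: "\<not> n dvd h"
  proof
    assume "n dvd h"
    moreover have "h \<noteq> 0" using h by auto
    ultimately have "degree n \<le> degree h" by (rule dvd_imp_degree_le)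
    moreover have "degree n = 1 + degree h"
      unfolding n using \<open>h \<noteq> 0\<close> by (subst degree_mult_eq) auto
    ultimately show False by simp
  qed
  have summand: "W 0 (smult t h + 1) h =
      (if poly (smult t h + 1) r = 0 then W 0 (lin r) h else W 0 1 h)" for t
    using degenerate_symbol[OF n co, of t] ndvd by auto
  have "W 0 h 1 = 0"
    by (rule cusp_multiple[OF n]) auto
  then have sum0: "(\<Sum>t\<in>UNIV. W 0 (smult t h + 1) h) = 0"
    using vertex[of h 1] by simp
  show ?thesis
  proof (cases "poly h r = 0")
    case True
    then show ?thesis
      using sum0 card_field_ge_2[where ?'k = 'k] by (simp add: summand)
  next
    case False
    define t0 where "t0 = - 1 / poly h r"
    have *: "poly (smult t h + 1) r = 0 \<longleftrightarrow> t = t0" for t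
      using False by (auto simp: t0_def field_simps eq_neg_iff_add_eq_0)
    have "(\<Sum>t\<in>UNIV. W 0 (smult t h + 1) h) =
       W 0 (smult t0 h + 1) h + (\<Sum>t\<in>UNIV - {t0}. W 0 (smult t h + 1) h)"
      by (rule sum.remove) auto
    also have "(\<Sum>t\<in>UNIV - {t0}. W 0 (smult t h + 1) h) = (\<Sum>t\<in>UNIV - {t0}. W 0 1 h)"
      unfolding summand * by (rule sum.cong) auto
    also have "W 0 (smult t0 h + 1) h = W 0 (lin r) h"
      unfolding summand * by simp
    finally have "(int CARD('k) - 1) * (W 0 1 h - W 0 (lin r) 1) = 0"
      using sum0 card_field_ge_2[where ?'k = 'k] symbol_linear_cofactor_simple[OF n h False]
      by (simp add: card_Diff_singleton of_nat_diff algebra_simps)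
    then show ?thesis
      using False card_field_ge_2[where ?'k = 'k] by auto
  qed
qed

text \<open>Constant column operations bring a coprime pair of degrees at most one to (0, 1), (1,
  0), (1, T) or (T - s, 1). The first two are cusps and the third is minus the sum of the basic
  values.\<close>

lemma small_symbol_dvd:
  assumes m: "\<And>s. m dvd W 0 (lin s) 1" and uv: "coprime u v" "degree u \<le> 1" "degree v \<le> 1"
  shows "m dvd W 0 u v"
proof -
  obtain u0 u1 where u: "u = [:u0, u1:]"
    using uv(2) by (rule degree_le_1_cases)
  obtain v0 v1 where v: "v = [:v0, v1:]"
    using uv(3) by (rule degree_le_1_cases)
  consider "u = 0" | "u \<noteq> 0" "u1 = 0" | "u1 \<noteq> 0"
    by blast
  then show ?thesis
  proof cases
    case 1
    have "W 0 u v = W 0 0 1"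
      using uv(1) by (intro cong) (auto simp: 1)
    then show ?thesis
      by (simp add: cusp_infinity)
  next
    case 2
    then have [simp]: "u1 = 0" "u0 \<noteq> 0" by (auto simp: u)
    show ?thesis
    proof (cases "v1 = 0")
      case True
      have "W 0 (smult u0 1) ([:v0:] * 1 + smult 1 0) = W 0 1 0"
        by (intro triangular) auto
      then show ?thesis
        by (simp add: u v True one_pCons cusp_zero[unfolded one_pCons])
    next
      case False
      have "W 0 (smult u0 1) ([:v0:] * 1 + smult v1 [:0, 1:]) = W 0 1 [:0, 1:]"
        using False by (intro triangular) auto
      then have "W 0 u v = W 0 1 [:0, 1:]"
        by (simp add: u v one_pCons)
      then show ?thesis
        by (simp add: symbol_one_T m dvd_sum)
    qed
  next
    case 3
    define s where "s = - u0 / u1"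
    define e where "e = v0 - v1 / u1 * u0"
    have us: "u = smult u1 (lin s)"
      using 3 by (simp add: u s_def lin_def)
    have v': "v = [:v1:] * lin s + smult e 1"
      using 3 by (simp add: v lin_def s_def e_def one_pCons)
    have "e \<noteq> 0"
    proof
      assume "e = 0"
      then have "lin s dvd u" "lin s dvd v"
        by (simp_all add: us v' dvd_smult)
      then show False
        using uv(1) lin_not_unit coprime_common_divisor by blast
    qed
    then have "W 0 u v = W 0 (lin s) 1"
      unfolding us v' using 3 by (intro triangular) auto
    then show ?thesis
      by (simp add: m)
  qed
qed

text \<open>Pigeonhole, where degree three is decisive: there are q^4 pairs of polynomials of degree
  at most one, but only q^3 residues modulo \<open>n\<close>.\<close>

lemma small_vector:
  assumes "degree n = 3"
  obtains u v where "u \<noteq> 0 \<or> v \<noteq> 0" "degree u \<le> 1" "degree v \<le> 1" "n dvd c * v - u * d"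
proof -
  let ?P = "polys_below 2 \<times> polys_below 2 :: ('k poly \<times> 'k poly) set"
  define \<phi> where "\<phi> = (\<lambda>(u, v). (c * v - u * d) mod n)"
  have "n \<noteq> 0" using assms by auto
  have "\<phi> ` ?P \<subseteq> polys_below 3"
    using degree_mod_less[OF \<open>n \<noteq> 0\<close>] assms by (auto simp: \<phi>_def polys_below_def)
  then have "card (\<phi> ` ?P) \<le> CARD('k) ^ 3"
    using card_mono[OF finite_polys_below] by (metis card_polys_below)
  also have "\<dots> < CARD('k) ^ 4"
    using card_field_ge_2[where ?'k = 'k] by (intro power_strict_increasing) auto
  also have "\<dots> = card ?P"
    by (simp add: card_cartesian_product card_polys_below power_add[symmetric])
  finally have "\<not> inj_on \<phi> ?P"
    using card_image[of \<phi> ?P] by auto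
  then obtain u v u' v' where *: "(u, v) \<in> ?P" "(u', v') \<in> ?P" "(u, v) \<noteq> (u', v')" "\<phi> (u, v) = \<phi> (u', v')"
    unfolding inj_on_def by auto
  have "n dvd (c * v - u * d) - (c * v' - u' * d)"
    using *(4) by (simp add: \<phi>_def mod_eq_dvd_iff)
  then have "n dvd c * (v - v') - (u - u') * d"
    by (simp add: algebra_simps)
  moreover have "degree (u - u') \<le> 1" "degree (v - v') \<le> 1"
    using *(1,2) by (auto simp: polys_below_def intro!: degree_diff_le)
  ultimately show ?thesis
    using that[of "u - u'" "v - v'"] *(3) by auto
qed

lemma common_linear_factor:
  fixes u v :: "'k poly"
  assumes "u \<noteq> 0 \<or> v \<noteq> 0" "degree u \<le> 1" "degree v \<le> 1" "\<not> coprime u v"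
  obtains r a b where "u = smult a (lin r)" "v = smult b (lin r)" "a \<noteq> 0 \<or> b \<noteq> 0"
proof -
  obtain g where g: "g dvd u" "g dvd v" "\<not> is_unit g"
    using assms(4) by (meson coprimeI)
  have "g \<noteq> 0" using g assms(1) by auto
  then have "degree g \<noteq> 0"
    using g(3) by (simp add: is_unit_iff_degree)
  moreover have "degree g \<le> 1"
    using assms g by (meson dvd_imp_degree_le le_trans)
  ultimately have "degree g = 1" by simp
  then obtain g0 g1 where g01: "g = [:g0, g1:]"
    using degree_le_1_cases[of g] by auto
  have "g1 \<noteq> 0" using \<open>degree g = 1\<close> by (auto simp: g01)
  define r where "r = - g0 / g1"
  have gr: "g = smult g1 (lin r)"
    using \<open>g1 \<noteq> 0\<close> by (simp add: g01 r_def lin_def)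
  have *: "\<exists>a. x = smult a (lin r)" if x: "g dvd x" "degree x \<le> 1" for x
  proof -
    obtain y where y: "x = g * y" using x(1) ..
    show ?thesis
    proof (cases "y = 0")
      case False
      then have "degree y = 0"
        using x(2) \<open>degree g = 1\<close> \<open>g \<noteq> 0\<close> by (simp add: y degree_mult_eq)
      then obtain a where "y = [:a:]" by (rule degree_eq_zeroE)
      then have "x = smult (a * g1) (lin r)"
        by (simp add: y gr)
      then show ?thesis ..
    qed (auto simp: y intro: exI[of _ 0])
  qed
  obtain a b where "u = smult a (lin r)" "v = smult b (lin r)"
    using * g assms by meson
  then show ?thesis
    using that assms(1) by auto
qed

text \<open>Divisibility replaces explicit integral formulas for the symbols: \<open>m = 0\<close>
  shows that the basic values determine all others, and nonzero \<open>m\<close> makes the lattice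
  of coordinate vectors saturated.\<close>

theorem symbol_dvd:
  assumes deg: "degree n = 3" and m: "\<And>s. m dvd W 0 (lin s) 1" and cd: "coprime c d"
  shows "m dvd W 0 c d"
proof -
  obtain u v where uv: "u \<noteq> 0 \<or> v \<noteq> 0" "degree u \<le> 1" "degree v \<le> 1" "n dvd c * v - u * d"
    using small_vector[OF deg] .
  show ?thesis
  proof (cases "coprime u v")
    case True
    then have "W 0 c d = W 0 u v"
      using uv cd by (intro cong) auto
    then show ?thesis
      using small_symbol_dvd[OF m True uv(2,3)] by simp
  next
    case False
    obtain r a b where r: "u = smult a (lin r)" "v = smult b (lin r)" "a \<noteq> 0 \<or> b \<noteq> 0"
      using common_linear_factor[OF uv(1-3) False] .
    have eq: "c * v - u * d = lin r * (c * [:b:] - [:a:] * d)"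
      by (simp add: r algebra_simps)
    show ?thesis
    proof (cases "poly n r = 0")
      \<comment> \<open>A common factor T - r prime to the level cancels from the congruence, and
        the constant pair (a, b) is a representative.\<close>
      case False
      then have n: "n dvd c * [:b:] - [:a:] * d"
        using uv(4) unfolding eq by (rule dvd_linear_mult_cancel[rotated])
      have co: "coprime [:a:] [:b:]"
        using r(3) by (metis coprime_1_right coprime_1_left is_unit_left_imp_coprime
            is_unit_right_imp_coprime is_unit_triv)
      then have "W 0 c d = W 0 [:a:] [:b:]"
        using n cd by (intro cong) auto
      then show ?thesis
        using small_symbol_dvd[OF m co] by simp
    next
      case True
      then have "lin r dvd n" by (simp add: linear_dvd_iff)
      then obtain h where h: "n = lin r * h" "lead_coeff h = 1" "degree n = degree (lin r) + degree h"
        using monic_dvd_factor[OF monic lead_coeff_lin] by blast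
      have h2: "degree h = 2" using h(3) deg by simp
      have "h dvd c * [:b:] - [:a:] * d"
        using uv(4) unfolding eq h(1) by (simp only: dvd_mult_cancel_left lin_nonzero simp_thms)
      show ?thesis
      proof (cases "a = 0")
        case True
        then have "h dvd c"
          using \<open>h dvd c * [:b:] - [:a:] * d\<close> r(3) by (simp add: dvd_smult_iff)
        then show ?thesis
          using cusp_multiple[OF h(1) cd] by simp
      next
        case False
        \<comment> \<open>A constant column operation, permitted at level 0, transfers the
          divisibility by \<open>h\<close> from b c - a d to the second entry, so that the
          degenerate case applies.\<close>
        define d' where "d' = d + [:- b / a:] * c"
        have "d' = smult (- 1 / a) (c * [:b:] - [:a:] * d)"
          using False by (simp add: d'_def algebra_simps smult_diff_right)
        then have hd: "h dvd d'"
          using \<open>h dvd c * [:b:] - [:a:] * d\<close> by (simp only: dvd_smult)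
        have co: "coprime c d'"
          using cd by (simp only: d'_def coprime_add_mult)
        have "W 0 (smult 1 c) ([:- b / a:] * c + smult 1 d) = W 0 c d"
          using cd by (intro triangular) auto
        then have W: "W 0 c d = W 0 c d'"
          by (simp add: d'_def add.commute)
        have "m dvd W 0 1 h"
          using m by (simp add: symbol_one_cofactor[OF h(1,2) h2])
        moreover have "m dvd W 0 (lin r) h" if "poly c r = 0"
        proof -
          have "poly h r \<noteq> 0"
          proof
            assume "poly h r = 0"
            then have "lin r dvd d'" "lin r dvd c"
              using hd that by (auto simp: linear_dvd_iff elim: dvdE)
            then show False
              using co lin_not_unit coprime_common_divisor by blast
          qed
          then show ?thesis
            using m by (simp add: symbol_linear_cofactor_simple[OF h(1,2) h2])
        qed
        ultimately show ?thesis
          unfolding W using degenerate_symbol[OF h(1) co hd]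
          by (cases "poly c r = 0"; cases "n dvd d'") auto
      qed
    qed
  qed
qed

theorem symbol_dvd_all:
  assumes deg: "degree n = 3" and m: "\<And>s. m dvd W 0 (lin s) 1" and cd: "coprime c d"
  shows "m dvd W k c d"
  using cd
proof (induction k arbitrary: d)
  case 0
  then show ?case using symbol_dvd[OF deg m] by blast
next
  case (Suc k)
  then show ?case
    by (simp add: split coprime_add_mult dvd_sum)
qed

end

subsection \<open>Symbols of a harmonic cochain\<close>

definition tpow :: "int \<Rightarrow> 'k::field fls" where
  "tpow k = fls_X powi (- k)"

lemma tpow_nonzero [simp]: "tpow k \<noteq> 0"
  unfolding tpow_def by (metis power_int_eq_0_iff fls_X_nonzero)

lemma tpow_0 [simp]: "tpow 0 = 1"
  by (simp add: tpow_def)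

lemma tpow_add: "tpow (k + l) = tpow k * tpow l"
  unfolding tpow_def minus_add_distrib by (rule power_int_add) simp

lemma tpow_minus_1: "tpow (- 1) = fls_X"
  unfolding tpow_def minus_minus power_int_1_right ..

lemma tpow_1: "tpow 1 = fls_X_inv"
proof -
  have "tpow 1 * tpow (- 1) = (fls_X_inv * fls_X :: 'a fls)"
    by (simp add: tpow_add[symmetric])
  then show ?thesis
    unfolding tpow_minus_1 by (metis fls_X_nonzero mult_right_cancel)
qed

lemma tpow_nat: "tpow (int k) = fls_X_inv ^ k"
  by (induction k) (simp_all add: tpow_add tpow_1)

lemma tpow_minus_nat: "tpow (- int k) = fls_X ^ k"
proof (induction k)
  case (Suc k)
  have "tpow (- int (Suc k)) = tpow (- 1) * (tpow (- int k) :: 'a fls)"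
    by (simp add: tpow_add[symmetric])
  then show ?case unfolding Suc tpow_minus_1 by simp
qed simp

lemma tpow_val_ge: "tpow k \<in> val_ge (- k)"
  unfolding tpow_def val_ge_iff by simp

lemma A_to_Finf_monom_tpow: "A_to_Finf (monom t k) = fls_const t * tpow (int k)"
  by (simp add: A_to_Finf_monom tpow_nat)

abbreviation poly_mat :: "'k::finite_field poly \<Rightarrow> 'k poly \<Rightarrow> 'k poly \<Rightarrow> 'k poly \<Rightarrow> 'k fls^2^2" where
  "poly_mat a b c d \<equiv> mat2 (A_to_Finf a) (A_to_Finf b) (A_to_Finf c) (A_to_Finf d)"

text \<open>The matrix \<gamma> diag(T^k, 1), where \<gamma> has the entries \<open>a\<close>,
  \<open>b\<close>, \<open>c\<close>, \<open>d\<close>.\<close>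

definition symbol_edge :: "int \<Rightarrow> 'k::finite_field poly \<Rightarrow> 'k poly \<Rightarrow> 'k poly \<Rightarrow> 'k poly \<Rightarrow> 'k fls^2^2"
  where "symbol_edge k a b c d =
    mat2 (A_to_Finf a * tpow k) (A_to_Finf b) (A_to_Finf c * tpow k) (A_to_Finf d)"

lemma symbol_edge_GL2: "a * d - b * c dvd 1 \<Longrightarrow> symbol_edge k a b c d \<in> GL2_Finf"
proof -
  assume "a * d - b * c dvd 1"
  then have "a * d - b * c \<noteq> 0"
    by auto
  then have "A_to_Finf (a * d - b * c) * tpow k \<noteq> 0"
    by (simp only: A_to_Finf_eq_0_iff tpow_nonzero mult_eq_0_iff simp_thms)
  then show ?thesis
    by (simp add: symbol_edge_def GL2_Finf_mat2_iff algebra_simps)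
qed

lemma Gamma0I:
  "a * d - b * c dvd 1 \<Longrightarrow> n dvd c \<Longrightarrow>
   poly_mat a b c d \<in> Gamma0 n"
  unfolding Gamma0_def
  by (intro image_eqI[of _ _ "mat2 a b c d"]) (auto simp: map_matrix_mat2 invertible_mat2_iff)

text \<open>The element is the second unimodular matrix times the inverse of the first. Its lower
  left entry is a unit times c' d - d' c, so congruence of the bottom rows is precisely what puts it
  into \<open>Gamma0 n\<close>.\<close>

lemma symbol_edge_Gamma0:
  assumes u: "a * d - b * c dvd 1" and u': "a' * d' - b' * c' dvd 1" and n: "n dvd c * d' - c' * d"
  obtains g where "g \<in> Gamma0 n" "symbol_edge k a' b' c' d' = g ** symbol_edge k a b c d"
proof -
  obtain e where e: "1 = (a * d - b * c) * e"
    using u ..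
  define p q r s where "p = e * (a' * d - b' * c)" and "q = e * (b' * a - a' * b)"
    and "r = e * (c' * d - d' * c)" and "s = e * (d' * a - c' * b)"
  have pqrs: "p * a + q * c = a' * ((a * d - b * c) * e)"
    "p * b + q * d = b' * ((a * d - b * c) * e)"
    "r * a + s * c = c' * ((a * d - b * c) * e)"
    "r * b + s * d = d' * ((a * d - b * c) * e)"
    by (simp_all add: p_def q_def r_def s_def algebra_simps)
  have "p * s - q * r = e * (a' * d' - b' * c') * ((a * d - b * c) * e)"
    by (simp add: p_def q_def r_def s_def algebra_simps)
  also have "\<dots> = e * (a' * d' - b' * c')"
    by (simp add: e[symmetric])
  also have "\<dots> dvd 1"
    using u' e by (metis dvd_triv_right is_unit_mult_iff)
  finally have "p * s - q * r dvd 1" .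
  moreover have "n dvd r"
    using n by (metis dvd_diff_commute dvd_mult mult.commute r_def)
  ultimately have "poly_mat p q r s \<in> Gamma0 n"
    by (rule Gamma0I)
  moreover have "symbol_edge k a' b' c' d' =
      poly_mat p q r s ** symbol_edge k a b c d"
  proof -
    have eqs: "A_to_Finf a' = A_to_Finf (p * a + q * c)" "A_to_Finf b' = A_to_Finf (p * b + q * d)"
      "A_to_Finf c' = A_to_Finf (r * a + s * c)" "A_to_Finf d' = A_to_Finf (r * b + s * d)"
      unfolding pqrs e[symmetric] by simp_all
    show ?thesis
      unfolding symbol_edge_def mat2_mult eqs by (simp add: algebra_simps)
  qed
  ultimately show ?thesis
    using that by blast
qed

text \<open>The shift by one comes from the entry \<pi> of \<open>rev_mat\<close>. Up to sign,
  negative levels thereby reduce to levels at least 0.\<close>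

lemma symbol_edge_reverse:
  "edge_class (symbol_edge k b a d c ** rev_mat) = edge_class (symbol_edge (- k - 1) a b c d)"
proof -
  have t: "tpow (- k - 1) * tpow k = (fls_X :: 'a fls)"
    unfolding tpow_minus_1[symmetric] tpow_add[symmetric] by simp
  have "symbol_edge k b a d c ** rev_mat = symbol_edge (- k - 1) a b c d ** mat (tpow k)"
    by (simp add: symbol_edge_def mat2_mult mat_eq_mat2 mult.assoc t)
  then show ?thesis
    by (simp add: edge_class_mat)
qed

section \<open>Values of an invariant cochain as a function of bottom rows\<close>

locale invariant_cochain =
  fixes n :: "'k::finite_field poly" and f :: "('k, int) cochain"
  assumes harmonic: "harmonic_cochain f"
    and invariant: "\<And>g. g \<in> Gamma0 n \<Longrightarrow> slash f g = f"
begin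

definition V :: "int \<Rightarrow> 'k poly \<Rightarrow> 'k poly \<Rightarrow> 'k poly \<Rightarrow> 'k poly \<Rightarrow> int" where
  "V k a b c d = f (edge_class (symbol_edge k a b c d))"

lemma invariant_edge: "g \<in> Gamma0 n \<Longrightarrow> f (edge_class (g ** h)) = f (edge_class h)"
  using invariant[of g] by (metis edge_act_edge_class slash_def)

lemma V_bottom:
  assumes "a * d - b * c dvd 1" "a' * d' - b' * c' dvd 1" "n dvd c * d' - c' * d"
  shows "V k a b c d = V k a' b' c' d'"
proof -
  obtain g where "g \<in> Gamma0 n" "symbol_edge k a' b' c' d' = g ** symbol_edge k a b c d"
    using symbol_edge_Gamma0[OF assms] .
  then show ?thesis
    by (simp add: V_def invariant_edge)
qed

text \<open>Conjugation by diag(T^k, 1) multiplies the upper right entry by T^(-k). The result is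
  integral because \<open>\<beta>\<close> has degree at most \<open>k\<close>, so these triangular
  matrices fix the edge.\<close>

lemma V_triangular:
  assumes "\<alpha> \<noteq> 0" "\<delta> \<noteq> 0" "degree \<beta> \<le> k"
  shows "V (int k) (smult \<alpha> a) (\<beta> * a + smult \<delta> b) (smult \<alpha> c) (\<beta> * c + smult \<delta> d) =
         V (int k) a b c d"
proof -
  have t: "tpow (int k) * tpow (- int k) = (1 :: 'k fls)"
    by (simp add: tpow_add[symmetric])
  have "A_to_Finf \<beta> * tpow (- int k) \<in> val_ge (- int k + int k)"
    using A_to_Finf_val_ge[OF assms(3)] tpow_val_ge[of "- int k"] by (intro val_ge_mult) auto
  then have v: "A_to_Finf \<beta> * tpow (- int k) \<in> val_ge 0"
    by simp
  have eq: "x * tpow (int k) * (A_to_Finf \<beta> * tpow (- int k)) = A_to_Finf \<beta> * x" for x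
    using t by (metis (no_types, lifting) mult.assoc mult.commute mult_1_right)
  have "edge_class (symbol_edge (int k) (smult \<alpha> a) (\<beta> * a + smult \<delta> b) (smult \<alpha> c) (\<beta> * c + smult \<delta> d)) =
      edge_class (symbol_edge (int k) a b c d)"
  proof (rule edge_class_eqI)
    show "symbol_edge (int k) (smult \<alpha> a) (\<beta> * a + smult \<delta> b) (smult \<alpha> c) (\<beta> * c + smult \<delta> d) =
      symbol_edge (int k) a b c d ** mat2 (1 * fls_const \<alpha>) (1 * (A_to_Finf \<beta> * tpow (- int k)))
        (1 * 0) (1 * fls_const \<delta>)"
      by (simp add: symbol_edge_def mat2_mult t mult_ac)
  qed (use assms v in auto)
  then show ?thesis by (simp add: V_def)
qed

lemma V_split:
  assumes "a * d - b * c dvd 1"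
  shows "V (int (Suc k)) a b c d =
    (\<Sum>t\<in>UNIV. V (int k) a (b + monom t (Suc k) * a) c (d + monom t (Suc k) * c))"
proof -
  have t: "tpow (int (Suc k)) * fls_X = (tpow (int k) :: 'k fls)"
    unfolding tpow_minus_1[symmetric] tpow_add[symmetric] by simp
  have "symbol_edge (int (Suc k)) a b c d ** mat2 fls_X (fls_const t) 0 1 =
      symbol_edge (int k) a (b + monom t (Suc k) * a) c (d + monom t (Suc k) * c)" for t
    by (simp only: symbol_edge_def mat2_mult mult.assoc t) (simp add: A_to_Finf_monom_tpow mult_ac add.commute)
  then show ?thesis
    using harmonic_split[OF harmonic symbol_edge_GL2[OF assms]] by (simp add: V_def)
qed

lemma V_vertex:
  assumes "a * d - b * c dvd 1"
  shows "V 0 a b c d + (\<Sum>t\<in>UNIV. V 0 (smult t a + b) a (smult t c + d) c) = 0"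
proof -
  have "symbol_edge 0 a b c d ** mat2 (fls_const t) 1 1 0 = symbol_edge 0 (smult t a + b) a (smult t c + d) c" for t
    by (simp add: symbol_edge_def mat2_mult mult_ac)
  then show ?thesis
    using harmonic_origin_sum[OF harmonic symbol_edge_GL2[OF assms, of 0]] by (simp add: V_def)
qed

lemma V_reverse:
  assumes "a * d - b * c dvd 1"
  shows "V (- k - 1) a b c d = - V k b a d c"
proof -
  have "b * c - a * d dvd 1"
    using assms by (metis minus_diff_eq minus_dvd_iff)
  then have GL: "symbol_edge k b a d c \<in> GL2_Finf"
    by (rule symbol_edge_GL2)
  show ?thesis
    using harmonic_rev[OF harmonic GL] by (simp add: V_def symbol_edge_reverse)
qed

text \<open>\<open>V_bottom\<close> makes the choice of the top row irrelevant;
  \<open>V_eq_W\<close> then allows any completion with unit determinant.\<close>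

definition W :: "nat \<Rightarrow> 'k poly \<Rightarrow> 'k poly \<Rightarrow> int" where
  "W k c d = (let (a, b) = SOME (a, b). a * d - b * c = 1 in V (int k) a b c d)"

lemma V_eq_W:
  assumes "a * d - b * c dvd 1"
  shows "V (int k) a b c d = W k c d"
proof -
  obtain e where e: "1 = (a * d - b * c) * e"
    using assms ..
  obtain a' b' where ab: "(SOME (a, b). a * d - b * c = 1) = (a', b')"
    by fastforce
  have "\<exists>p. case p of (a, b) \<Rightarrow> a * d - b * c = 1"
    by (intro exI[of _ "(e * a, e * b)"]) (use e in \<open>simp add: algebra_simps\<close>)
  from someI_ex[OF this] have "a' * d - b' * c = 1"
    by (simp add: ab)
  then have "V (int k) a b c d = V (int k) a' b' c d"
    using assms by (intro V_bottom) auto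
  then show ?thesis
    by (simp add: W_def ab)
qed

lemma coprime_completion:
  fixes c d :: "'k poly"
  assumes "coprime c d"
  obtains a b where "a * d - b * c = 1"
proof -
  obtain x y where "x * c + y * d = 1"
    using bezout_poly[OF assms] .
  then have "y * d - (- x) * c = 1"
    by (simp add: algebra_simps)
  with that show ?thesis by blast
qed

lemma unimodular_coprime: "a * d - b * c dvd 1 \<Longrightarrow> coprime c d" for a b c d :: "'k poly"
  by (rule coprime_polyI[of "- b" _ a]) (simp add: algebra_simps)

end

text \<open>Finitely many values instead of finite support modulo \<open>Gamma0 n\<close>:
  equivalent by \<open>H0_iff\<close>, and evidently inherited by sums, by quotients by integers and
  by Hecke images.\<close>

locale bounded_cochain = invariant_cochain n f
  for n :: "'k::finite_field poly" and f :: "('k, int) cochain" +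
  assumes monic: "lead_coeff n = 1" and finite_values: "finite (range f)"

text \<open>\<open>cong\<close> expresses invariance under \<open>Gamma0 n\<close>,
  \<open>triangular\<close> the stabilizer of the edge, \<open>split\<close> and
  \<open>vertex\<close> harmonicity at its origin, and \<open>bounded\<close> the finiteness of the
  set of values.\<close>

sublocale bounded_cochain \<subseteq> manin_symbols n W
proof
  show "lead_coeff n = 1" by (rule monic)
next
  fix k c d c' d'
  assume co: "coprime c d" "coprime c' d'" and n: "n dvd c * d' - c' * d"
  obtain a b a' b' where "a * d - b * c = 1" "a' * d' - b' * c' = 1"
    using co coprime_completion by metis
  then show "W k c d = W k c' d'"
    using V_bottom[of a d b c a' d' b' c' "int k"] n V_eq_W by simp
next
  fix k and c d \<beta> :: "'k poly" and \<alpha> \<delta> :: 'k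
  assume *: "coprime c d" "\<alpha> \<noteq> 0" "\<delta> \<noteq> 0" "degree \<beta> \<le> k"
  obtain a b where ab: "a * d - b * c = 1"
    using *(1) by (rule coprime_completion)
  have "smult \<alpha> a * (\<beta> * c + smult \<delta> d) - (\<beta> * a + smult \<delta> b) * smult \<alpha> c = smult (\<alpha> * \<delta>) (a * d - b * c)"
    by (simp add: algebra_simps smult_diff_right)
  also have "\<dots> = [:\<alpha> * \<delta>:]"
    by (simp add: ab)
  also have "\<dots> dvd 1"
    using * by (intro is_unit_triv) simp
  finally have "smult \<alpha> a * (\<beta> * c + smult \<delta> d) - (\<beta> * a + smult \<delta> b) * smult \<alpha> c dvd 1" .
  then show "W k (smult \<alpha> c) (\<beta> * c + smult \<delta> d) = W k c d"
    using V_triangular[OF *(2-4), of a b c d] V_eq_W ab by simp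
next
  fix k and c d :: "'k poly" assume "coprime c d"
  then obtain a b where ab: "a * d - b * c = 1"
    by (rule coprime_completion)
  have *: "a * (d + monom t (Suc k) * c) - (b + monom t (Suc k) * a) * c dvd 1" for t
    using ab by (simp add: algebra_simps)
  have "W (Suc k) c d = V (int (Suc k)) a b c d"
    by (rule V_eq_W[symmetric]) (simp add: ab)
  then show "W (Suc k) c d = (\<Sum>t\<in>UNIV. W k c (d + monom t (Suc k) * c))"
    using V_split[of a d b c k] by (simp only: V_eq_W[OF *] ab dvd_refl)
next
  fix c d :: "'k poly" assume "coprime c d"
  then obtain a b where ab: "a * d - b * c = 1"
    by (rule coprime_completion)
  have "(smult t a + b) * c - a * (smult t c + d) = - (a * d - b * c)" for t
    by (simp add: algebra_simps)
  then have *: "(smult t a + b) * c - a * (smult t c + d) dvd 1" for t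
    by (simp add: ab)
  show "W 0 c d + (\<Sum>t\<in>UNIV. W 0 (smult t c + d) c) = 0"
    using V_vertex[of a d b c] V_eq_W[OF *, of 0] V_eq_W[of a d b c 0] ab by simp
next
  obtain B where B: "\<And>x. x \<in> range f \<Longrightarrow> \<bar>x\<bar> \<le> B"
    using finite_imageI[OF finite_values, of abs] by (metis Max_ge imageI)
  have "\<bar>W k c d\<bar> \<le> B" for k c d
    by (auto simp: W_def V_def split: prod.splits intro: B)
  then show "\<exists>B. \<forall>k c d. \<bar>W k c d\<bar> \<le> B" by blast
qed

subsection \<open>Reduction theory\<close>

lemma left_mult_symbol_edge:
  "poly_mat p q r s ** symbol_edge l a b c d =
   symbol_edge l (p * a + q * c) (p * b + q * d) (r * a + s * c) (r * b + s * d)"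
  by (simp add: symbol_edge_def mat2_mult algebra_simps)

definition is_symbol_edge :: "('k::finite_field fls^2^2) set \<Rightarrow> bool" where
  "is_symbol_edge e \<longleftrightarrow> (\<exists>l a b c d. a * d - b * c dvd 1 \<and> e = edge_class (symbol_edge l a b c d))"

lemma is_symbol_edge_left_mult:
  assumes "is_symbol_edge (edge_class g)" "p * s - q * r dvd 1"
  shows "is_symbol_edge (edge_class (poly_mat p q r s ** g))"
proof -
  obtain l a b c d where *: "a * d - b * c dvd 1" "edge_class g = edge_class (symbol_edge l a b c d)"
    using assms(1) by (auto simp: is_symbol_edge_def)
  let ?m = "poly_mat p q r s"
  have "edge_class (?m ** g) = edge_class (?m ** symbol_edge l a b c d)"
    by (simp add: edge_act_edge_class[symmetric] *(2))
  moreover have "(p * a + q * c) * (r * b + s * d) - (p * b + q * d) * (r * a + s * c) =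
      (p * s - q * r) * (a * d - b * c)"
    by (simp add: algebra_simps)
  then have "(p * a + q * c) * (r * b + s * d) - (p * b + q * d) * (r * a + s * c) dvd 1"
    using *(1) assms(2) by (simp only: is_unit_mult_iff simp_thms)
  ultimately show ?thesis
    unfolding is_symbol_edge_def left_mult_symbol_edge by blast
qed

lemma fls_subdegree_tpow: "fls_subdegree (tpow k) = - k"
  by (simp add: tpow_def)

text \<open>Euclid's algorithm: translate \<open>u\<close> into the maximal ideal, then invert it.\<close>

lemma upper_edge_reduction:
  "is_symbol_edge (edge_class (mat2 (tpow (- k)) u 0 1))" for u :: "'k::finite_field fls"
proof (induction "nat k" arbitrary: k u rule: less_induct)
  case less
  obtain p where p: "u - A_to_Finf p \<in> val_ge 1"
    by (rule fls_polynomial_part)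
  define u' where "u' = u - A_to_Finf p"
  have "is_symbol_edge (edge_class (mat2 (tpow (- k)) u' 0 1))"
  proof (cases "u' \<in> val_ge k")
    case True
    have "edge_class (mat2 (tpow (- k)) u' 0 1) = edge_class (symbol_edge (- k) 1 0 0 1)"
    proof (rule edge_class_eqI)
      have "tpow (- k) * tpow k = (1 :: 'k fls)"
        by (simp add: tpow_add[symmetric])
      then have "tpow (- k) * (tpow k * u') = u'"
        by (metis mult.assoc mult_1)
      then show "mat2 (tpow (- k)) u' 0 1 =
          symbol_edge (- k) 1 0 0 1 ** mat2 (1 * 1) (1 * (tpow k * u')) (1 * 0) (1 * 1)"
        by (simp add: symbol_edge_def mat2_mult)
      show "tpow k * u' \<in> val_ge 0"
        using val_ge_mult[OF tpow_val_ge True, of k] by simp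
    qed auto
    moreover have "(1 :: 'k poly) * 1 - 0 * 0 dvd 1"
      by simp
    ultimately show ?thesis
      unfolding is_symbol_edge_def by blast
  next
    case False
    define j where "j = fls_subdegree u'"
    have u': "u' \<noteq> 0" "1 \<le> j" "j < k"
      using False p unfolding val_ge_iff u'_def[symmetric] j_def[symmetric] by auto
    \<comment> \<open>The second factor below must be \<open>u'\<close> times an Iwahori matrix with
      lower row (\<zeta>, 1), which forces these values. \<open>\<epsilon>\<close> has valuation 0
      and \<open>\<zeta>\<close> has valuation \<open>k - j\<close>. As 1 \<le> j < k, the new
      exponent \<open>k - 2 j\<close> is smaller, and \<open>nat\<close> sends negative ones to 0,
      so the induction terminates.\<close>
    define \<epsilon> where "\<epsilon> = - (inverse u' * inverse u' * tpow (- 2 * j))"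
    define \<zeta> where "\<zeta> = tpow (- k) * inverse u'"
    have sub: "fls_subdegree u' = j"
      by (simp add: j_def)
    have unit: "fls_unit \<epsilon>" "\<zeta> \<in> val_ge 1"
      using u' unfolding \<epsilon>_def \<zeta>_def fls_unit_iff val_ge_iff
      by (simp_all add: fls_subdegree_tpow fls_inverse_subdegree sub)
    have "edge_class (mat2 0 1 (tpow (- k)) u') = edge_class (mat2 (tpow (- (k - 2 * j))) (inverse u') 0 1)"
    proof (rule edge_class_eqI)
      have t: "tpow (- (k - 2 * j)) * tpow (- 2 * j) = (tpow (- k) :: 'k fls)"
        by (simp add: tpow_add[symmetric])
      have "tpow (- (k - 2 * j)) * (u' * \<epsilon>) + inverse u' * (u' * \<zeta>) =
         inverse u' * (u' * inverse u') * (tpow (- k) - tpow (- (k - 2 * j)) * tpow (- 2 * j))"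
        by (simp add: \<epsilon>_def \<zeta>_def algebra_simps)
      then have 1: "tpow (- (k - 2 * j)) * (u' * \<epsilon>) + inverse u' * (u' * \<zeta>) = 0"
        unfolding t by simp
      have 2: "u' * \<zeta> = tpow (- k)"
        using u' by (simp add: \<zeta>_def)
      show "mat2 0 1 (tpow (- k)) u' = mat2 (tpow (- (k - 2 * j))) (inverse u') 0 1 **
          mat2 (u' * \<epsilon>) (u' * 0) (u' * \<zeta>) (u' * 1)"
        using 1 2 u' by (simp add: mat2_mult)
    qed (use u' unit in auto)
    moreover have "is_symbol_edge (edge_class (mat2 (tpow (- (k - 2 * j))) (inverse u') 0 1))"
      using u' by (intro less) auto
    ultimately have "is_symbol_edge (edge_class (mat2 0 1 (tpow (- k)) u'))"
      by simp
    from is_symbol_edge_left_mult[OF this, of 0 0 1 1]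
    show ?thesis
      by (simp add: mat2_mult)
  qed
  from is_symbol_edge_left_mult[OF this, of 1 1 p 0]
  show ?case
    by (simp add: mat2_mult u'_def)
qed

lemma is_symbol_edge_rev:
  assumes "is_symbol_edge (edge_class (g ** rev_mat))"
  shows "is_symbol_edge (edge_class g)"
proof -
  obtain l a b c d where *: "a * d - b * c dvd 1"
    "edge_class (g ** rev_mat) = edge_class (symbol_edge l a b c d)"
    using assms by (auto simp: is_symbol_edge_def)
  have "edge_class g = edge_rev (edge_class (g ** rev_mat))"
    by (simp add: edge_rev_edge_class edge_class_rev_rev)
  also have "\<dots> = edge_class (symbol_edge (- l - 1) b a d c)"
    by (simp add: *(2) edge_rev_edge_class symbol_edge_reverse)
  finally have "edge_class g = edge_class (symbol_edge (- l - 1) b a d c)" .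
  moreover have "b * c - a * d dvd 1"
    using *(1) by (metis minus_diff_eq minus_dvd_iff)
  ultimately show ?thesis
    unfolding is_symbol_edge_def by blast
qed

text \<open>When \<open>d\<close> strictly dominates \<open>c\<close>, Iwahori column operations
  clear \<open>c\<close> and leave an upper triangular representative, to which Euclid's algorithm
  applies.\<close>

lemma edge_reduction_dominant:
  fixes a b c d :: "'k::finite_field fls"
  assumes GL: "mat2 a b c d \<in> GL2_Finf" and cd: "d \<noteq> 0" "c / d \<in> val_ge 1"
  shows "is_symbol_edge (edge_class (mat2 a b c d))"
proof -
  define a' where "a' = (a * d - b * c) / d / d"
  have "a' \<noteq> 0"
    using GL cd by (simp add: GL2_Finf_mat2_iff a'_def)
  define k where "k = fls_subdegree a'"
  define \<epsilon> where "\<epsilon> = tpow k * a'"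
  have \<epsilon>: "fls_unit \<epsilon>"
    using \<open>a' \<noteq> 0\<close> by (simp add: \<epsilon>_def fls_unit_iff fls_subdegree_tpow k_def)
  have "tpow (- k) * tpow k = (1 :: 'k fls)"
    by (simp add: tpow_add[symmetric])
  then have a': "tpow (- k) * \<epsilon> = a'"
    by (simp add: \<epsilon>_def mult.assoc[symmetric])
  have "edge_class (mat2 a b c d) = edge_class (mat2 (tpow (- k)) (b / d) 0 1)"
  proof (rule edge_class_eqI)
    have "tpow (- k) * (d * \<epsilon>) = (a * d - b * c) / d"
      using a' cd(1) by (simp add: a'_def mult.left_commute[of _ d])
    then show "mat2 a b c d = mat2 (tpow (- k)) (b / d) 0 1 ** mat2 (d * \<epsilon>) (d * 0) (d * (c / d)) (d * 1)"
      using cd(1) by (simp add: mat2_mult field_simps)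
  qed (use cd \<epsilon> in auto)
  then show ?thesis
    using upper_edge_reduction by simp
qed

lemma edge_reduction:
  assumes "e \<in> tree_edges"
  obtains l a b c d where "a * d - b * c dvd 1" "e = edge_class (symbol_edge l a b c d)"
proof -
  obtain g where g: "g \<in> GL2_Finf" "e = edge_class g"
    using assms by (auto simp: tree_edges_def)
  obtain a b c d where abcd: "g = mat2 a b c d" by (rule mat2_cases)
  have "is_symbol_edge e"
  proof (cases "d \<noteq> 0 \<and> c / d \<in> val_ge 1")
    case True
    then show ?thesis
      using g edge_reduction_dominant[of a b c d] by (simp add: abcd)
  next
    \<comment> \<open>Now \<open>c\<close> has valuation at most that of \<open>d\<close>. Reversal
      turns the bottom row into (d \<pi>, c), where the second entry dominates strictly.\<close>
    case False
    have "g ** rev_mat = mat2 (b * fls_X) a (d * fls_X) c"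
      by (simp add: abcd mat2_mult)
    moreover have "c \<noteq> 0"
      using False g by (auto simp: abcd GL2_Finf_mat2_iff)
    moreover have "d * fls_X / c \<in> val_ge 1"
      using False \<open>c \<noteq> 0\<close> by (cases "d = 0") (auto simp: val_ge_iff fls_divide_subdegree)
    moreover have "g ** rev_mat \<in> GL2_Finf"
      using g rev_mat_in_GL2 by (intro GL2_Finf_mult)
    ultimately have "is_symbol_edge (edge_class (g ** rev_mat))"
      using edge_reduction_dominant[of "b * fls_X" a "d * fls_X" c] by simp
    then show ?thesis
      using is_symbol_edge_rev g by simp
  qed
  then show ?thesis
    using that by (auto simp: is_symbol_edge_def)
qed

section \<open>Orbits of \<open>Gamma0 n\<close> and finiteness of the support\<close>

lemma Gamma0_cases:
  assumes "g \<in> Gamma0 n"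
  obtains a b c d where "g = poly_mat a b c d"
    "a * d - b * c dvd 1" "n dvd c"
proof -
  obtain h where h: "g = map_matrix A_to_Finf h" "invertible h" "n dvd h $ 2 $ 1"
    using assms by (auto simp: Gamma0_def)
  obtain a b c d where "h = mat2 a b c d" by (rule mat2_cases)
  with h that show ?thesis
    by (simp add: map_matrix_mat2 invertible_mat2_iff)
qed

lemma Gamma0_mult:
  assumes "g \<in> Gamma0 n" "h \<in> Gamma0 n" shows "g ** h \<in> Gamma0 n"
proof -
  obtain a b c d where g: "g = poly_mat a b c d"
    "a * d - b * c dvd 1" "n dvd c"
    using Gamma0_cases[OF assms(1)] .
  obtain a' b' c' d' where h: "h = poly_mat a' b' c' d'"
    "a' * d' - b' * c' dvd 1" "n dvd c'"
    using Gamma0_cases[OF assms(2)] .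
  have "(a * a' + b * c') * (c * b' + d * d') - (a * b' + b * d') * (c * a' + d * c') =
      (a * d - b * c) * (a' * d' - b' * c')"
    by (simp add: algebra_simps)
  then have "(a * a' + b * c') * (c * b' + d * d') - (a * b' + b * d') * (c * a' + d * c') dvd 1"
    using g(2) h(2) by (simp only: is_unit_mult_iff simp_thms)
  moreover have "n dvd c * a' + d * c'"
    using g(3) h(3) by simp
  ultimately show ?thesis
    using Gamma0I[of "a * a' + b * c'" "c * b' + d * d'" "a * b' + b * d'" "c * a' + d * c'" n]
    by (simp add: g(1) h(1) mat2_mult)
qed

lemma Gamma0_inverse:
  assumes "g \<in> Gamma0 n"
  obtains h where "h \<in> Gamma0 n" "h ** g = mat 1" "g ** h = mat 1"
proof -
  obtain a b c d where g: "g = poly_mat a b c d"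
    "a * d - b * c dvd 1" "n dvd c"
    using Gamma0_cases[OF assms] .
  obtain e where e: "1 = (a * d - b * c) * e" using g(2) ..
  let ?h = "poly_mat (e * d) (- e * b) (- e * c) (e * a)"
  have "e * d * (e * a) - - e * b * (- e * c) = e * ((a * d - b * c) * e)"
    by (simp add: algebra_simps)
  also have "\<dots> dvd 1"
    using e by (metis dvd_triv_right mult_1_right)
  finally have "?h \<in> Gamma0 n"
    using g(3) by (intro Gamma0I) auto
  moreover have E: "A_to_Finf ((a * d - b * c) * e) = 1"
    by (simp only: e[symmetric] A_to_Finf_1)
  have "?h ** g = mat 1" "g ** ?h = mat 1"
    using E by (simp_all add: g(1) mat2_mult mat_eq_mat2 algebra_simps)
  ultimately show ?thesis
    using that by blast
qed

lemma orbit_eq: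
  assumes "g \<in> Gamma0 n"
  shows "(\<lambda>h. edge_act h (edge_act g e)) ` Gamma0 n = (\<lambda>h. edge_act h e) ` Gamma0 n"
proof (intro equalityI subsetI)
  fix x assume "x \<in> (\<lambda>h. edge_act h (edge_act g e)) ` Gamma0 n"
  then show "x \<in> (\<lambda>h. edge_act h e) ` Gamma0 n"
    using Gamma0_mult[OF _ assms] by (auto simp: edge_act_mult[symmetric])
next
  fix x assume "x \<in> (\<lambda>h. edge_act h e) ` Gamma0 n"
  then obtain h where h: "h \<in> Gamma0 n" "x = edge_act h e" by blast
  obtain g' where g': "g' \<in> Gamma0 n" "g' ** g = mat 1"
    using Gamma0_inverse[OF assms] .
  have "x = edge_act (h ** g') (edge_act g e)"
    by (simp add: h(2) edge_act_mult[symmetric] matrix_mul_assoc[symmetric] g'(2))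
  then show "x \<in> (\<lambda>h. edge_act h (edge_act g e)) ` Gamma0 n"
    using Gamma0_mult[OF h(1) g'(1)] by blast
qed

lemma finite_image_key:
  assumes "finite (key ` X)" "\<And>x y. x \<in> X \<Longrightarrow> y \<in> X \<Longrightarrow> key x = key y \<Longrightarrow> h x = h y"
  shows "finite (h ` X)"
proof -
  have "h ` X = (\<lambda>k. h (SOME x. x \<in> X \<and> key x = k)) ` key ` X"
  proof -
    have "h x = h (SOME y. y \<in> X \<and> key y = key x)" if "x \<in> X" for x
      using someI[of "\<lambda>y. y \<in> X \<and> key y = key x" x] that assms(2) by metis
    then show ?thesis by (auto simp: image_image)
  qed
  then show ?thesis
    using assms(1) by simp
qed

context invariant_cochain
begin

lemma finite_support_imp_finite_values:
  assumes "finite_support_mod (Gamma0 n) f"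
  shows "finite (range f)"
proof -
  let ?S = "{e \<in> tree_edges. f e \<noteq> 0}"
  have "finite (f ` ?S)"
  proof (rule finite_image_key)
    show "finite ((\<lambda>e. (\<lambda>g. edge_act g e) ` Gamma0 n) ` ?S)"
      using assms by (simp add: finite_support_mod_def)
    fix x y assume eq: "(\<lambda>g. edge_act g x) ` Gamma0 n = (\<lambda>g. edge_act g y) ` Gamma0 n"
    have "mat 1 \<in> Gamma0 n"
      using Gamma0I[of 1 1 0 0 n] by (simp add: mat_eq_mat2)
    then have "x \<in> (\<lambda>g. edge_act g x) ` Gamma0 n"
      by (metis edge_act_1 imageI)
    then obtain g where "g \<in> Gamma0 n" "x = edge_act g y"
      unfolding eq by blast
    then show "f x = f y"
      using invariant[of g] by (metis slash_def)
  qed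
  moreover have "range f \<subseteq> insert 0 (f ` ?S)"
    using harmonic by (auto simp: harmonic_cochain_def)
  ultimately show ?thesis
    by (meson finite.insertI finite_subset)
qed

end

context bounded_cochain
begin

text \<open>Every cusp has width at most the degree of the level: \<open>w = n\<close> is admissible
  for every point.\<close>

lemma W_eq_0:
  assumes "coprime c d" "degree n \<le> Suc k" shows "W k c d = 0"
  using assms monic by (intro cusp[of c d n]) auto

lemma symbol_value:
  assumes u: "a * d - b * c dvd 1"
  shows "f (edge_class (symbol_edge l a b c d)) =
    (if l \<ge> 0 then W (nat l) c d else - W (nat (- l - 1)) d c)"
proof (cases "l \<ge> 0")
  case True
  then show ?thesis
    using V_eq_W[OF u, of "nat l"] by (simp add: V_def)
next
  case False
  have u': "b * c - a * d dvd 1"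
    using u by (metis minus_diff_eq minus_dvd_iff)
  show ?thesis
    using False V_reverse[OF u, of "- l - 1"] V_eq_W[OF u', of "nat (- l - 1)"] by (simp add: V_def)
qed

lemma value_dvd:
  assumes "degree n = 3" "\<And>s. m dvd W 0 (lin s) 1"
  shows "m dvd f e"
proof (cases "e \<in> tree_edges")
  case True
  then obtain l a b c d where *: "a * d - b * c dvd 1" "e = edge_class (symbol_edge l a b c d)"
    by (rule edge_reduction)
  have "coprime c d" "coprime d c"
    using unimodular_coprime[OF *(1)] by (simp_all add: coprime_commute)
  then show ?thesis
    using symbol_dvd_all[OF assms] by (simp add: *(2) symbol_value[OF *(1)])
qed (use harmonic in \<open>auto simp: harmonic_cochain_def\<close>)

text \<open>Nonzero values need -K \<le> l \<le> K, since beyond this range the symbols vanish by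
  \<open>W_eq_0\<close>. Within the range, \<open>l\<close> and the bottom row modulo
  \<open>n\<close> determine the orbit, which leaves finitely many.\<close>

lemma finite_support: "finite_support_mod (Gamma0 n) f"
proof -
  define K where "K = int (degree n)"
  define X where "X = {(l :: int, a, b, c, d :: 'k poly). - K \<le> l \<and> l \<le> K \<and> a * d - b * c dvd 1}"
  define orb where "orb e = (\<lambda>g. edge_act g e) ` Gamma0 n" for e
  define h where "h = (\<lambda>(l, a, b, c, d). orb (edge_class (symbol_edge l a b c d)))"
  define key where "key = (\<lambda>(l :: int, a :: 'k poly, b :: 'k poly, c, d). (l, c mod n, d mod n))"
  have "n \<noteq> 0" using monic by auto
  have "finite (h ` X)"
  proof (rule finite_image_key)
    have "x mod n \<in> polys_below (degree n)" for x
      using degree_mod_less[OF \<open>n \<noteq> 0\<close>, of x] by (auto simp: polys_below_def)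
    then have "key ` X \<subseteq> {- K..K} \<times> polys_below (degree n) \<times> polys_below (degree n)"
      by (auto simp: key_def X_def)
    then show "finite (key ` X)"
      by (rule finite_subset) auto
  next
    fix x y assume xy: "x \<in> X" "y \<in> X" "key x = key y"
    obtain l a b c d where x: "x = (l, a, b, c, d)" by (metis prod_cases5)
    obtain l' a' b' c' d' where y: "y = (l', a', b', c', d')" by (metis prod_cases5)
    have l: "l' = l" and "c mod n = c' mod n" "d mod n = d' mod n"
      using xy(3) by (auto simp: key_def x y)
    then have "n dvd c - c'" "n dvd d' - d"
      by (simp_all add: mod_eq_dvd_iff dvd_diff_commute)
    then have "n dvd (c - c') * d' + c' * (d' - d)"
      by simp
    then have n: "n dvd c * d' - c' * d"
      by (simp add: algebra_simps)
    obtain g where g: "g \<in> Gamma0 n" "symbol_edge l a' b' c' d' = g ** symbol_edge l a b c d"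
      using symbol_edge_Gamma0[OF _ _ n, of a b a' b' l] xy by (auto simp: X_def x y)
    show "h x = h y"
      using orbit_eq[OF g(1)] by (simp add: h_def x y l orb_def g(2) edge_act_edge_class[symmetric])
  qed
  moreover have "orb ` {e \<in> tree_edges. f e \<noteq> 0} \<subseteq> h ` X"
  proof (intro image_subsetI)
    fix e assume "e \<in> {e \<in> tree_edges. f e \<noteq> 0}"
    then have e: "e \<in> tree_edges" "f e \<noteq> 0" by auto
    obtain l a b c d where *: "a * d - b * c dvd 1" "e = edge_class (symbol_edge l a b c d)"
      using e(1) by (rule edge_reduction)
    have co: "coprime c d" "coprime d c"
      using unimodular_coprime[OF *(1)] by (simp_all add: coprime_commute)
    have "\<not> l > K"
      using e(2) W_eq_0[OF co(1), of "nat l"] by (auto simp: *(2) symbol_value[OF *(1)] K_def)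
    moreover have "\<not> l < - K"
      using e(2) W_eq_0[OF co(2), of "nat (- l - 1)"] by (auto simp: *(2) symbol_value[OF *(1)] K_def)
    ultimately have "(l, a, b, c, d) \<in> X"
      using *(1) by (auto simp: X_def)
    then show "orb e \<in> h ` X"
      by (rule rev_image_eqI) (simp add: h_def *(2))
  qed
  ultimately show ?thesis
    unfolding finite_support_mod_def orb_def by (rule finite_subset[rotated])
qed

end

lemma H0_iff:
  assumes "lead_coeff n = 1"
  shows "f \<in> carrier (H0 n) \<longleftrightarrow> bounded_cochain n f"
proof
  assume "f \<in> carrier (H0 n)"
  then have f: "harmonic_cochain f" "\<And>g. g \<in> Gamma0 n \<Longrightarrow> slash f g = f" "finite_support_mod (Gamma0 n) f"
    by (auto simp: H0_def)
  interpret invariant_cochain n f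
    by standard (use f in auto)
  show "bounded_cochain n f"
    by standard (use assms finite_support_imp_finite_values f in auto)
next
  assume "bounded_cochain n f"
  then interpret bounded_cochain n f .
  show "f \<in> carrier (H0 n)"
    using harmonic invariant finite_support by (auto simp: H0_def)
qed

subsection \<open>Hecke operators\<close>

definition hecke_mat :: "'k::finite_field poly \<times> 'k poly \<times> 'k poly \<Rightarrow> 'k fls^2^2" where
  "hecke_mat = (\<lambda>(a, b, d). mat2 (A_to_Finf a) (A_to_Finf b) 0 (A_to_Finf d))"

lemma hecke_op_eq: "hecke_op n m f e = (\<Sum>i\<in>hecke_index n m. f (edge_act (hecke_mat i) e))"
  by (simp add: hecke_op_def hecke_mat_def slash_def case_prod_beta')

definition hecke_diag :: "'k::finite_field poly \<Rightarrow> 'k poly \<Rightarrow> ('k poly \<times> 'k poly) set" where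
  "hecke_diag n m = {(a, d). lead_coeff a = 1 \<and> lead_coeff d = 1 \<and> a * d = m \<and> coprime a n}"

lemma finite_hecke_diag [simp]: "finite (hecke_diag n m)"
proof (rule finite_subset)
  show "hecke_diag n m \<subseteq> polys_below (Suc (degree m)) \<times> polys_below (Suc (degree m))"
  proof (clarsimp simp: hecke_diag_def polys_below_def)
    fix a d :: "'a poly"
    assume "lead_coeff a = 1" "lead_coeff d = 1"
    then have "a \<noteq> 0" "d \<noteq> 0" by auto
    then show "(a = 0 \<or> degree a < Suc (degree (a * d))) \<and> (d = 0 \<or> degree d < Suc (degree (a * d)))"
      by (simp add: degree_mult_eq)
  qed
qed auto

lemma hecke_index_eq:
  "hecke_index n m = (\<lambda>((a, d), b). (a, b, d)) ` (SIGMA x:hecke_diag n m. polys_below (degree (snd x)))"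
  by (force simp: hecke_index_def hecke_diag_def polys_below_def)

lemma finite_hecke_index [simp]: "finite (hecke_index n m)"
  unfolding hecke_index_eq by (intro finite_imageI finite_SigmaI) auto

lemma sum_hecke_index:
  "(\<Sum>i\<in>hecke_index n m. h i) = (\<Sum>(a, d)\<in>hecke_diag n m. \<Sum>b\<in>polys_below (degree d). h (a, b, d))"
proof -
  have "inj_on (\<lambda>((a, d), b). (a, b, d)) (SIGMA x:hecke_diag n m. polys_below (degree (snd x)))"
    by (auto simp: inj_on_def)
  then show ?thesis
    unfolding hecke_index_eq
    by (subst sum.reindex) (simp_all add: sum.Sigma case_prod_beta')
qed

section \<open>Hecke cosets and invariance of the Hecke operators\<close>

lemma coprime_dvd_mult_poly:
  fixes n :: "'k::field poly"
  assumes "coprime g n" "n dvd g * r" shows "n dvd r"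
proof -
  obtain x y where xy: "x * g + y * n = 1"
    using bezout_poly[OF assms(1)] .
  have "r = (x * g + y * n) * r" by (simp add: xy)
  also have "\<dots> = x * (g * r) + n * (y * r)" by (simp add: algebra_simps)
  also have "n dvd \<dots>" using assms(2) by simp
  finally show ?thesis .
qed

lemma coprime_mult_poly:
  fixes n :: "'k::field poly"
  assumes "coprime a n" "coprime b n" shows "coprime (a * b) n"
proof -
  obtain x y x' y' where xy: "x * a + y * n = 1" "x' * b + y' * n = 1"
    using bezout_poly assms by metis
  have "(x * x') * (a * b) + (x * a * y' + y) * n = x * a * (x' * b + y' * n) + y * n"
    by (simp add: algebra_simps)
  also have "\<dots> = 1" by (simp add: xy)
  finally show ?thesis by (metis coprime_polyI dvd_refl)
qed

text \<open>Hermite normal form from the left. The first column divided by its gcd \<open>g\<close>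
  becomes the first column of \<gamma>, and the Bezout coefficients supply the second one. Dividing
  \<open>b0\<close> by \<open>d\<close> yields the reduced entry \<open>b\<close> and the unipotent
  correction \<open>c\<close>. Coprimality of \<open>p\<close> with \<open>n\<close> lets the
  divisibility of \<open>r\<close> descend to \<open>r / g\<close>.\<close>

lemma hecke_coset_exists:
  fixes n m :: "'k::finite_field poly"
  assumes "lead_coeff m = 1" and det: "p * s - q * r = smult \<epsilon> m" "\<epsilon> \<noteq> 0"
    and r: "n dvd r" and p: "coprime p n"
  obtains \<gamma> i where "\<gamma> \<in> Gamma0 n" "i \<in> hecke_index n m"
    "poly_mat p q r s = \<gamma> ** hecke_mat i"
proof -
  have "m \<noteq> 0" using assms(1) by auto
  have "p \<noteq> 0 \<or> r \<noteq> 0"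
    using det \<open>m \<noteq> 0\<close> by auto
  then obtain g x y p' r' where g: "lead_coeff g = 1" "p = g * p'" "r = g * r'" "x * p' + y * r' = 1"
    by (rule bezout_gcd_poly)
  have gn: "coprime g n"
    using p unfolding g(2) by (meson coprime_divisors dvd_refl dvd_triv_left)
  have r': "n dvd r'"
    using coprime_dvd_mult_poly[OF gn] r unfolding g(3) .
  define d where "d = smult (inverse \<epsilon>) (p' * s - r' * q)"
  have d0: "p' * s - r' * q = smult \<epsilon> d"
    using det(2) by (simp add: d_def)
  have "smult \<epsilon> m = smult \<epsilon> (g * d)"
    unfolding det(1)[symmetric] mult_smult_right[symmetric] d0[symmetric] g(2,3)
    by (simp add: algebra_simps)
  then have gd: "g * d = m"
    using det(2) by (metis smult_eq_iff)
  have ld: "lead_coeff d = 1"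
    using assms(1) g(1) unfolding gd[symmetric] by (simp add: lead_coeff_mult)
  then have "d \<noteq> 0" by auto
  define b0 where "b0 = x * q + y * s"
  define b c where "b = b0 mod d" and "c = b0 div d"
  have b0: "b + c * d = b0"
    by (simp add: b_def c_def)
  have i: "(g, b, d) \<in> hecke_index n m"
    using degree_mod_less[OF \<open>d \<noteq> 0\<close>, of b0] g(1) ld gd gn by (auto simp: hecke_index_def b_def)
  define u v where "u = p' * c - smult \<epsilon> y" and "v = r' * c + smult \<epsilon> x"
  have "p' * v - u * r' = smult \<epsilon> (x * p' + y * r')"
    by (simp add: u_def v_def algebra_simps smult_add_right)
  also have "\<dots> dvd 1"
    unfolding g(4) using det(2) by (simp add: is_unit_triv)
  finally have \<gamma>: "poly_mat p' u r' v \<in> Gamma0 n"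
    using r' by (rule Gamma0I)
  have "p' * b + u * d = p' * (b + c * d) - y * smult \<epsilon> d"
    by (simp add: u_def algebra_simps)
  also have "\<dots> = (x * p' + y * r') * q"
    unfolding b0 d0[symmetric] by (simp add: b0_def algebra_simps)
  finally have q: "q = p' * b + u * d" by (simp add: g(4))
  have "r' * b + v * d = r' * (b + c * d) + x * smult \<epsilon> d"
    by (simp add: v_def algebra_simps)
  also have "\<dots> = (x * p' + y * r') * s"
    unfolding b0 d0[symmetric] by (simp add: b0_def algebra_simps)
  finally have s: "s = r' * b + v * d" by (simp add: g(4))
  have "poly_mat p q r s =
      poly_mat p' u r' v ** hecke_mat (g, b, d)"
    unfolding q s g(2,3) by (simp add: hecke_mat_def mat2_mult mult.commute)
  then show ?thesis
    using that \<gamma> i by blast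
qed

lemma monic_unit_eq_1: "lead_coeff p = 1 \<Longrightarrow> p dvd 1 \<Longrightarrow> p = 1" for p :: "'k::field poly"
  by (metis degree_eq_zeroE is_unit_iff_degree lead_coeff_pCons(2) one_pCons not_is_unit_0)

text \<open>Comparing entries makes \<gamma> upper triangular, monicity makes its diagonal trivial,
  and the degree bound on the upper right entries leaves no room for a translation.\<close>

lemma hecke_coset_unique:
  assumes "i \<in> hecke_index n m" "j \<in> hecke_index n m" "\<gamma> \<in> Gamma0 n"
    "hecke_mat i = \<gamma> ** hecke_mat j"
  shows "i = j"
proof -
  obtain a b d where i: "i = (a, b, d)" by (metis prod_cases3)
  obtain a' b' d' where j: "j = (a', b', d')" by (metis prod_cases3)
  obtain p q r s where \<gamma>: "\<gamma> = poly_mat p q r s"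
    "p * s - q * r dvd 1"
    using Gamma0_cases[OF assms(3)] .
  have ai: "lead_coeff a = 1" "lead_coeff d = 1" "lead_coeff a' = 1" "lead_coeff d' = 1"
    "b = 0 \<or> degree b < degree d" "b' = 0 \<or> degree b' < degree d'"
    using assms(1,2) by (auto simp: i j hecke_index_def)
  have "poly_mat a b 0 d =
     poly_mat (p * a') (p * b' + q * d') (r * a') (r * b' + s * d')"
    using assms(4) by (simp add: i j \<gamma>(1) hecke_mat_def mat2_mult)
  then have eqs: "a = p * a'" "b = p * b' + q * d'" "0 = r * a'" "d = r * b' + s * d'"
    unfolding mat2_eq_iff A_to_Finf_eq_iff by auto
  have "a' \<noteq> 0" "d' \<noteq> 0" using ai by auto
  then have r: "r = 0" using eqs(3) by simp
  have ps: "p dvd 1" "s dvd 1"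
    using \<gamma>(2) by (auto simp: r is_unit_mult_iff)
  have "p = 1"
    using ai(1,3) ps(1) unfolding eqs(1) by (intro monic_unit_eq_1) (simp_all add: lead_coeff_mult)
  have d: "d = s * d'" using eqs(4) by (simp add: r)
  have "s = 1"
    using ai(2,4) ps(2) unfolding d by (intro monic_unit_eq_1) (simp_all add: lead_coeff_mult)
  have "q = 0"
  proof (rule ccontr)
    assume "q \<noteq> 0"
    then have "degree d' \<le> degree (b - b')" "q * d' \<noteq> 0"
      using eqs(2) \<open>d' \<noteq> 0\<close> by (simp_all add: \<open>p = 1\<close> degree_mult_eq)
    moreover have "b - b' = 0 \<or> degree (b - b') < degree d'"
      using ai(5,6) by (auto simp: d \<open>s = 1\<close> intro: degree_diff_less)
    ultimately show False
      using eqs(2) by (auto simp: \<open>p = 1\<close>)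
  qed
  then show ?thesis
    using eqs d by (simp add: i j \<open>p = 1\<close> \<open>s = 1\<close>)
qed

lemma coprime_unimodular_poly:
  fixes n :: "'k::field poly"
  assumes "p * s - q * r dvd 1" "n dvd r" shows "coprime p n"
proof -
  obtain r' where r: "r = n * r'" using assms(2) ..
  show ?thesis
    by (rule coprime_polyI[of s _ "- q * r'"]) (use assms(1) in \<open>simp add: r algebra_simps\<close>)
qed

text \<open>Right multiplication by \<open>g\<close> permutes the cosets represented by the
  \<open>hecke_mat i\<close>, and the left factors from \<open>Gamma0 n\<close> are swallowed by the
  invariance of \<open>f\<close>.\<close>

lemma hecke_op_invariant:
  fixes f :: "('k::finite_field, int) cochain"
  assumes inv: "\<And>g. g \<in> Gamma0 n \<Longrightarrow> slash f g = f" and m: "lead_coeff m = 1" and g: "g \<in> Gamma0 n"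
  shows "slash (hecke_op n m f) g = hecke_op n m f"
proof -
  obtain p q r s where gg: "g = poly_mat p q r s"
    "p * s - q * r dvd 1" "n dvd r"
    using Gamma0_cases[OF g] .
  obtain \<epsilon> where \<epsilon>: "p * s - q * r = [:\<epsilon>:]" "\<epsilon> \<noteq> 0"
    using gg(2) by (auto simp: is_unit_poly_iff dvd_field_iff)
  have "\<exists>\<gamma> j. \<gamma> \<in> Gamma0 n \<and> j \<in> hecke_index n m \<and> hecke_mat i ** g = \<gamma> ** hecke_mat j"
    if i: "i \<in> hecke_index n m" for i
  proof -
    obtain a b d where abd: "i = (a, b, d)" by (metis prod_cases3)
    have *: "a * d = m" "coprime a n"
      using i by (auto simp: abd hecke_index_def)
    obtain r' where r': "r = n * r'" using gg(3) ..
    have "coprime n (a * p + (b * r') * n)"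
      unfolding coprime_add_mult
      using coprime_mult_poly[OF *(2) coprime_unimodular_poly[OF gg(2,3)]] by (simp add: coprime_commute)
    then have co: "coprime (a * p + b * r) n"
      by (simp add: r' coprime_commute mult_ac)
    have det: "(a * p + b * r) * (d * s) - (a * q + b * s) * (d * r) = smult \<epsilon> m"
    proof -
      have "(a * p + b * r) * (d * s) - (a * q + b * s) * (d * r) = (a * d) * (p * s - q * r)"
        by (simp add: algebra_simps)
      then show ?thesis by (simp add: * \<epsilon>)
    qed
    have M: "hecke_mat i ** g = poly_mat (a * p + b * r) (a * q + b * s) (d * r) (d * s)"
      by (simp add: abd hecke_mat_def gg(1) mat2_mult)
    obtain \<gamma> j where "\<gamma> \<in> Gamma0 n" "j \<in> hecke_index n m"
      "poly_mat (a * p + b * r) (a * q + b * s) (d * r) (d * s) = \<gamma> ** hecke_mat j"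
      using hecke_coset_exists[OF m det \<epsilon>(2) dvd_mult[OF gg(3)] co] .
    then show ?thesis
      unfolding M by blast
  qed
  then obtain \<gamma> \<sigma> where \<sigma>: "\<And>i. i \<in> hecke_index n m \<Longrightarrow>
      \<gamma> i \<in> Gamma0 n \<and> \<sigma> i \<in> hecke_index n m \<and> hecke_mat i ** g = \<gamma> i ** hecke_mat (\<sigma> i)"
    by metis
  obtain g' where g': "g ** g' = mat 1"
    using Gamma0_inverse[OF g] by metis
  have "inj_on \<sigma> (hecke_index n m)"
  proof (rule inj_onI)
    fix i j assume ij: "i \<in> hecke_index n m" "j \<in> hecke_index n m" "\<sigma> i = \<sigma> j"
    obtain h where h: "h \<in> Gamma0 n" "h ** \<gamma> j = mat 1"
      using Gamma0_inverse \<sigma>[OF ij(2)] by metis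
    have "hecke_mat (\<sigma> j) = h ** (hecke_mat j ** g)"
      using \<sigma>[OF ij(2)] h(2) by (simp add: matrix_mul_assoc)
    then have "hecke_mat i ** g = \<gamma> i ** h ** hecke_mat j ** g"
      using \<sigma>[OF ij(1)] ij(3) by (simp add: matrix_mul_assoc)
    then have "hecke_mat i ** (g ** g') = \<gamma> i ** h ** hecke_mat j ** (g ** g')"
      by (simp add: matrix_mul_assoc)
    then have "hecke_mat i = (\<gamma> i ** h) ** hecke_mat j"
      by (simp add: g')
    moreover have "\<gamma> i ** h \<in> Gamma0 n"
      using \<sigma>[OF ij(1)] h(1) by (simp add: Gamma0_mult)
    ultimately show "i = j"
      using hecke_coset_unique ij by blast
  qed
  then have bij: "bij_betw \<sigma> (hecke_index n m) (hecke_index n m)"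
    unfolding bij_betw_def using \<sigma> endo_inj_surj[OF finite_hecke_index, of \<sigma> n m] by blast
  show ?thesis
  proof
    fix e
    have "slash (hecke_op n m f) g e = (\<Sum>i\<in>hecke_index n m. f (edge_act (hecke_mat i ** g) e))"
      by (simp add: slash_def hecke_op_eq edge_act_mult)
    also have "\<dots> = (\<Sum>i\<in>hecke_index n m. f (edge_act (hecke_mat (\<sigma> i)) e))"
    proof (rule sum.cong)
      fix i assume "i \<in> hecke_index n m"
      then have "f (edge_act (hecke_mat i ** g) e) = slash f (\<gamma> i) (edge_act (hecke_mat (\<sigma> i)) e)"
        using \<sigma> by (simp add: slash_def edge_act_mult)
      then show "f (edge_act (hecke_mat i ** g) e) = f (edge_act (hecke_mat (\<sigma> i)) e)"
        using inv \<sigma> \<open>i \<in> hecke_index n m\<close> by metis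
    qed simp
    also have "\<dots> = hecke_op n m f e"
      unfolding hecke_op_eq by (rule sum.reindex_bij_betw[OF bij])
    finally show "slash (hecke_op n m f) g e = hecke_op n m f e" .
  qed
qed

lemma hecke_op_H0:
  assumes n: "lead_coeff n = 1" and m: "lead_coeff m = 1" and f: "f \<in> carrier (H0 n)"
  shows "hecke_op n m f \<in> carrier (H0 n)"
proof -
  interpret bounded_cochain n f
    using f H0_iff[OF n] by blast
  have "hecke_mat i \<in> GL2_Finf" if "i \<in> hecke_index n m" for i
    using that by (auto simp: hecke_mat_def GL2_Finf_mat2_iff hecke_index_def)
  then have "harmonic_cochain (\<lambda>e. \<Sum>i\<in>hecke_index n m. slash f (hecke_mat i) e)"
    by (intro harmonic_sum harmonic_slash harmonic)
  then have 1: "harmonic_cochain (hecke_op n m f)"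
    unfolding slash_def hecke_op_eq[symmetric] .
  obtain B where B: "\<And>x. x \<in> range f \<Longrightarrow> \<bar>x\<bar> \<le> B"
    using finite_imageI[OF finite_values, of abs] by (metis Max_ge imageI)
  define C where "C = of_nat (card (hecke_index n m)) * B"
  have "\<bar>hecke_op n m f e\<bar> \<le> C" for e
  proof -
    have "\<bar>hecke_op n m f e\<bar> \<le> (\<Sum>i\<in>hecke_index n m. \<bar>f (edge_act (hecke_mat i) e)\<bar>)"
      unfolding hecke_op_eq by (rule sum_abs)
    also have "\<dots> \<le> C"
      unfolding C_def by (rule sum_bounded_above) (auto intro: B)
    finally show ?thesis .
  qed
  then have "range (hecke_op n m f) \<subseteq> {- C..C}"
    by (auto simp: abs_le_iff minus_le_iff)
  then have "finite (range (hecke_op n m f))"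
    by (rule finite_subset) simp
  then have "bounded_cochain n (hecke_op n m f)"
    using 1 hecke_op_invariant[OF invariant m] n by unfold_locales auto
  then show ?thesis
    using H0_iff[OF n] by blast
qed

section \<open>Residue systems and commutation with operators of degree one\<close>

lemma residue_sum:
  fixes d :: "'k::finite_field poly" and \<psi> :: "'k poly \<Rightarrow> int"
  assumes d: "d \<noteq> 0" and I: "finite I" "card I = CARD('k) ^ degree d"
    and inj: "\<And>x y. x \<in> I \<Longrightarrow> y \<in> I \<Longrightarrow> d dvd h x - h y \<Longrightarrow> x = y"
    and periodic: "\<And>b c. \<psi> (b + c * d) = \<psi> b"
  shows "(\<Sum>x\<in>I. \<psi> (h x)) = (\<Sum>b\<in>polys_below (degree d). \<psi> b)"
proof -
  have "inj_on (\<lambda>x. h x mod d) I"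
    using inj by (auto simp: inj_on_def mod_eq_dvd_iff)
  moreover have "(\<lambda>x. h x mod d) ` I \<subseteq> polys_below (degree d)"
    using degree_mod_less[OF d] by (auto simp: polys_below_def)
  ultimately have bij: "bij_betw (\<lambda>x. h x mod d) I (polys_below (degree d))"
    unfolding bij_betw_def
    by (simp add: card_subset_eq card_image I card_polys_below)
  have "\<psi> (h x) = \<psi> (h x mod d)" for x
    using periodic[of "h x mod d" "h x div d"] by simp
  then have "(\<Sum>x\<in>I. \<psi> (h x)) = (\<Sum>x\<in>I. \<psi> (h x mod d))"
    by simp
  also have "\<dots> = (\<Sum>b\<in>polys_below (degree d). \<psi> b)"
    by (rule sum.reindex_bij_betw[OF bij])
  finally show ?thesis .
qed

lemma polys_below_dvd_diff:
  assumes "b \<in> polys_below (degree d)" "b' \<in> polys_below (degree d)" "d dvd b - b'"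
  shows "b = b'"
proof (rule ccontr)
  assume "b \<noteq> b'"
  then have "degree d \<le> degree (b - b')"
    using assms(3) by (intro dvd_imp_degree_le) auto
  moreover have "degree (b - b') < degree d"
    using assms(1,2) \<open>b \<noteq> b'\<close> by (auto simp: polys_below_def intro: degree_diff_less)
  ultimately show False by simp
qed

text \<open>Mixed radix digits modulo (T - s) d: a residue modulo \<open>d\<close>, then a constant,
  since the constants represent A modulo T - s.\<close>

lemma digits_unique:
  fixes d :: "'k::finite_field poly"
  assumes d: "d \<noteq> 0"
    and xy: "x \<in> UNIV \<times> polys_below (degree d)" "y \<in> UNIV \<times> polys_below (degree d)"
    and dvd: "lin s * d dvd (snd x + [:fst x:] * d) - (snd y + [:fst y:] * d)"
  shows "x = y"
proof -
  have eq: "(snd x + [:fst x:] * d) - (snd y + [:fst y:] * d) = (snd x - snd y) + [:fst x - fst y:] * d"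
    by (simp add: algebra_simps smult_diff_left)
  have "d dvd (snd x - snd y) + [:fst x - fst y:] * d"
    using dvd unfolding eq by (rule dvd_mult_right)
  then have "d dvd snd x - snd y"
    by (simp only: dvd_add_times_triv_right_iff)
  then have s: "snd x = snd y"
    using xy polys_below_dvd_diff by (metis mem_Times_iff)
  have "lin s * d dvd [:fst x - fst y:] * d"
    using dvd unfolding eq by (simp add: s)
  then have "lin s dvd [:fst x - fst y:]"
    using d by (simp only: dvd_mult_cancel_right) simp
  then have "fst x = fst y"
    by (simp add: linear_dvd_iff)
  with s show ?thesis by (simp add: prod_eq_iff)
qed

lemma hecke_mat_mult:
  "hecke_mat (a, b, d) ** hecke_mat (a', b', d') = hecke_mat (a * a', a * b' + b * d', d * d')"
  by (simp add: hecke_mat_def mat2_mult)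

lemma irreducible_linear_factor:
  fixes a d :: "'k::field poly"
  assumes "lead_coeff a = 1" "lead_coeff d = 1" "a * d = lin s"
  shows "a = 1 \<and> d = lin s \<or> a = lin s \<and> d = 1"
proof -
  have "a \<noteq> 0" "d \<noteq> 0" using assms by auto
  then have "degree a + degree d = 1"
    using assms(3) by (metis degree_lin degree_mult_eq)
  then consider "degree a = 0" | "degree d = 0" by linarith
  then show ?thesis
  proof cases
    case 1
    then have "a = 1"
      using assms(1) by (metis degree_eq_zeroE lead_coeff_pCons(2) one_pCons)
    then show ?thesis using assms(3) by simp
  next
    case 2
    then have "d = 1"
      using assms(2) by (metis degree_eq_zeroE lead_coeff_pCons(2) one_pCons)
    then show ?thesis using assms(3) by simp
  qed
qed

lemma hecke_diag_lin:
  "hecke_diag n (lin s) = (if poly n s = 0 then {(1, lin s)} else {(1, lin s), (lin s, 1)})"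
proof (intro equalityI subsetI)
  fix x assume x: "x \<in> hecke_diag n (lin s)"
  obtain a d where ad: "x = (a, d)" by fastforce
  show "x \<in> (if poly n s = 0 then {(1, lin s)} else {(1, lin s), (lin s, 1)})"
    using x irreducible_linear_factor[of a d s] by (auto simp: ad hecke_diag_def coprime_linear_iff)
next
  fix x assume "x \<in> (if poly n s = 0 then {(1, lin s)} else {(1, lin s), (lin s, 1)})"
  then show "x \<in> hecke_diag n (lin s)"
    by (auto simp: hecke_diag_def coprime_linear_iff split: if_splits)
qed

lemma polys_below_1: "polys_below 1 = range (\<lambda>t. [:t:])"
proof -
  have "polys_below (Suc 0) = (\<lambda>(a, p). pCons a p) ` (UNIV \<times> {0})"
    unfolding polys_below_Suc polys_below_0 ..
  also have "\<dots> = range (\<lambda>t. [:t:])" by auto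
  finally show ?thesis by simp
qed

lemma hecke_op_lin:
  "hecke_op n (lin s) f e = (\<Sum>t\<in>UNIV. f (edge_act (hecke_mat (1, [:t:], lin s)) e)) +
     (if poly n s = 0 then 0 else f (edge_act (hecke_mat (lin s, 0, 1)) e))"
proof -
  have "(\<Sum>b\<in>polys_below (degree (lin s)). f (edge_act (hecke_mat (1, b, lin s)) e)) =
      (\<Sum>t\<in>UNIV. f (edge_act (hecke_mat (1, [:t:], lin s)) e))"
    by (simp add: polys_below_1[unfolded One_nat_def] sum.reindex inj_def)
  moreover have "lin s \<noteq> 1"
    by (metis degree_1 degree_lin zero_neq_one)
  ultimately show ?thesis
    unfolding hecke_op_eq sum_hecke_index hecke_diag_lin
    by (simp add: polys_below_0)
qed

lemma sum_case_prod_cong: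
  "(\<And>a d. (a, d) \<in> D \<Longrightarrow> g a d = h a d) \<Longrightarrow> (\<Sum>(a, d)\<in>D. g a d) = (\<Sum>(a, d)\<in>D. h a d)"
  by (rule sum.cong) auto

lemma sum_if_diff:
  assumes "finite D"
  shows "(\<Sum>x\<in>D. if C x then g x else h x) = (\<Sum>x\<in>D. h x) + (\<Sum>x\<in>{x \<in> D. C x}. g x - h x :: int)"
proof -
  have "(\<Sum>x\<in>{x \<in> D. C x}. g x - h x) = (\<Sum>x\<in>D. if C x then g x - h x else 0)"
    using assms by (simp add: sum.inter_filter)
  then show ?thesis
    by (simp add: sum.distrib[symmetric] if_distrib cong: if_cong)
qed

text \<open>Both composites are sums over matrices with rows \<open>(a, b)\<close> and \<open>(0, d)\<close> for \<open>a d = m P\<close>.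
  Some \<open>b\<close> are repeated \<open>q\<close> times when \<open>P\<close> divides \<open>a\<close> in one order and when \<open>P\<close> divides
  \<open>d\<close> in the other; these cases correspond under \<open>(a, d) \<mapsto> (a P, d / P)\<close>.\<close>

theorem hecke_op_commute_lin:
  fixes f :: "('k::finite_field, int) cochain"
  assumes inv: "\<And>g. g \<in> Gamma0 n \<Longrightarrow> slash f g = f"
  shows "hecke_op n (lin s) (hecke_op n m f) = hecke_op n m (hecke_op n (lin s) f)"
proof
  fix e
  let ?P = "lin s"
  define \<phi> where "\<phi> a b d = f (edge_act (hecke_mat (a, b, d)) e)" for a b d
  have \<phi>_periodic: "\<phi> a (b + c * d) d = \<phi> a b d" for a b c d
  proof -
    have "poly_mat 1 c 0 1 \<in> Gamma0 n"
      by (rule Gamma0I) auto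
    moreover have "hecke_mat (a, b + c * d, d) =
        poly_mat 1 c 0 1 ** hecke_mat (a, b, d)"
      by (simp add: hecke_mat_def mat2_mult)
    ultimately show ?thesis
      using inv unfolding \<phi>_def by (metis edge_act_mult slash_def)
  qed
  \<comment> \<open>\<open>G\<close> sums over a full residue system. \<open>H\<close> is its
    degenerate counterpart, in which only multiples of \<open>P\<close> occur as upper right
    entries, each of them q times.\<close>
  define G where "G a d = (\<Sum>b\<in>polys_below (degree d). \<phi> a b d)" for a d
  define H where "H a d = int CARD('k) * (\<Sum>b\<in>polys_below (degree d). \<phi> a (?P * b) (?P * d))" for a d
  let ?D = "hecke_diag n m"

  have deg_P: "degree (?P * d) = Suc (degree d)" if "d \<noteq> 0" for d
    using that by (simp add: degree_mult_eq)
  have card: "card (UNIV \<times> polys_below (degree d) :: ('k \<times> 'k poly) set) = CARD('k) ^ degree (?P * d)"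
    if "d \<noteq> 0" for d
    using that by (simp add: card_cartesian_product card_polys_below deg_P)

  have right_all: "(\<Sum>t\<in>UNIV. \<Sum>b\<in>polys_below (degree d). \<phi> a (1 * b + [:t:] * d) (?P * d)) = G a (?P * d)"
    if d: "d \<noteq> 0" for a d
  proof -
    have "(\<Sum>t\<in>UNIV. \<Sum>b\<in>polys_below (degree d). \<phi> a (1 * b + [:t:] * d) (?P * d)) =
        (\<Sum>x\<in>UNIV \<times> polys_below (degree d). \<phi> a (snd x + [:fst x:] * d) (?P * d))"
      by (simp add: sum.cartesian_product case_prod_beta')
    also have "\<dots> = G a (?P * d)"
      unfolding G_def
    proof (rule residue_sum)
      show "x = y" if "x \<in> UNIV \<times> polys_below (degree d)" "y \<in> UNIV \<times> polys_below (degree d)"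
        "?P * d dvd (snd x + [:fst x:] * d) - (snd y + [:fst y:] * d)" for x y
        using digits_unique[OF d that] .
    qed (use d card \<phi>_periodic in auto)
    finally show ?thesis .
  qed

  have left_all: "(\<Sum>t\<in>UNIV. \<Sum>b\<in>polys_below (degree d). \<phi> a (a * [:t:] + b * ?P) (?P * d)) =
      (if poly a s = 0 then H a d else G a (?P * d))"
    if d: "d \<noteq> 0" for a d
  proof (cases "poly a s = 0")
    case False
    have "(\<Sum>t\<in>UNIV. \<Sum>b\<in>polys_below (degree d). \<phi> a (a * [:t:] + b * ?P) (?P * d)) =
        (\<Sum>x\<in>UNIV \<times> polys_below (degree d). \<phi> a (a * [:fst x:] + snd x * ?P) (?P * d))"
      by (simp add: sum.cartesian_product case_prod_beta')
    also have "\<dots> = G a (?P * d)"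
      unfolding G_def
    proof (rule residue_sum)
      fix x y
      assume xy: "x \<in> UNIV \<times> polys_below (degree d)" "y \<in> UNIV \<times> polys_below (degree d)"
        and dvd: "?P * d dvd (a * [:fst x:] + snd x * ?P) - (a * [:fst y:] + snd y * ?P)"
      then have "?P dvd (a * [:fst x:] + snd x * ?P) - (a * [:fst y:] + snd y * ?P)"
        using dvd_mult_left by blast
      then have "poly a s * (fst x - fst y) = 0"
        by (simp add: linear_dvd_iff algebra_simps)
      then have s: "fst x = fst y"
        using False by simp
      have "?P * d dvd ?P * (snd x - snd y)"
        using dvd by (simp add: s algebra_simps)
      then have "d dvd snd x - snd y"
        by (simp only: dvd_mult_cancel_left lin_nonzero simp_thms)
      then have "snd x = snd y"
        using xy polys_below_dvd_diff by (metis mem_Times_iff)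
      with s show "x = y" by (simp add: prod_eq_iff)
    qed (use d card \<phi>_periodic in auto)
    finally show ?thesis using False by simp
  next
    case True
    then obtain a' where a': "a = ?P * a'"
      unfolding linear_dvd_iff[symmetric] ..
    have "(\<Sum>b\<in>polys_below (degree d). \<phi> a (a * [:t:] + b * ?P) (?P * d)) =
        (\<Sum>b\<in>polys_below (degree d). \<phi> a (?P * b) (?P * d))" for t
    proof -
      have "(\<Sum>b\<in>polys_below (degree d). \<phi> a (a * [:t:] + b * ?P) (?P * d)) =
          (\<Sum>b\<in>polys_below (degree d). \<phi> a (?P * (b + a' * [:t:])) (?P * d))"
        unfolding a' by (simp only: algebra_simps)
      also have "\<dots> = (\<Sum>b\<in>polys_below (degree d). \<phi> a (?P * b) (?P * d))"
      proof (rule residue_sum[where \<psi> = "\<lambda>b. \<phi> a (?P * b) (?P * d)"])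
        show "x = y" if "x \<in> polys_below (degree d)" "y \<in> polys_below (degree d)"
          "d dvd x + a' * [:t:] - (y + a' * [:t:])" for x y
          using that polys_below_dvd_diff by simp
        show "\<phi> a (?P * (b + c * d)) (?P * d) = \<phi> a (?P * b) (?P * d)" for b c
          using \<phi>_periodic[of a "?P * b" c "?P * d"] by (simp add: algebra_simps)
      qed (use d card_polys_below in auto)
      finally show ?thesis .
    qed
    then show ?thesis
      using True by (simp add: H_def)
  qed

  have right_P: "(\<Sum>b\<in>polys_below (degree d). \<phi> a (?P * b + 0 * d) d) =
      (if poly d s = 0 then H a (d div ?P) else G a d)" if d: "d \<noteq> 0" for a d
  proof (cases "poly d s = 0")
    case False
    have "(\<Sum>b\<in>polys_below (degree d). \<phi> a (?P * b) d) = G a d"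
      unfolding G_def
    proof (rule residue_sum)
      show "x = y" if "x \<in> polys_below (degree d)" "y \<in> polys_below (degree d)"
        "d dvd ?P * x - ?P * y" for x y
        using that dvd_linear_mult_cancel[OF _ False, of "x - y"] polys_below_dvd_diff
        by (simp add: right_diff_distrib)
    qed (use d card_polys_below \<phi>_periodic in auto)
    then show ?thesis using False by simp
  next
    case True
    then obtain d' where d': "d = ?P * d'"
      unfolding linear_dvd_iff[symmetric] ..
    have nz: "d' \<noteq> 0" using d d' by auto
    have "(\<Sum>b\<in>polys_below (degree d). \<phi> a (?P * b) d) =
       (\<Sum>x\<in>UNIV \<times> polys_below (degree d'). \<phi> a (?P * (snd x + [:fst x:] * d')) d)"
    proof (rule residue_sum[where \<psi> = "\<lambda>b. \<phi> a (?P * b) d", symmetric])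
      show "card (UNIV \<times> polys_below (degree d') :: ('k \<times> 'k poly) set) = CARD('k) ^ degree d"
        using card[OF nz] by (simp only: d')
      show "\<phi> a (?P * (b + c * d)) d = \<phi> a (?P * b) d" for b c
        using \<phi>_periodic[of a "?P * b" "?P * c" d] by (simp add: algebra_simps)
      show "x = y" if "x \<in> UNIV \<times> polys_below (degree d')" "y \<in> UNIV \<times> polys_below (degree d')"
        "d dvd (snd x + [:fst x:] * d') - (snd y + [:fst y:] * d')" for x y
        using digits_unique[OF nz that(1,2)] that(3) unfolding d' .
    qed (use d in auto)
    also have "\<dots> = (\<Sum>t\<in>UNIV. \<Sum>b\<in>polys_below (degree d'). \<phi> a (?P * (b + [:t:] * d')) d)"
      by (simp add: sum.cartesian_product case_prod_beta')
    also have "\<dots> = (\<Sum>t\<in>(UNIV::'k set). \<Sum>b\<in>polys_below (degree d'). \<phi> a (?P * b) d)"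
    proof (intro sum.cong refl)
      fix t b
      show "\<phi> a (?P * (b + [:t:] * d')) d = \<phi> a (?P * b) d"
        using \<phi>_periodic[of a "?P * b" "[:t:]" d] unfolding d' by (simp add: algebra_simps)
    qed
    also have "\<dots> = H a d'"
      by (simp add: H_def d')
    also have "d' = d div ?P"
      by (simp add: d')
    finally show ?thesis
      using True by simp
  qed

  have D: "a \<noteq> 0 \<and> d \<noteq> 0 \<and> coprime a n" if "(a, d) \<in> ?D" for a d
    using that by (auto simp: hecke_diag_def)

  have lhs: "hecke_op n ?P (hecke_op n m f) e =
     (\<Sum>(a, d)\<in>?D. if poly a s = 0 then H a d else G a (?P * d)) +
     (if poly n s = 0 then 0 else (\<Sum>(a, d)\<in>?D. G (?P * a) d))"
  proof -
    have "(\<Sum>t\<in>UNIV. hecke_op n m f (edge_act (hecke_mat (1, [:t:], ?P)) e)) =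
      (\<Sum>t\<in>UNIV. \<Sum>(a, d)\<in>?D. \<Sum>b\<in>polys_below (degree d). \<phi> a (a * [:t:] + b * ?P) (?P * d))"
      unfolding hecke_op_eq sum_hecke_index \<phi>_def edge_act_mult[symmetric] hecke_mat_mult
      by (simp add: mult.commute)
    also have "\<dots> = (\<Sum>(a, d)\<in>?D. \<Sum>t\<in>UNIV. \<Sum>b\<in>polys_below (degree d). \<phi> a (a * [:t:] + b * ?P) (?P * d))"
      by (simp add: case_prod_beta' sum.swap[of _ ?D])
    also have "\<dots> = (\<Sum>(a, d)\<in>?D. if poly a s = 0 then H a d else G a (?P * d))"
      by (rule sum_case_prod_cong, rule left_all) (use D in blast)
    finally have 1: "(\<Sum>t\<in>UNIV. hecke_op n m f (edge_act (hecke_mat (1, [:t:], ?P)) e)) = \<dots>" .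
    have 2: "hecke_op n m f (edge_act (hecke_mat (?P, 0, 1)) e) = (\<Sum>(a, d)\<in>?D. G (?P * a) d)"
      unfolding hecke_op_eq sum_hecke_index G_def \<phi>_def edge_act_mult[symmetric] hecke_mat_mult
      by (simp add: mult.commute)
    show ?thesis
      unfolding hecke_op_lin 1 2 ..
  qed
  have rhs: "hecke_op n m (hecke_op n ?P f) e =
     (\<Sum>(a, d)\<in>?D. G a (?P * d)) +
     (if poly n s = 0 then 0 else (\<Sum>(a, d)\<in>?D. if poly d s = 0 then H (?P * a) (d div ?P) else G (?P * a) d))"
  proof -
    have 1: "(\<Sum>b\<in>polys_below (degree d). \<Sum>t\<in>UNIV. f (edge_act (hecke_mat (1, [:t:], ?P)) (edge_act (hecke_mat (a, b, d)) e))) =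
      (\<Sum>t\<in>UNIV. \<Sum>b\<in>polys_below (degree d). \<phi> a (1 * b + [:t:] * d) (?P * d))" for a d
      unfolding \<phi>_def edge_act_mult[symmetric] hecke_mat_mult
      by (subst sum.swap) simp
    have 2: "(\<Sum>b\<in>polys_below (degree d). f (edge_act (hecke_mat (?P, 0, 1)) (edge_act (hecke_mat (a, b, d)) e))) =
      (\<Sum>b\<in>polys_below (degree d). \<phi> (?P * a) (?P * b + 0 * d) d)" for a d
      unfolding \<phi>_def edge_act_mult[symmetric] hecke_mat_mult by simp
    have "hecke_op n m (hecke_op n ?P f) e =
      (\<Sum>(a, d)\<in>?D. \<Sum>b\<in>polys_below (degree d). hecke_op n ?P f (edge_act (hecke_mat (a, b, d)) e))"
      unfolding hecke_op_eq[of n m] sum_hecke_index ..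
    also have "\<dots> = (\<Sum>(a, d)\<in>?D. (\<Sum>t\<in>UNIV. \<Sum>b\<in>polys_below (degree d). \<phi> a (1 * b + [:t:] * d) (?P * d)) +
        (if poly n s = 0 then 0 else \<Sum>b\<in>polys_below (degree d). \<phi> (?P * a) (?P * b + 0 * d) d))"
      unfolding hecke_op_lin sum.distrib 1 2[symmetric] by (cases "poly n s = 0") simp_all
    also have "\<dots> = (\<Sum>(a, d)\<in>?D. G a (?P * d) +
        (if poly n s = 0 then 0 else if poly d s = 0 then H (?P * a) (d div ?P) else G (?P * a) d))"
    proof (rule sum_case_prod_cong)
      fix a d assume "(a, d) \<in> ?D"
      then have "d \<noteq> 0" using D by blast
      show "(\<Sum>t\<in>UNIV. \<Sum>b\<in>polys_below (degree d). \<phi> a (1 * b + [:t:] * d) (?P * d)) +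
        (if poly n s = 0 then 0 else \<Sum>b\<in>polys_below (degree d). \<phi> (?P * a) (?P * b + 0 * d) d) =
        G a (?P * d) + (if poly n s = 0 then 0 else if poly d s = 0 then H (?P * a) (d div ?P) else G (?P * a) d)"
        unfolding right_all[OF \<open>d \<noteq> 0\<close>] right_P[OF \<open>d \<noteq> 0\<close>] by (rule refl)
    qed
    finally show ?thesis
      by (simp add: case_prod_beta' sum.distrib)
  qed
  show "hecke_op n ?P (hecke_op n m f) e = hecke_op n m (hecke_op n ?P f) e"
  proof (cases "poly n s = 0")
    \<comment> \<open>Here \<open>T_P\<close> lacks the matrix diag(P, 1), and \<open>P\<close>
      cannot divide \<open>a\<close> because \<open>a\<close> is prime to \<open>n\<close>; no
      repetition occurs on either side.\<close>
    case True
    have "poly a s \<noteq> 0" if "(a, d) \<in> ?D" for a d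
    proof
      assume "poly a s = 0"
      then have "?P dvd a" "?P dvd n"
        using True by (simp_all add: linear_dvd_iff)
      then show False
        using D[OF that] lin_not_unit coprime_common_divisor by blast
    qed
    then have "(\<Sum>(a, d)\<in>?D. if poly a s = 0 then H a d else G a (?P * d)) = (\<Sum>(a, d)\<in>?D. G a (?P * d))"
      by (intro sum.cong) auto
    then show ?thesis
      unfolding lhs rhs using True by simp
  next
    case False
    let ?D1 = "{x \<in> ?D. poly (fst x) s = 0}" and ?D2 = "{x \<in> ?D. poly (snd x) s = 0}"
    have co: "coprime ?P n" using False by (simp add: coprime_linear_iff)
    have "(\<Sum>x\<in>?D1. H (fst x) (snd x) - G (fst x) (?P * snd x)) =
        (\<Sum>x\<in>?D2. H (?P * fst x) (snd x div ?P) - G (?P * fst x) (snd x))"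
    proof (rule sum.reindex_bij_witness[of _ "\<lambda>(a, d). (?P * a, d div ?P)" "\<lambda>(a, d). (a div ?P, ?P * d)"])
      fix x assume "x \<in> ?D1"
      then obtain a d where x: "x = (a, d)" "(a, d) \<in> ?D" "poly a s = 0" by (cases x) auto
      then obtain a' where a': "a = ?P * a'"
        unfolding linear_dvd_iff[symmetric] by (elim dvdE)
      have "lead_coeff a' = 1"
        using x(2) by (simp add: hecke_diag_def a' lead_coeff_mult lead_coeff_lin del: degree_lin)
      moreover have "coprime a' n"
        using D[OF x(2)] unfolding a' by (meson coprime_divisors dvd_refl dvd_triv_right)
      ultimately have "(a', ?P * d) \<in> ?D"
        using x(2) by (auto simp: hecke_diag_def a' lead_coeff_mult lead_coeff_lin mult_ac simp del: degree_lin)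
      then show "(case case x of (a, d) \<Rightarrow> (a div ?P, ?P * d) of (a, d) \<Rightarrow> (?P * a, d div ?P)) = x"
        "(case x of (a, d) \<Rightarrow> (a div ?P, ?P * d)) \<in> ?D2"
        "H (?P * fst (case x of (a, d) \<Rightarrow> (a div ?P, ?P * d))) (snd (case x of (a, d) \<Rightarrow> (a div ?P, ?P * d)) div ?P) -
          G (?P * fst (case x of (a, d) \<Rightarrow> (a div ?P, ?P * d))) (snd (case x of (a, d) \<Rightarrow> (a div ?P, ?P * d))) =
          H (fst x) (snd x) - G (fst x) (?P * snd x)"
        by (simp_all add: x a')
    next
      fix x assume "x \<in> ?D2"
      then obtain a d where x: "x = (a, d)" "(a, d) \<in> ?D" "poly d s = 0" by (cases x) auto
      then obtain d' where d': "d = ?P * d'"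
        unfolding linear_dvd_iff[symmetric] by (elim dvdE)
      have "lead_coeff d' = 1"
        using x(2) by (simp add: hecke_diag_def d' lead_coeff_mult lead_coeff_lin del: degree_lin)
      moreover have "coprime (?P * a) n"
        using D[OF x(2)] co by (intro coprime_mult_poly) auto
      ultimately have "(?P * a, d') \<in> ?D"
        using x(2) by (auto simp: hecke_diag_def d' lead_coeff_mult lead_coeff_lin mult_ac simp del: degree_lin)
      then show "(case case x of (a, d) \<Rightarrow> (?P * a, d div ?P) of (a, d) \<Rightarrow> (a div ?P, ?P * d)) = x"
        "(case x of (a, d) \<Rightarrow> (?P * a, d div ?P)) \<in> ?D1"
        by (simp_all add: x d')
    qed
    then show ?thesis
      unfolding lhs rhs using False
      by (simp add: case_prod_beta' sum_if_diff)
  qed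
qed

subsection \<open>Characters of the finite field\<close>

lemma of_nat_inverse_char:
  assumes "(of_nat k :: 'k::finite_field) \<noteq> 0"
  obtains u where "of_nat (u * k) = (1 :: 'k)"
proof -
  have "\<not> CHAR('k) dvd k"
    using assms by (simp add: of_nat_eq_0_iff_char_dvd)
  then have "coprime k CHAR('k)"
    by (metis CHAR_prime coprime_commute prime_imp_coprime)
  then obtain u where "[k * u = 1] (mod CHAR('k))"
    using cong_solve_coprime_nat by auto
  then have "of_nat (k * u) = (of_nat 1 :: 'k)"
    by (simp only: of_nat_eq_iff_cong_CHAR)
  then show ?thesis
    by (intro that[of u]) (simp add: mult.commute)
qed

text \<open>\<open>abs_trace\<close> takes its exponent from a \<open>THE\<close>, which needs this
  existence. A largest additively closed set of p-power order containing 0 is the whole field,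
  because adjoining a missing element multiplies the order by p.\<close>

lemma card_finite_field: "\<exists>r. CARD('k::finite_field) = CHAR('k) ^ r"
proof -
  let ?p = "CHAR('k)"
  have p: "?p > 1" using prime_gt_1_nat[OF CHAR_prime] .
  define good where "good r \<longleftrightarrow> (\<exists>S :: 'k set. 0 \<in> S \<and> (\<forall>x\<in>S. \<forall>y\<in>S. x + y \<in> S) \<and> card S = ?p ^ r)" for r
  have "good 0"
    unfolding good_def by (intro exI[of _ "{0}"]) auto
  moreover have "r \<le> CARD('k)" if good: "good r" for r
  proof -
    obtain S :: "'k set" where "card S = ?p ^ r" using good by (auto simp: good_def)
    then have "?p ^ r \<le> CARD('k)" using card_mono[of UNIV S] by simp
    moreover have "r < ?p ^ r" using p by (simp add: power_gt_expt)
    ultimately show ?thesis by simp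
  qed
  ultimately obtain r where r: "good r" "\<And>r'. good r' \<Longrightarrow> r' \<le> r"
    using GreatestI_nat[of good 0 "CARD('k)"] Greatest_le_nat[of good _ "CARD('k)"] by blast
  obtain S :: "'k set" where S: "0 \<in> S" "\<And>x y. x \<in> S \<Longrightarrow> y \<in> S \<Longrightarrow> x + y \<in> S" "card S = ?p ^ r"
    using r(1) by (auto simp: good_def)
  have mult: "of_nat k * x \<in> S" if "x \<in> S" for k x
    by (induction k) (use S that in \<open>auto simp: algebra_simps\<close>)
  have minus: "- x \<in> S" if "x \<in> S" for x
  proof -
    have "of_nat (?p - 1) * x = - x"
      using p by (simp add: of_nat_diff algebra_simps)
    then show ?thesis using mult[OF that] by metis
  qed
  have "S = UNIV"
  proof (rule ccontr)
    assume "S \<noteq> UNIV"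
    then obtain x where x: "x \<notin> S" by blast
    define h where "h = (\<lambda>(i, s). of_nat i * x + s)"
    have inj_aux: "i \<le> j" if "i < ?p" "s \<in> S" "s' \<in> S" "of_nat i * x + s = of_nat j * x + s'" for i j s s'
    proof (rule ccontr)
      assume "\<not> i \<le> j"
      then have ij: "of_nat (i - j) * x = s' + - s"
        using that(4) by (simp add: of_nat_diff algebra_simps)
      have "\<not> ?p dvd i - j"
        using \<open>\<not> i \<le> j\<close> that(1) by (auto dest: dvd_imp_le)
      then obtain u where u: "of_nat (u * (i - j)) = (1 :: 'k)"
        using of_nat_inverse_char of_nat_eq_0_iff_char_dvd by metis
      have "x = of_nat u * (of_nat (i - j) * x)"
        using u by (simp add: mult.assoc[symmetric])
      also have "\<dots> \<in> S"
        unfolding ij using that S minus mult by blast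
      finally show False using x by simp
    qed
    have "inj_on h ({..<?p} \<times> S)"
    proof (rule inj_onI, clarify)
      fix i s j s' assume *: "i < ?p" "j < ?p" "s \<in> S" "s' \<in> S" "h (i, s) = h (j, s')"
      then have "i = j"
        using inj_aux[of i s s' j] inj_aux[of j s' s i] by (auto simp: h_def)
      then show "i = j \<and> s = s'" using *(5) by (auto simp: h_def)
    qed
    then have S1: "card (h ` ({..<?p} \<times> S)) = ?p ^ Suc r"
      by (simp add: card_image card_cartesian_product S(3))
    have S2: "0 \<in> h ` ({..<?p} \<times> S)"
      by (rule image_eqI[of _ _ "(0, 0)"]) (use p S in \<open>auto simp: h_def\<close>)
    have S3: "a + b \<in> h ` ({..<?p} \<times> S)" if ab: "a \<in> h ` ({..<?p} \<times> S)" "b \<in> h ` ({..<?p} \<times> S)" for a b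
    proof -
      obtain i s j s' where *: "a = of_nat i * x + s" "b = of_nat j * x + s'" "s \<in> S" "s' \<in> S"
        using ab by (auto simp: h_def)
      have "of_nat ((i + j) mod ?p) = (of_nat (i + j) :: 'k)"
        by (simp only: of_nat_eq_iff_cong_CHAR cong_mod_left cong_refl)
      then have "a + b = h ((i + j) mod ?p, s + s')"
        by (simp add: * h_def algebra_simps)
      then show ?thesis
        using S * p by (intro image_eqI[of _ _ "((i + j) mod ?p, s + s')"]) auto
    qed
    have "good (Suc r)"
      unfolding good_def by (intro exI[of _ "h ` ({..<?p} \<times> S)"] conjI ballI S1 S2 S3)
    then show False using r(2)[of "Suc r"] by simp
  qed
  then show ?thesis using S(3) by blast
qed

definition field_degree :: "'k::finite_field itself \<Rightarrow> nat" where
  "field_degree _ = (THE r. CARD('k) = CHAR('k) ^ r)"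

lemma field_degree: "CARD('k::finite_field) = CHAR('k) ^ field_degree TYPE('k)"
proof -
  obtain r where r: "CARD('k) = CHAR('k) ^ r" using card_finite_field by blast
  have "CHAR('k) > 1" using prime_gt_1_nat[OF CHAR_prime] .
  then have "(THE r. CARD('k) = CHAR('k) ^ r) = r"
    by (intro the_equality) (simp_all add: r power_inject_exp)
  then show ?thesis using r by (simp add: field_degree_def)
qed

lemma abs_trace_eq:
  "abs_trace (x :: 'k::finite_field) = (\<Sum>i<field_degree TYPE('k). x ^ (CHAR('k) ^ i))"
  by (simp add: abs_trace_def field_degree_def)

lemma abs_trace_add: "abs_trace (x + y) = abs_trace x + abs_trace (y :: 'k::finite_field)"
  by (simp add: abs_trace_eq freshmans_dream'[OF CHAR_prime refl] sum.distrib)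

text \<open>X^p - X has at most p roots, and by additivity of the Frobenius the p multiples of 1 are
  already roots.\<close>

lemma prime_subfield_iff: "x \<in> prime_subfield \<longleftrightarrow> x ^ CHAR('k) = (x :: 'k::finite_field)"
proof -
  let ?p = "CHAR('k)"
  have p: "?p > 1" using prime_gt_1_nat[OF CHAR_prime] .
  define Q :: "'k poly" where "Q = monom 1 ?p - monom 1 1"
  have coeff: "coeff Q ?p = 1"
    using p by (simp add: Q_def)
  then have "Q \<noteq> 0" by auto
  have "degree Q \<le> ?p"
    unfolding Q_def using p by (intro degree_diff_le) (auto simp: degree_monom_eq)
  then have card_le: "card {x. poly Q x = 0} \<le> ?p"
    using card_poly_roots_bound[OF \<open>Q \<noteq> 0\<close>] by simp
  have roots: "poly Q x = 0 \<longleftrightarrow> x ^ ?p = x" for x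
    by (simp add: Q_def poly_monom)
  have sub: "of_nat ` {..<?p} \<subseteq> {x. poly Q x = 0}"
  proof
    fix x :: 'k assume "x \<in> of_nat ` {..<?p}"
    then obtain k where "x = of_nat k" by blast
    moreover have "(of_nat k :: 'k) ^ ?p = of_nat k"
    proof (induction k)
      case (Suc k)
      then show ?case
        by (simp add: freshmans_dream[OF CHAR_prime refl])
    qed (use p in simp)
    ultimately show "x \<in> {x. poly Q x = 0}" by (simp add: roots)
  qed
  have "inj_on (of_nat :: nat \<Rightarrow> 'k) {..<?p}"
    by (auto simp: inj_on_def of_nat_eq_iff_cong_CHAR cong_less_modulus_unique_nat)
  then have "card (of_nat ` {..<?p} :: 'k set) = ?p"
    by (simp add: card_image)
  then have eq: "of_nat ` {..<?p} = {x. poly Q x = 0}"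
    using sub card_le poly_roots_finite[OF \<open>Q \<noteq> 0\<close>] by (intro card_seteq) auto
  have "(of_int i :: 'k) \<in> of_nat ` {..<?p}" for i
  proof -
    have "(of_int i :: 'k) ^ ?p = of_int i"
    proof (cases "i \<ge> 0")
      case True
      then obtain k where "i = int k" using nonneg_int_cases by blast
      then show ?thesis
      proof -
        have "(of_nat k :: 'k) ^ ?p = of_nat k"
          by (induction k) (use p in \<open>simp_all add: freshmans_dream[OF CHAR_prime refl]\<close>)
        then show ?thesis using \<open>i = int k\<close> by simp
      qed
    next
      case False
      define k where "k = nat (- i)"
      have k: "of_int i = - (of_nat k :: 'k)"
        using False by (simp add: k_def)
      have "(of_nat k :: 'k) ^ ?p = of_nat k"
        by (induction k) (use p in \<open>simp_all add: freshmans_dream[OF CHAR_prime refl]\<close>)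
      then show ?thesis
        unfolding k by (simp add: minus_power_prime_CHAR[OF refl CHAR_prime])
    qed
    then show ?thesis unfolding eq by (simp add: roots)
  qed
  then have "prime_subfield = (of_nat ` {..<?p} :: 'k set)"
    unfolding prime_subfield_def by (auto simp: image_iff) (metis of_int_of_nat_eq)
  then show ?thesis
    unfolding eq roots by auto
qed

text \<open>The Frobenius permutes the conjugates cyclically because x^q = x, so it fixes their
  sum.\<close>

lemma abs_trace_in_prime_subfield: "abs_trace (x :: 'k::finite_field) \<in> prime_subfield"
proof -
  let ?p = "CHAR('k)" and ?r = "field_degree TYPE('k)"
  have "x ^ (?p ^ ?r) = x"
    using finite_field_power_card_eq_same[of x] by (simp add: field_degree)
  have "abs_trace x ^ ?p = (\<Sum>i<?r. (x ^ (?p ^ i)) ^ ?p)"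
    unfolding abs_trace_eq by (rule freshmans_dream_sum[OF CHAR_prime refl])
  also have "\<dots> = (\<Sum>i<?r. x ^ (?p ^ Suc i))"
    by (simp add: power_mult[symmetric] mult.commute)
  also have "\<dots> = (\<Sum>i<Suc ?r. x ^ (?p ^ i)) - x"
    by (subst sum.lessThan_Suc_shift) simp
  also have "\<dots> = abs_trace x"
    by (simp add: abs_trace_eq \<open>x ^ (?p ^ ?r) = x\<close>)
  finally show ?thesis by (simp add: prime_subfield_iff)
qed

lemma abs_trace_scale:
  assumes "k \<in> prime_subfield" shows "abs_trace (k * x) = k * abs_trace (x :: 'k::finite_field)"
proof -
  have "k ^ (CHAR('k) ^ i) = k" for i
    by (induction i) (use assms in \<open>simp_all add: prime_subfield_iff power_mult mult.commute\<close>)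
  then show ?thesis
    by (simp add: abs_trace_eq power_mult_distrib sum_distrib_left)
qed

text \<open>The trace is given by a nonzero polynomial of degree at most q/p, which has fewer than q
  roots.\<close>

lemma abs_trace_nonzero: "\<exists>x :: 'k::finite_field. abs_trace x \<noteq> 0"
proof (rule ccontr)
  let ?p = "CHAR('k)" and ?r = "field_degree TYPE('k)"
  assume "\<nexists>x :: 'k. abs_trace x \<noteq> 0"
  then have 0: "abs_trace x = 0" for x :: 'k by blast
  have p: "?p > 1" using prime_gt_1_nat[OF CHAR_prime] .
  have "CARD('k) > 1"
    using card_mono[of UNIV "{0, 1 :: 'k}"] by simp
  then obtain r where r: "?r = Suc r"
    using field_degree[where ?'k = 'k] by (cases ?r) auto
  define Q :: "'k poly" where "Q = (\<Sum>i<?r. monom 1 (?p ^ i))"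
  have "coeff Q (?p ^ r) = (\<Sum>i<?r. if i = r then 1 else 0)"
    unfolding Q_def coeff_sum using p by (intro sum.cong) (auto simp: power_inject_exp)
  then have "coeff Q (?p ^ r) = 1"
    by (simp add: r)
  then have "Q \<noteq> 0" by auto
  have "degree Q \<le> ?p ^ r"
    unfolding Q_def
    by (rule degree_sum_le) (use p r in \<open>auto simp: degree_monom_eq intro!: power_increasing\<close>)
  moreover have "card {x. poly Q x = 0} \<le> degree Q"
    by (rule card_poly_roots_bound[OF \<open>Q \<noteq> 0\<close>])
  moreover have "{x. poly Q x = 0} = UNIV"
    using 0 by (auto simp: Q_def poly_sum poly_monom abs_trace_eq)
  ultimately have "CARD('k) \<le> ?p ^ r" by simp
  also have "\<dots> < ?p ^ ?r" using p by (simp add: r)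
  finally show False by (simp add: field_degree)
qed

text \<open>The trace is linear over the prime field and nonzero, hence takes every value there, so
  its composite with \<open>\<eta>0\<close> is a nontrivial additive character. Translating by an
  element of character value other than 1 forces the sum to vanish.\<close>

lemma character_sum:
  fixes \<eta>0 :: "'k::finite_field \<Rightarrow> complex"
  assumes \<eta>: "nontrivial_character \<eta>0"
  shows "(\<Sum>c\<in>UNIV. \<eta>0 (abs_trace (- c))) = 0" "\<eta>0 (abs_trace 0) = 1"
proof -
  define \<omega> where "\<omega> x = \<eta>0 (abs_trace x)" for x
  have add: "\<omega> (x + y) = \<omega> x * \<omega> y" for x y
    using \<eta> by (simp add: \<omega>_def abs_trace_add nontrivial_character_def abs_trace_in_prime_subfield)
  have nz: "\<omega> x \<noteq> 0" for x
    using \<eta> by (simp add: \<omega>_def nontrivial_character_def abs_trace_in_prime_subfield)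
  show "\<eta>0 (abs_trace 0) = 1"
    using add[of 0 0] nz[of 0] by (simp add: \<omega>_def)
  obtain x0 where x0: "x0 \<in> prime_subfield" "\<eta>0 x0 \<noteq> 1"
    using \<eta> by (auto simp: nontrivial_character_def)
  obtain c where c: "abs_trace c \<noteq> (0 :: 'k)"
    using abs_trace_nonzero by blast
  have "x0 / abs_trace c \<in> prime_subfield"
    using x0(1) abs_trace_in_prime_subfield[of c] by (simp add: prime_subfield_iff power_divide)
  then have "abs_trace (x0 / abs_trace c * c) = x0"
    unfolding abs_trace_scale[OF \<open>x0 / abs_trace c \<in> prime_subfield\<close>] using c by simp
  then obtain a where a: "\<omega> a \<noteq> 1"
    using x0(2) unfolding \<omega>_def by metis
  have "\<omega> a * (\<Sum>x\<in>UNIV. \<omega> x) = (\<Sum>x\<in>UNIV. \<omega> (a + x))"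
    by (simp add: add sum_distrib_left)
  also have "\<dots> = (\<Sum>x\<in>UNIV. \<omega> x)"
    by (rule sum.reindex_bij_witness[of _ "\<lambda>x. x - a" "\<lambda>x. a + x"]) auto
  finally have "(\<Sum>x\<in>UNIV. \<omega> x) = 0"
    using a by simp
  moreover have "(\<Sum>x\<in>UNIV. \<omega> (- x)) = (\<Sum>x\<in>UNIV. \<omega> x)"
    by (rule sum.reindex_bij_witness[of _ uminus uminus]) auto
  ultimately show "(\<Sum>c\<in>UNIV. \<eta>0 (abs_trace (- c))) = 0"
    by (simp add: \<omega>_def)
qed

subsection \<open>Values near the cusp infinity\<close>

definition upper_edge :: "nat \<Rightarrow> 'k::finite_field fls \<Rightarrow> ('k fls^2^2) set" where
  "upper_edge k u = edge_class (mat2 (fls_X ^ k) u 0 1)"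

text \<open>In terms of Fourier coefficients this is \<open>(f|T\<^sub>P)\<^sup>*(1)\<close> for \<open>P = T - s\<close>.\<close>

definition coord :: "('k::finite_field, int) cochain \<Rightarrow> 'k \<Rightarrow> int" where
  "coord f s = f (upper_edge 3 (fls_X + fls_const s * fls_X ^ 2))"

lemma sum_split_0: "(\<Sum>t\<in>UNIV. h t) = h 0 + (\<Sum>t\<in>UNIV - {0}. h t)"
  for h :: "'k::{finite,zero} \<Rightarrow> 'b::comm_monoid_add"
  by (rule sum.remove) auto

lemma card_nonzero: "int (card (UNIV - {0 :: 'k::finite_field})) = int CARD('k) - 1"
  using card_field_ge_2[where ?'k = 'k] by (simp add: card_Diff_singleton of_nat_diff)

text \<open>With x = 1/y, the entry x + s x^2 is 1/(y - s) expanded modulo x^3. The last factor is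
  \<open>y\<close> times an Iwahori matrix when x = \<pi> and \<open>s\<close> is constant, so the
  two sides represent the same edge.\<close>

lemma coord_matrix:
  fixes x y s :: "'a::field"
  assumes "x * y = 1"
  shows "mat2 0 1 x (y - s) = mat2 (x ^ 3) (x + s * x ^ 2) 0 1 **
    mat2 (y * - (1 + s * x)) (y * (s * s)) (y * x ^ 2) (y * (1 - s * x))"
proof -
  have "x \<noteq> 0"
    using assms by auto
  moreover from this have "y = 1 / x"
    using assms by (simp add: field_simps)
  ultimately show ?thesis
    by (simp add: mat2_mult field_simps power2_eq_square power3_eq_cube)
qed

text \<open>The same expansion for (t + x)/(y - s) modulo x^3. The left side is the image of
  (\<pi>^2, \<pi>) under the Hecke matrix with rows (1, t) and (0, T - s).\<close>

lemma hecke_matrix: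
  fixes x y s t :: "'a::field"
  assumes "x * y = 1"
  shows "mat2 (x ^ 2) (t + x) 0 (y - s) = mat2 (x ^ 3) (t * x + (1 + t * s) * x ^ 2) 0 1 **
    mat2 (y * 1) (y * (s * (1 + t * s))) (y * 0) (y * (1 - s * x))"
proof -
  have "x \<noteq> 0"
    using assms by auto
  moreover from this have "y = 1 / x"
    using assms by (simp add: field_simps)
  ultimately show ?thesis
    by (simp add: mat2_mult field_simps power2_eq_square power3_eq_cube)
qed

context bounded_cochain
begin

lemma upper_edge_split: "f (upper_edge k u) = (\<Sum>t\<in>UNIV. f (upper_edge (Suc k) (u + fls_const t * fls_X ^ k)))"
proof -
  have GL: "mat2 (fls_X ^ k) u 0 1 \<in> GL2_Finf"
    by (simp add: GL2_Finf_mat2_iff)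
  have eq: "mat2 (fls_X ^ k) u 0 1 ** mat2 fls_X (fls_const t) 0 1 =
      mat2 (fls_X ^ Suc k) (u + fls_const t * fls_X ^ k) 0 1" for t
    by (simp add: mat2_mult algebra_simps)
  show ?thesis
    using harmonic_split[OF harmonic GL] unfolding eq upper_edge_def .
qed

text \<open>diag(c, 1) lies in \<open>Gamma0 n\<close> for nonzero constants \<open>c\<close>. Sums
  over F_q thereby collapse to the term at 0 and q - 1 equal terms.\<close>

lemma upper_edge_scale:
  assumes "c \<noteq> 0" shows "f (upper_edge k (fls_const c * u)) = f (upper_edge k u)"
proof -
  have "poly_mat [:c:] 0 0 1 \<in> Gamma0 n"
    using assms by (intro Gamma0I) (auto simp: is_unit_triv)
  then have "f (upper_edge k u) = f (edge_class (mat2 (fls_const c) 0 0 1 ** mat2 (fls_X ^ k) u 0 1))"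
    by (simp add: invariant_edge upper_edge_def)
  also have "edge_class (mat2 (fls_const c) 0 0 1 ** mat2 (fls_X ^ k) u 0 1) = upper_edge k (fls_const c * u)"
    unfolding upper_edge_def
    by (rule edge_class_eqI[of _ _ 1 "fls_const c" 0 0 1]) (use assms in \<open>auto simp: mat2_mult\<close>)
  finally show ?thesis by simp
qed

text \<open>The edge is the reverse of one at level \<open>k\<close> with bottom row (1, 0), which
  explains the sign and the shift of the index.\<close>

lemma upper_edge_0: "f (upper_edge (Suc k) 0) = - W k 1 0"
proof -
  have "symbol_edge (- int (Suc k)) 1 0 0 1 = mat2 (fls_X ^ Suc k) 0 0 (1 :: 'k fls)"
    unfolding symbol_edge_def tpow_minus_nat by simp
  moreover have "nat (- (- int (Suc k)) - 1) = k" by simp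
  ultimately show ?thesis
    using symbol_value[of 1 1 0 0 "- int (Suc k)"] by (simp add: upper_edge_def)
qed

text \<open>The bridge from the neighbourhood of infinity to the symbols: through it the vanishing
  and divisibility results for \<open>W\<close> become statements about coordinates.\<close>

lemma coord_eq: "coord f s = - W 0 (lin s) 1"
proof -
  let ?X = "fls_X :: 'k fls" and ?Y = "fls_X_inv :: 'k fls" and ?s = "fls_const s"
  have "edge_class (symbol_edge 0 1 0 (lin s) 1 ** rev_mat) = upper_edge 3 (?X + ?s * ?X ^ 2)"
    unfolding upper_edge_def
  proof (rule edge_class_eqI[where z = ?Y and a = "- (1 + ?s * ?X)" and b = "?s * ?s" and c = "?X ^ 2" and d = "1 - ?s * ?X"])
    have "symbol_edge 0 1 0 (lin s) 1 ** rev_mat = mat2 0 1 ?X (?Y - ?s)"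
      by (simp add: symbol_edge_def mat2_mult lin_def A_to_Finf_linear)
    also have "\<dots> = mat2 (?X ^ 3) (?X + ?s * ?X ^ 2) 0 1 **
        mat2 (?Y * - (1 + ?s * ?X)) (?Y * (?s * ?s)) (?Y * ?X ^ 2) (?Y * (1 - ?s * ?X))"
      by (rule coord_matrix) simp
    finally show "symbol_edge 0 1 0 (lin s) 1 ** rev_mat = \<dots>" .
    have "?s * ?X \<in> val_ge 1"
      by (simp add: val_ge_mult0)
    then show "fls_unit (- (1 + ?s * ?X))" "fls_unit (1 - ?s * ?X)"
      unfolding fls_unit_uminus by (simp_all add: fls_unit_add fls_unit_diff)
    show "?X ^ 2 \<in> val_ge 1"
      unfolding power2_eq_square by (rule val_ge_mult0[OF val_ge_mono[OF val_ge_X]]) simp_all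
    show "?s * ?s \<in> val_ge 0" by (rule val_ge_mult0) simp_all
  qed simp
  moreover have "f (edge_class (symbol_edge 0 1 0 (lin s) 1 ** rev_mat)) = - f (edge_class (symbol_edge 0 1 0 (lin s) 1))"
    by (rule harmonic_rev[OF harmonic symbol_edge_GL2]) simp
  moreover have "f (edge_class (symbol_edge 0 1 0 (lin s) 1)) = W 0 (lin s) 1"
    by (subst symbol_value) auto
  ultimately show ?thesis
    by (simp add: coord_def)
qed

lemma upper_edge_2_1: "f (upper_edge 2 fls_X) = (\<Sum>s\<in>UNIV. coord f s)"
  using upper_edge_split[of 2 fls_X] by (simp add: coord_def eval_nat_numeral)

text \<open>The value on (\<pi>, 0) is minus the vanishing symbol at the cusp 0; splitting this edge
  and scaling by constants gives the relation.\<close>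

lemma upper_edge_2_0: "f (upper_edge 2 0) = - (int CARD('k) - 1) * f (upper_edge 2 fls_X)"
proof -
  have "0 = f (upper_edge 1 0)"
    using upper_edge_0[of 0] cusp_zero by simp
  also have "\<dots> = (\<Sum>t\<in>UNIV. f (upper_edge 2 (fls_const t * fls_X)))"
    using upper_edge_split[of 1 0] by (simp add: numeral_2_eq_2)
  also have "\<dots> = f (upper_edge 2 0) + (\<Sum>t\<in>UNIV - {0::'k}. f (upper_edge 2 fls_X))"
    unfolding sum_split_0 by (simp add: upper_edge_scale)
  finally show ?thesis
    by (simp add: card_nonzero algebra_simps)
qed

context
  assumes degree_n: "degree n = 3"
begin

text \<open>In degree three the value on (\<pi>^3, 0) vanishes. So the value on (\<pi>^2, 0) is q -
  1 times the one on (\<pi>^3, \<pi>^2), while \<open>upper_edge_2_0\<close> expresses it by the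
  value on (\<pi>^2, \<pi>); the factor q - 1 cancels.\<close>

lemma upper_edge_3_2: "f (upper_edge 3 (fls_X ^ 2)) = - f (upper_edge 2 fls_X)"
proof -
  have 0: "f (upper_edge 3 0) = 0"
    using upper_edge_0[of 2] W_eq_0[of 1 0 2] degree_n by (simp add: eval_nat_numeral)
  have "f (upper_edge 2 0) = (\<Sum>t\<in>UNIV. f (upper_edge 3 (fls_const t * fls_X ^ 2)))"
    using upper_edge_split[of 2 0] by (simp add: eval_nat_numeral)
  also have "\<dots> = (\<Sum>t\<in>UNIV - {0::'k}. f (upper_edge 3 (fls_X ^ 2)))"
    unfolding sum_split_0 by (simp add: upper_edge_scale 0)
  finally have "f (upper_edge 2 0) = (int CARD('k) - 1) * f (upper_edge 3 (fls_X ^ 2))"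
    by (simp add: card_nonzero)
  then have "(int CARD('k) - 1) * (f (upper_edge 3 (fls_X ^ 2)) + f (upper_edge 2 fls_X)) = 0"
    unfolding upper_edge_2_0 by (simp only: distrib_left mult_minus_left)
  then show ?thesis
    using card_field_ge_2[where ?'k = 'k] by (simp add: eq_neg_iff_add_eq_0)
qed

text \<open>The matrix diag(P, 1), if it occurs, contributes a vanishing value. For t \<noteq> 0 the
  terms are the coordinates at s + 1/t, that is, all coordinates except the one at \<open>s\<close>.
  The term t = 0 is minus the sum of all coordinates, so just the missing coordinate survives, with
  a minus sign.\<close>

lemma hecke_lin_upper_edge: "hecke_op n (lin s) f (upper_edge 2 fls_X) = - coord f s"
proof -
  let ?X = "fls_X :: 'k fls" and ?Y = "fls_X_inv :: 'k fls" and ?s = "fls_const s"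
  have XY: "?X * ?Y = 1" "?X ^ 3 * ?Y = ?X ^ 2" "?X ^ 2 * ?Y = ?X"
    by (simp_all add: power2_eq_square power3_eq_cube mult.assoc)
  have unit: "fls_unit (1 - ?s * ?X)"
    by (simp add: fls_unit_diff val_ge_mult0)
  have P: "A_to_Finf (lin s) = ?Y - ?s"
    by (simp add: lin_def A_to_Finf_linear)
  have last: "f (edge_act (hecke_mat (lin s, 0, 1)) (upper_edge 2 ?X)) = 0"
  proof -
    have m: "poly_mat 1 1 0 1 \<in> Gamma0 n"
      by (rule Gamma0I) auto
    have "edge_act (hecke_mat (lin s, 0, 1)) (upper_edge 2 ?X) =
        edge_class (mat2 1 1 0 1 ** mat2 (?X ^ 1) 0 0 1)"
      unfolding upper_edge_def edge_act_edge_class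
    proof (rule edge_class_eqI[where z = 1 and a = "1 - ?s * ?X" and b = "- ?s" and c = 0 and d = 1])
      have "(?Y - ?s) * ?X ^ 2 = ?X ^ 2 * ?Y - ?s * ?X ^ 2" "(?Y - ?s) * ?X = ?X * ?Y - ?s * ?X"
        by (simp_all add: algebra_simps)
      then show "hecke_mat (lin s, 0, 1) ** mat2 (?X ^ 2) ?X 0 1 = mat2 1 1 0 1 ** mat2 (?X ^ 1) 0 0 1 **
          mat2 (1 * (1 - ?s * ?X)) (1 * - ?s) (1 * 0) (1 * 1)"
        by (simp add: hecke_mat_def P mat2_mult XY) (simp add: algebra_simps power2_eq_square)
    qed (use unit in \<open>auto simp: val_ge_uminus\<close>)
    then have "f (edge_act (hecke_mat (lin s, 0, 1)) (upper_edge 2 ?X)) = f (upper_edge 1 0)"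
      using invariant_edge[OF m] by (simp add: upper_edge_def)
    then show ?thesis
      using upper_edge_0[of 0] cusp_zero by simp
  qed
  have summand: "edge_act (hecke_mat (1, [:t:], lin s)) (upper_edge 2 ?X) =
      upper_edge 3 (fls_const t * ?X + (1 + fls_const t * ?s) * ?X ^ 2)" for t
  proof -
    let ?t = "fls_const t"
    let ?u = "?t * ?X + (1 + ?t * ?s) * ?X ^ 2"
    show ?thesis
      unfolding upper_edge_def edge_act_edge_class
    proof (rule edge_class_eqI[where z = ?Y and a = 1 and b = "?s * (1 + ?t * ?s)" and c = 0 and d = "1 - ?s * ?X"])
      have "hecke_mat (1, [:t:], lin s) ** mat2 (?X ^ 2) ?X 0 1 = mat2 (?X ^ 2) (?t + ?X) 0 (?Y - ?s)"
        by (simp add: hecke_mat_def P mat2_mult)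
      also have "\<dots> = mat2 (?X ^ 3) ?u 0 1 **
          mat2 (?Y * 1) (?Y * (?s * (1 + ?t * ?s))) (?Y * 0) (?Y * (1 - ?s * ?X))"
        by (rule hecke_matrix) simp
      finally show "hecke_mat (1, [:t:], lin s) ** mat2 (?X ^ 2) ?X 0 1 = mat2 (?X ^ 3) ?u 0 1 **
          mat2 (?Y * 1) (?Y * (?s * (1 + ?t * ?s))) (?Y * 0) (?Y * (1 - ?s * ?X))" .
      show "?s * (1 + ?t * ?s) \<in> val_ge 0"
        by (intro val_ge_mult0 val_ge_add) auto
    qed (use unit in auto)
  qed
  have nonzero: "f (upper_edge 3 (fls_const t * ?X + (1 + fls_const t * ?s) * ?X ^ 2)) = coord f (s + 1 / t)"
    if "t \<noteq> 0" for t
  proof -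
    have "fls_const t * fls_const (s + 1 / t) = 1 + fls_const t * ?s"
    proof -
      have "t * (s + 1 / t) = 1 + t * s"
        using that by (simp add: field_simps)
      then have "fls_const t * fls_const (s + 1 / t) = fls_const (1 + t * s)"
        by (simp only: fls_const_mult_const)
      also have "\<dots> = 1 + fls_const t * ?s"
        by (simp only: fls_plus_const[symmetric] fls_const_1 fls_const_mult_const)
      finally show ?thesis .
    qed
    then have "fls_const t * ?X + (1 + fls_const t * ?s) * ?X ^ 2 = fls_const t * (?X + fls_const (s + 1 / t) * ?X ^ 2)"
      by (simp only: distrib_left mult.assoc[symmetric])
    then show ?thesis
      by (simp only: upper_edge_scale[OF that] coord_def)
  qed
  have "(\<Sum>t\<in>UNIV. f (edge_act (hecke_mat (1, [:t:], lin s)) (upper_edge 2 ?X))) =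
      f (upper_edge 3 (?X ^ 2)) + (\<Sum>t\<in>UNIV - {0}. coord f (s + 1 / t))"
    unfolding summand sum_split_0 using nonzero by simp
  also have "(\<Sum>t\<in>UNIV - {0}. coord f (s + 1 / t)) = (\<Sum>c\<in>UNIV - {s}. coord f c)"
    by (rule sum.reindex_bij_witness[of _ "\<lambda>c. 1 / (c - s)" "\<lambda>t. s + 1 / t"]) auto
  also have "\<dots> = (\<Sum>c\<in>UNIV. coord f c) - coord f s"
    by (simp add: sum_diff1)
  finally show ?thesis
    by (simp add: hecke_op_lin last upper_edge_3_2 upper_edge_2_1)
qed

lemma coord_dvd:
  assumes "\<And>s. m dvd coord f s" shows "m dvd f e"
  using value_dvd[OF degree_n, of m e] assms by (simp add: coord_eq)

lemma coord_double_root: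
  assumes "n = lin r * h" "poly h r = 0"
  shows "coord f r = 0"
  using double_root[OF assms(1) degree_n assms(2)] by (simp add: coord_eq)

end

text \<open>By scaling, the q - 1 nonzero residues contribute the value at (\<pi>^2, \<pi>) times a
  character sum equal to -1. The residue 0 contributes -(q - 1) times the same value. The total
  factor -q cancels the normalization, which makes the coefficient integral.\<close>

lemma fourier_coeff_1:
  assumes \<eta>: "nontrivial_character \<eta>0"
  shows "fourier_coeff \<eta>0 f 1 = of_int (- f (upper_edge 2 fls_X))"
proof -
  have reps: "pi_reps 2 = range (\<lambda>c :: 'k. fls_const c * fls_X)"
  proof (intro equalityI subsetI)
    fix u :: "'k fls" assume u: "u \<in> pi_reps 2"
    show "u \<in> range (\<lambda>c :: 'k. fls_const c * fls_X)"
    proof (rule range_eqI[of _ _ "fls_nth u 1"], rule fls_eqI)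
      fix i
      have "fls_nth u i \<noteq> 0 \<longrightarrow> 1 \<le> i \<and> i < int 2"
        using u unfolding pi_reps_def by blast
      then have "fls_nth u i = 0" if "i \<noteq> 1"
        using that by linarith
      then show "fls_nth u i = fls_nth (fls_const (fls_nth u 1) * fls_X) i"
        by (cases "i = 1") simp_all
    qed
  next
    fix u assume "u \<in> range (\<lambda>c :: 'k. fls_const c * fls_X)"
    then obtain c where "u = fls_const c * fls_X" by blast
    then show "u \<in> pi_reps 2"
      by (simp add: pi_reps_def)
  qed
  have inj: "inj (\<lambda>c :: 'k. fls_const c * fls_X)"
  proof (rule injI)
    fix x y :: 'k assume "fls_const x * fls_X = fls_const y * fls_X"
    from arg_cong[OF this, of "\<lambda>x. fls_nth x 1"] show "x = y" by simp
  qed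
  let ?\<omega> = "\<lambda>c :: 'k. \<eta>0 (abs_trace (- c))"
  have "(\<Sum>u\<in>pi_reps (2 + degree (1 :: 'k poly)). of_int (f (edge_class (mat2 (fls_X ^ (2 + degree (1 :: 'k poly))) u 0 1))) *
        eta_character \<eta>0 (- (A_to_Finf 1 * u))) =
      (\<Sum>c\<in>UNIV. of_int (f (upper_edge 2 (fls_const c * fls_X))) * ?\<omega> c)"
    by (simp add: reps sum.reindex[OF inj] eta_character_def upper_edge_def)
  also have "\<dots> = of_int (f (upper_edge 2 0)) * ?\<omega> 0 + (\<Sum>c\<in>UNIV - {0}. of_int (f (upper_edge 2 fls_X)) * ?\<omega> c)"
    unfolding sum_split_0 by (simp add: upper_edge_scale)
  also have "(\<Sum>c\<in>UNIV - {0}. of_int (f (upper_edge 2 fls_X)) * ?\<omega> c) =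
      of_int (f (upper_edge 2 fls_X)) * ((\<Sum>c\<in>UNIV. ?\<omega> c) - ?\<omega> 0)"
    by (simp add: sum_distrib_left[symmetric] sum_diff1)
  also have "of_int (f (upper_edge 2 0)) * ?\<omega> 0 + \<dots> = - of_nat CARD('k) * of_int (f (upper_edge 2 fls_X))"
    unfolding character_sum(1)[OF \<eta>] using character_sum(2)[OF \<eta>]
    by (simp add: upper_edge_2_0 algebra_simps)
  finally show ?thesis
    by (simp add: fourier_coeff_def)
qed

end

subsection \<open>Saturated lattices\<close>

text \<open>A nonzero saturated lattice contains a vector on which some integral form takes the
  value \<open>1\<close>: one where such a form takes its least positive value. Split it off and induct on
  the rank.\<close>

lemma saturated_frame:
  fixes L :: "('k::finite \<Rightarrow> int) set"
  assumes "(\<lambda>_. 0) \<in> L" "\<And>x y. x \<in> L \<Longrightarrow> y \<in> L \<Longrightarrow> (\<lambda>s. x s - y s) \<in> L"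
    "\<And>m x. m \<noteq> 0 \<Longrightarrow> (\<lambda>s. m * x s) \<in> L \<Longrightarrow> x \<in> L"
  shows "\<exists>F. (\<forall>s. F s \<in> L) \<and> (\<forall>x\<in>L. \<forall>t. x t = (\<Sum>s\<in>UNIV. x s * F s t))"
  using assms
proof (induction "dim ((\<lambda>x. \<chi> s. real_of_int (x s)) ` L)" arbitrary: L rule: less_induct)
  case less
  note zero = less.prems(1) and diff = less.prems(2) and sat = less.prems(3)
  have add: "(\<lambda>s. x s + y s) \<in> L" if "x \<in> L" "y \<in> L" for x y
    using diff[OF that(1) diff[OF zero that(2)]] by simp
  have nat_mult: "(\<lambda>s. int k * x s) \<in> L" if "x \<in> L" for k x
  proof (induction k)
    case (Suc k)
    from add[OF this that] show ?case by (simp add: algebra_simps)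
  qed (use zero in simp)
  have mult: "(\<lambda>s. k * x s) \<in> L" if "x \<in> L" for k x
  proof (cases "k \<ge> 0")
    case True
    then show ?thesis using nat_mult[OF that, of "nat k"] by simp
  next
    case False
    then show ?thesis using diff[OF zero nat_mult[OF that, of "nat (- k)"]] by simp
  qed
  have sum: "(\<lambda>t. \<Sum>u\<in>S. c u * F u t) \<in> L" if "\<And>u. F u \<in> L" "finite S" for F :: "'k \<Rightarrow> 'k \<Rightarrow> int" and c S
    using that(2)
  proof (induction S rule: finite_induct)
    case (insert u S)
    have "(\<lambda>t. c u * F u t + (\<Sum>v\<in>S. c v * F v t)) \<in> L"
      by (intro add mult that insert)
    with insert show ?case by simp
  qed (use zero in simp)
  show ?case
  proof (cases "\<forall>x\<in>L. \<forall>s. x s = 0")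
    case True
    then show ?thesis
      using zero by (intro exI[of _ "\<lambda>_ _. 0"]) auto
  next
    case False
    define P where "P c \<longleftrightarrow> c > 0 \<and> (\<exists>w \<alpha>. w \<in> L \<and> int c = (\<Sum>s\<in>UNIV. \<alpha> s * w s))" for c :: nat
    obtain w0 s0 where w0: "w0 \<in> L" "w0 s0 \<noteq> (0 :: int)"
      using False by blast
    have "P (nat \<bar>w0 s0\<bar>)"
      unfolding P_def
    proof (intro conjI exI)
      have "sgn (w0 s0) * w0 s0 = \<bar>w0 s0\<bar>"
        by (simp add: abs_sgn mult.commute)
      then show "int (nat \<bar>w0 s0\<bar>) = (\<Sum>s\<in>UNIV. (if s = s0 then sgn (w0 s0) else 0) * w0 s)"
        by (simp add: if_distrib[of "\<lambda>x. x * _"] cong: if_cong)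
    qed (use w0 in auto)
    then obtain c where c: "P c" "\<And>c'. P c' \<Longrightarrow> c \<le> c'"
      using LeastI[of P] Least_le[of P] by blast
    obtain w \<alpha> where w: "w \<in> L" "int c = (\<Sum>s\<in>UNIV. \<alpha> s * w s)" and "c > 0"
      using c(1) by (auto simp: P_def)
    \<comment> \<open>The remainder of \<open>w s\<close> modulo \<open>c\<close> is again the value
      of an integral form at \<open>w\<close>, namely of the coordinate \<open>s\<close> minus a
      multiple of \<open>\<alpha>\<close>. A nonzero remainder would contradict the minimality of
      \<open>c\<close>.\<close>
    have "int c dvd w s" for s
    proof (rule ccontr)
      assume "\<not> int c dvd w s"
      define r where "r = w s mod int c"
      have r: "0 < r" "r < int c"
        using \<open>\<not> int c dvd w s\<close> \<open>c > 0\<close> unfolding r_def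
        by (metis dvd_eq_mod_eq_0 int_ops(1) of_nat_0_less_iff order_le_less pos_mod_sign, simp)
      have "r = w s - w s div int c * int c"
        by (simp add: r_def minus_div_mult_eq_mod)
      also have "\<dots> = (\<Sum>t\<in>UNIV. ((if t = s then 1 else 0) - w s div int c * \<alpha> t) * w t)"
        unfolding w(2) left_diff_distrib sum_subtractf mult.assoc sum_distrib_left[symmetric]
        by (simp add: if_distrib[of "\<lambda>x. x * _"] cong: if_cong)
      finally have "P (nat r)"
        unfolding P_def using r w(1) by (intro conjI exI[of _ w] exI[of _ "\<lambda>t. (if t = s then 1 else 0) - w s div int c * \<alpha> t"]) auto
      with c(2)[of "nat r"] r show False by linarith
    qed
    then have "\<forall>s. \<exists>v. w s = int c * v" by (auto elim: dvdE)
    then obtain v where v: "\<And>s. w s = int c * v s" by metis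
    have "v \<in> L"
    proof (rule sat)
      show "(\<lambda>s. int c * v s) \<in> L" using w(1) unfolding v[symmetric] .
    qed (use \<open>c > 0\<close> in simp)
    have "int c * (\<Sum>s\<in>UNIV. \<alpha> s * v s) = int c * 1"
      using w(2) by (simp add: v sum_distrib_left mult_ac)
    then have \<alpha>v: "(\<Sum>s\<in>UNIV. \<alpha> s * v s) = 1"
      using \<open>c > 0\<close> by (subst (asm) mult_cancel_left) simp
    define ev where "ev x = (\<Sum>s\<in>UNIV. \<alpha> s * x s)" for x :: "'k \<Rightarrow> int"
    define L' where "L' = {x \<in> L. ev x = 0}"
    let ?I = "(\<lambda>x. \<chi> s. real_of_int (x s))"
    have "dim (?I ` L') < dim (?I ` L)"
    proof (rule dim_psubset, rule psubsetI)
      show "span (?I ` L') \<subseteq> span (?I ` L)"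
        by (intro span_mono image_mono) (auto simp: L'_def)
      define H where "H = {y :: real^'k. (\<Sum>s\<in>UNIV. real_of_int (\<alpha> s) * y $ s) = 0}"
      have "subspace H"
        unfolding subspace_def H_def
        by (auto simp: algebra_simps sum.distrib) (simp add: mult.left_commute sum_distrib_left[symmetric])
      moreover have "?I ` L' \<subseteq> H"
      proof (intro image_subsetI)
        fix x assume "x \<in> L'"
        then have "real_of_int (ev x) = 0" by (simp add: L'_def)
        then show "?I x \<in> H" by (simp add: H_def ev_def)
      qed
      ultimately have "span (?I ` L') \<subseteq> H"
        by (simp add: span_minimal)
      moreover have "?I v \<notin> H"
      proof -
        have "(\<Sum>s\<in>UNIV. real_of_int (\<alpha> s) * ?I v $ s) = real_of_int (\<Sum>s\<in>UNIV. \<alpha> s * v s)"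
          by simp
        then show ?thesis by (simp add: H_def \<alpha>v del: of_int_sum)
      qed
      moreover have "?I v \<in> span (?I ` L)"
        using \<open>v \<in> L\<close> by (simp add: span_base)
      ultimately show "span (?I ` L') \<noteq> span (?I ` L)" by blast
    qed
    then have "\<exists>F. (\<forall>s. F s \<in> L') \<and> (\<forall>x\<in>L'. \<forall>t. x t = (\<Sum>s\<in>UNIV. x s * F s t))"
    proof (rule less.hyps)
      show "(\<lambda>_. 0) \<in> L'" using zero by (simp add: L'_def ev_def)
      show "(\<lambda>s. x s - y s) \<in> L'" if "x \<in> L'" "y \<in> L'" for x y
        using that diff by (simp add: L'_def ev_def right_diff_distrib sum_subtractf)
      show "x \<in> L'" if m: "m \<noteq> 0" "(\<lambda>s. m * x s) \<in> L'" for m x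
      proof -
        have "m * ev x = ev (\<lambda>s. m * x s)"
          by (simp add: ev_def sum_distrib_left mult_ac)
        then show ?thesis using m sat[of m x] by (simp add: L'_def)
      qed
    qed
    then obtain F where F: "\<And>s. F s \<in> L'" "\<And>x t. x \<in> L' \<Longrightarrow> x t = (\<Sum>s\<in>UNIV. x s * F s t)"
      by blast
    have FL: "F s \<in> L" for s using F(1) by (simp add: L'_def)
    \<comment> \<open>Let p' be the map onto \<open>L'\<close> given by \<open>F\<close>; then v' =
      v - p'(v). As x - ev(x) v lies in \<open>L'\<close> and is fixed by p', every x in
      \<open>L\<close> equals p'(x) + ev(x) v'. \<open>G\<close> is this map written in
      coordinates.\<close>
    define v' where "v' t = v t - (\<Sum>u\<in>UNIV. v u * F u t)" for t
    have v'L: "v' \<in> L"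
      unfolding v'_def by (intro diff \<open>v \<in> L\<close> sum FL) simp
    define G where "G s t = F s t + \<alpha> s * v' t" for s t
    show ?thesis
    proof (intro exI[of _ G] conjI allI ballI)
      fix s show "G s \<in> L"
        unfolding G_def by (intro add mult FL v'L)
    next
      fix x t assume x: "x \<in> L"
      have "ev (\<lambda>s. x s - k * v s) = ev x - k * ev v" for k
        by (simp add: ev_def right_diff_distrib sum_subtractf sum_distrib_left mult.left_commute)
      moreover have "ev v = 1"
        using \<alpha>v by (simp add: ev_def)
      ultimately have "(\<lambda>s. x s - ev x * v s) \<in> L'"
        using diff[OF x mult[OF \<open>v \<in> L\<close>, of "ev x"]] by (simp add: L'_def)
      from F(2)[OF this, of t] have "x t = ev x * v t + (\<Sum>s\<in>UNIV. (x s - ev x * v s) * F s t)"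
        by simp
      also have "(\<Sum>s\<in>UNIV. (x s - ev x * v s) * F s t) =
          (\<Sum>s\<in>UNIV. x s * F s t) - ev x * (\<Sum>s\<in>UNIV. v s * F s t)"
        by (simp add: left_diff_distrib sum_subtractf sum_distrib_left mult.assoc)
      also have "ev x * v t + ((\<Sum>s\<in>UNIV. x s * F s t) - ev x * (\<Sum>s\<in>UNIV. v s * F s t)) =
          (\<Sum>s\<in>UNIV. x s * F s t) + ev x * v' t"
        by (simp add: v'_def right_diff_distrib)
      also have "\<dots> = (\<Sum>s\<in>UNIV. x s * G s t)"
        by (simp add: G_def ev_def distrib_left sum.distrib sum_distrib_left mult_ac)
      finally show "x t = (\<Sum>s\<in>UNIV. x s * G s t)" .
    qed
  qed
qed

subsection \<open>Endomorphism rings\<close>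

lemma (in comm_group) hom_integer_combination:
  fixes c :: "'s \<Rightarrow> int"
  assumes h: "h \<in> hom G integer_group" and "finite S" "\<And>s. s \<in> S \<Longrightarrow> F s \<in> carrier G"
  shows "h (finprod G (\<lambda>s. F s [^] c s) S) = (\<Sum>s\<in>S. c s * h (F s))"
proof -
  interpret group_hom G integer_group h
    by (intro group_hom.intro is_group group_integer_group group_hom_axioms.intro h)
  show ?thesis
    using assms(2,3)
  proof (induction S rule: finite_induct)
    case (insert s S)
    have "h (F s [^] c s) = c s * h (F s)"
      using hom_int_pow[of "F s" "c s"] insert.prems by simp
    moreover have "finprod G (\<lambda>s. F s [^] c s) (insert s S) = F s [^] c s \<otimes> finprod G (\<lambda>s. F s [^] c s) S"
      using insert by (intro finprod_insert) auto
    moreover have "finprod G (\<lambda>s. F s [^] c s) S \<in> carrier G"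
      using insert by (intro finprod_closed) auto
    ultimately show ?case
      using insert by simp
  qed simp
qed

text \<open>Membership is required only where the coefficient is nonzero, so that a combination
  omitting one operator can be placed in a subgroup not yet known to contain it.\<close>

lemma (in comm_group) integer_combination_in_subgroup:
  fixes c :: "'s \<Rightarrow> int"
  assumes H: "subgroup H G" and "finite S" "\<And>s. s \<in> S \<Longrightarrow> F s \<in> carrier G"
    "\<And>s. s \<in> S \<Longrightarrow> c s \<noteq> 0 \<Longrightarrow> F s \<in> H"
  shows "finprod G (\<lambda>s. F s [^] c s) S \<in> H"
  using assms(2-4)
proof (induction S rule: finite_induct)
  case empty
  then show ?case using subgroup.one_closed[OF H] by simp
next
  case (insert s S)
  have "F s [^] c s \<in> H"
  proof (cases "c s = 0")
    case True
    then show ?thesis using subgroup.one_closed[OF H] by simp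
  next
    case False
    then show ?thesis using subgroup_int_pow_closed[OF H] insert.prems by simp
  qed
  moreover have "finprod G (\<lambda>s. F s [^] c s) (insert s S) = F s [^] c s \<otimes> finprod G (\<lambda>s. F s [^] c s) S"
    using insert by (intro finprod_insert) auto
  ultimately show ?case
    using insert subgroup.m_closed[OF H] by simp
qed

lemma End_ring_simps [simp]:
  "carrier (End_ring G) = hom G G \<inter> extensional (carrier G)"
  "x \<in> carrier G \<Longrightarrow> (s \<otimes>\<^bsub>End_ring G\<^esub> t) x = t (s x)"
  "x \<in> carrier G \<Longrightarrow> (s \<oplus>\<^bsub>End_ring G\<^esub> t) x = s x \<otimes>\<^bsub>G\<^esub> t x"
  "x \<in> carrier G \<Longrightarrow> \<one>\<^bsub>End_ring G\<^esub> x = x"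
  "x \<in> carrier G \<Longrightarrow> \<zero>\<^bsub>End_ring G\<^esub> x = \<one>\<^bsub>G\<^esub>"
  by (simp_all add: End_ring_def)

lemma End_ring_extensional:
  "s \<otimes>\<^bsub>End_ring G\<^esub> t \<in> extensional (carrier G)" "s \<oplus>\<^bsub>End_ring G\<^esub> t \<in> extensional (carrier G)"
  "\<one>\<^bsub>End_ring G\<^esub> \<in> extensional (carrier G)" "\<zero>\<^bsub>End_ring G\<^esub> \<in> extensional (carrier G)"
  by (simp_all add: End_ring_def)

lemma ring_End_ring:
  fixes G (structure)
  assumes "comm_group G" shows "ring (End_ring G)"
proof -
  interpret comm_group G by fact
  let ?R = "End_ring G"
  have closed: "t x \<in> carrier G" if "t \<in> carrier ?R" "x \<in> carrier G" for t x
    using that by (auto simp: hom_def)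
  have mult: "t (x \<otimes> y) = t x \<otimes> t y" if "t \<in> carrier ?R" "x \<in> carrier G" "y \<in> carrier G" for t x y
    using that by (auto simp: hom_def)
  have I: "t \<in> carrier ?R" if "t \<in> extensional (carrier G)" "\<And>x. x \<in> carrier G \<Longrightarrow> t x \<in> carrier G"
    "\<And>x y. x \<in> carrier G \<Longrightarrow> y \<in> carrier G \<Longrightarrow> t (x \<otimes> y) = t x \<otimes> t y" for t
    using that by (auto simp: hom_def)
  have eqI: "s = t" if "s \<in> extensional (carrier G)" "t \<in> extensional (carrier G)" "\<And>x. x \<in> carrier G \<Longrightarrow> s x = t x" for s t
    using that by (metis extensionalityI)
  have ext: "t \<in> extensional (carrier G)" if "t \<in> carrier ?R" for t
    using that by simp
  have add: "s \<oplus>\<^bsub>?R\<^esub> t \<in> carrier ?R" if "s \<in> carrier ?R" "t \<in> carrier ?R" for s t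
  proof (rule I)
    fix x y assume "x \<in> carrier G" "y \<in> carrier G"
    then show "(s \<oplus>\<^bsub>?R\<^esub> t) (x \<otimes> y) = (s \<oplus>\<^bsub>?R\<^esub> t) x \<otimes> (s \<oplus>\<^bsub>?R\<^esub> t) y"
      using closed[OF that(1)] closed[OF that(2)] by (simp add: mult[OF that(1)] mult[OF that(2)] m_ac)
  qed (use that closed in \<open>auto simp: End_ring_extensional\<close>)
  have mul: "s \<otimes>\<^bsub>?R\<^esub> t \<in> carrier ?R" if "s \<in> carrier ?R" "t \<in> carrier ?R" for s t
    by (rule I) (use closed[OF that(1)] closed[OF that(2)] in
        \<open>simp_all add: End_ring_extensional mult[OF that(1)] mult[OF that(2)]\<close>)
  have one: "\<one>\<^bsub>?R\<^esub> \<in> carrier ?R" and zero: "\<zero>\<^bsub>?R\<^esub> \<in> carrier ?R"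
    by (rule I; simp add: End_ring_extensional)+
  show ?thesis
  proof (rule ringI)
    show "abelian_group ?R"
    proof (rule abelian_groupI)
      show "\<exists>y\<in>carrier ?R. y \<oplus>\<^bsub>?R\<^esub> x = \<zero>\<^bsub>?R\<^esub>" if x: "x \<in> carrier ?R" for x
      proof
        let ?y = "\<lambda>f\<in>carrier G. inv (x f)"
        show "?y \<in> carrier ?R"
          by (rule I) (use closed[OF x] mult[OF x] in \<open>simp_all add: inv_mult\<close>)
        show "?y \<oplus>\<^bsub>?R\<^esub> x = \<zero>\<^bsub>?R\<^esub>"
          by (rule eqI) (use closed[OF x] in \<open>simp_all add: End_ring_extensional\<close>)
      qed
    qed (use add zero in \<open>auto intro!: eqI simp: End_ring_extensional closed m_ac simp del: End_ring_simps(1) dest: ext\<close>)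
    show "monoid ?R"
      by (rule monoidI) (use mul one in \<open>auto intro!: eqI simp: End_ring_extensional closed simp del: End_ring_simps(1) dest: ext\<close>)
  qed (auto intro!: eqI simp: End_ring_extensional closed mult simp del: End_ring_simps(1) dest: ext)
qed

subsection \<open>The Hecke algebra of level three\<close>

lemma H0_simps [simp]:
  "f \<otimes>\<^bsub>H0 n\<^esub> g = (\<lambda>e. f e + g e)" "\<one>\<^bsub>H0 n\<^esub> = (\<lambda>e. 0)"
  by (simp_all add: H0_def)

lemma hecke_op_linear:
  "hecke_op n m (\<lambda>e. a * f e + b * g e) = (\<lambda>e. a * hecke_op n m f e + b * hecke_op n m g e)"
  by (rule ext) (simp add: hecke_op_eq sum.distrib sum_distrib_left)

locale level_three =
  fixes n :: "'k::finite_field poly"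
  assumes monic: "lead_coeff n = 1" and degree_n: "degree n = 3"
begin

abbreviation "H \<equiv> carrier (H0 n)"
abbreviation "R \<equiv> End_ring (H0 n)"
abbreviation "e1 \<equiv> upper_edge 2 (fls_X :: 'k fls)"

lemma bounded: "f \<in> H \<Longrightarrow> bounded_cochain n f"
  using H0_iff[OF monic] by blast

lemma H0_linear:
  assumes "f \<in> H" "g \<in> H" shows "(\<lambda>e. a * f e + b * g e) \<in> H"
proof -
  interpret f: bounded_cochain n f by (rule bounded[OF assms(1)])
  interpret g: bounded_cochain n g by (rule bounded[OF assms(2)])
  have "harmonic_cochain (\<lambda>e. a * f e + b * g e)"
    using f.harmonic g.harmonic unfolding harmonic_cochain_def
    by (simp add: sum.distrib sum_distrib_left[symmetric])
  moreover have "slash (\<lambda>e. a * f e + b * g e) \<gamma> = (\<lambda>e. a * f e + b * g e)" if "\<gamma> \<in> Gamma0 n" for \<gamma>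
    using f.invariant[OF that] g.invariant[OF that] by (simp add: slash_def fun_eq_iff)
  moreover have "finite (range (\<lambda>e. a * f e + b * g e))"
    by (rule finite_subset[of _ "(\<lambda>(x, y). a * x + b * y) ` (range f \<times> range g)"])
      (use f.finite_values g.finite_values in auto)
  ultimately have "bounded_cochain n (\<lambda>e. a * f e + b * g e)"
    using monic by unfold_locales auto
  then show ?thesis using H0_iff[OF monic] by blast
qed

lemma H0_zero: "(\<lambda>e. 0) \<in> H"
proof -
  have "harmonic_cochain (\<lambda>e :: ('k fls^2^2) set. 0 :: int)"
    by (simp add: harmonic_cochain_def)
  moreover have "slash (\<lambda>e :: ('k fls^2^2) set. 0 :: int) \<gamma> = (\<lambda>e. 0)" for \<gamma>
    by (simp add: slash_def)
  ultimately have "bounded_cochain n (\<lambda>e. 0)"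
    using monic by unfold_locales auto
  then show ?thesis using H0_iff[OF monic] by blast
qed

lemma comm_group_H0: "comm_group (H0 n)"
proof (rule comm_groupI)
  show "\<exists>g\<in>H. g \<otimes>\<^bsub>H0 n\<^esub> f = \<one>\<^bsub>H0 n\<^esub>" if "f \<in> H" for f
    using H0_linear[OF that that, of "- 1" 0] by (intro bexI[of _ "\<lambda>e. - f e"]) auto
  show "f \<otimes>\<^bsub>H0 n\<^esub> g \<in> H" if "f \<in> H" "g \<in> H" for f g
    using H0_linear[OF that, of 1 1] by simp
qed (use H0_zero in \<open>auto simp: algebra_simps\<close>)

sublocale H0: comm_group "H0 n" by (rule comm_group_H0)

sublocale End: ring R by (rule ring_End_ring[OF comm_group_H0])

text \<open>The divisibility theorem with \<open>m = 0\<close>, applied to the difference.\<close>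

lemma coord_inj:
  assumes "f \<in> H" "g \<in> H" "\<And>s. coord f s = coord g s" shows "f = g"
proof -
  interpret bounded_cochain n "\<lambda>e. 1 * f e + (- 1) * g e"
    by (rule bounded[OF H0_linear[OF assms(1,2)]])
  have "0 dvd 1 * f e + (- 1) * g e" for e
    by (rule coord_dvd[OF degree_n]) (use assms(3) in \<open>simp add: coord_def\<close>)
  then show ?thesis by (simp add: fun_eq_iff)
qed

text \<open>If \<open>m\<close> divides the coordinates of \<open>f\<close>, it divides all values,
  and f/m is again a cochain of the same kind; hence the coordinate vectors form a saturated
  lattice. The \<open>F s\<close> are the images of the unit vectors under a projection onto it.
  They replace a basis, so no rank has to be known.\<close>

lemma frame:
  obtains F where "\<And>s. F s \<in> H" "\<And>f. f \<in> H \<Longrightarrow> f = (\<lambda>e. \<Sum>s\<in>UNIV. coord f s * F s e)"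
proof -
  define L where "L = coord ` H"
  have "\<exists>G. (\<forall>s. G s \<in> L) \<and> (\<forall>x\<in>L. \<forall>t. x t = (\<Sum>s\<in>UNIV. x s * G s t))"
  proof (rule saturated_frame)
    show "(\<lambda>_. 0) \<in> L"
      unfolding L_def by (rule image_eqI[OF _ H0_zero]) (simp add: coord_def fun_eq_iff)
    show "(\<lambda>s. x s - y s) \<in> L" if xy: "x \<in> L" "y \<in> L" for x y
    proof -
      obtain f g where "f \<in> H" "g \<in> H" "x = coord f" "y = coord g"
        using xy by (auto simp: L_def)
      then show ?thesis
        unfolding L_def using H0_linear[of f g 1 "- 1"]
        by (intro image_eqI[of _ _ "\<lambda>e. 1 * f e + (- 1) * g e"]) (auto simp: coord_def fun_eq_iff)
    qed
    show "x \<in> L" if m: "m \<noteq> 0" "(\<lambda>s. m * x s) \<in> L" for m x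
    proof -
      obtain f where f: "f \<in> H" "\<And>s. coord f s = m * x s"
        using m(2) unfolding L_def by (metis (no_types, lifting) imageE)
      interpret bounded_cochain n f by (rule bounded[OF f(1)])
      have "m dvd f e" for e
        by (rule coord_dvd[OF degree_n]) (simp add: f(2))
      then have "\<forall>e. \<exists>y. f e = m * y" by (auto elim: dvdE)
      then obtain g where g: "\<And>e. f e = m * g e" by metis
      have "harmonic_cochain g"
        unfolding harmonic_cochain_def
      proof (intro conjI allI ballI impI)
        show "g e = 0" if "e \<notin> tree_edges" for e
          using harmonic that m(1) by (simp add: harmonic_cochain_def g)
        show "g (edge_rev e) = - g e" if "e \<in> tree_edges" for e
        proof -
          have "m * g (edge_rev e) = m * - g e"
            using harmonic that by (simp add: harmonic_cochain_def g)
          then show ?thesis using m(1) by (metis mult_left_cancel)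
        qed
        show "(\<Sum>e | e \<in> tree_edges \<and> edge_terminus e = v. g e) = 0" if "v \<in> tree_vertices" for v
          using harmonic that m(1) by (simp add: harmonic_cochain_def g sum_distrib_left[symmetric])
      qed
      moreover have "slash g \<gamma> = g" if "\<gamma> \<in> Gamma0 n" for \<gamma>
        using invariant[OF that] m(1) by (simp add: slash_def fun_eq_iff g)
      moreover have "finite (range g)"
      proof (rule finite_imageD)
        have "(\<lambda>y. m * y) ` range g = range f"
          by (simp add: image_image g)
        then show "finite ((\<lambda>y. m * y) ` range g)"
          using finite_values by simp
      qed (use m(1) in \<open>simp add: inj_on_def\<close>)
      ultimately have "bounded_cochain n g"
        using monic by unfold_locales auto
      then have "g \<in> H" using H0_iff[OF monic] by blast
      moreover have "coord g = x"
        using f(2) m(1) by (auto simp: coord_def g fun_eq_iff)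
      ultimately show ?thesis unfolding L_def by blast
    qed
  qed
  then obtain G where G: "\<And>s. G s \<in> L" "\<And>x t. x \<in> L \<Longrightarrow> x t = (\<Sum>s\<in>UNIV. x s * G s t)"
    by blast
  have "\<forall>s. \<exists>f\<in>H. coord f = G s"
    using G(1) unfolding L_def by (metis imageE)
  then obtain F where F: "\<And>s. F s \<in> H" "\<And>s. coord (F s) = G s" by metis
  have sum_in: "(\<lambda>e. \<Sum>s\<in>S. c s * F s e) \<in> H" if "finite S" for c S
    using that
  proof (induction S rule: finite_induct)
    case (insert s S)
    from H0_linear[OF F(1) insert.IH, of "c s" s 1] insert.hyps show ?case by simp
  qed (use H0_zero in simp)
  have "f = (\<lambda>e. \<Sum>s\<in>UNIV. coord f s * F s e)" if f: "f \<in> H" for f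
  proof (rule coord_inj[OF f sum_in])
    fix t
    have "coord f t = (\<Sum>s\<in>UNIV. coord f s * G s t)"
      using G(2)[of "coord f" t] f by (simp add: L_def)
    then show "coord f t = coord (\<lambda>e. \<Sum>s\<in>UNIV. coord f s * F s e) t"
      unfolding F(2)[symmetric] by (simp add: coord_def)
  qed simp
  with F(1) that show ?thesis by blast
qed

lemma hecke_T_in:
  assumes m: "lead_coeff m = 1" shows "hecke_T n m \<in> carrier R"
proof -
  have add: "hecke_T n m (f \<otimes>\<^bsub>H0 n\<^esub> g) = hecke_T n m f \<otimes>\<^bsub>H0 n\<^esub> hecke_T n m g" if "f \<in> H" "g \<in> H" for f g
  proof -
    have "hecke_T n m (f \<otimes>\<^bsub>H0 n\<^esub> g) = hecke_op n m (\<lambda>e. f e + g e)"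
      using H0.m_closed[OF that] by (simp add: hecke_T_def)
    also have "\<dots> = hecke_T n m f \<otimes>\<^bsub>H0 n\<^esub> hecke_T n m g"
      using hecke_op_linear[of n m 1 f 1 g] that by (simp add: hecke_T_def)
    finally show ?thesis .
  qed
  have closed: "hecke_T n m f \<in> H" if "f \<in> H" for f
    using hecke_op_H0[OF monic m that] that by (simp add: hecke_T_def)
  have "hecke_T n m \<in> hom (H0 n) (H0 n)"
    by (rule homI) (fact closed, fact add)
  then show ?thesis
    by (simp add: hecke_T_def)
qed

lemma hecke_T_apply: "f \<in> H \<Longrightarrow> hecke_T n m f = hecke_op n m f"
  by (simp add: hecke_T_def)

lemma generators_in: "{hecke_T n m | m. lead_coeff m = 1} \<subseteq> carrier R"
  using hecke_T_in by blast

section \<open>The Hecke algebra as the span of operators of degree one\<close>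

lemma hecke_carrier:
  "carrier (hecke_algebra n) = generate_ring R {hecke_T n m | m. lead_coeff m = 1}"
  by (simp add: hecke_algebra_def)

lemma hecke_subring: "subring (carrier (hecke_algebra n)) R"
  unfolding hecke_carrier by (rule End.generate_ring_is_subring[OF generators_in])

lemma hecke_in_R: "t \<in> carrier (hecke_algebra n) \<Longrightarrow> t \<in> carrier R"
  unfolding hecke_carrier using End.generate_ring_in_carrier[OF generators_in] by blast

lemma R_closed: "t \<in> carrier R \<Longrightarrow> f \<in> H \<Longrightarrow> t f \<in> H"
  using hom_in_carrier[of t "H0 n" "H0 n"] by simp

lemma R_add: "t \<in> carrier R \<Longrightarrow> f \<in> H \<Longrightarrow> g \<in> H \<Longrightarrow> t (\<lambda>e. f e + g e) = (\<lambda>e. t f e + t g e)"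
  using hom_mult[of t "H0 n" "H0 n" f g] by simp

lemma R_ext:
  assumes "s \<in> carrier R" "t \<in> carrier R" "\<And>f. f \<in> H \<Longrightarrow> s f = t f" shows "s = t"
  by (rule extensionalityI[of s H t]) (use assms in simp_all)

lemma a_inv_apply:
  assumes t: "t \<in> carrier R" and f: "f \<in> H"
  shows "(\<ominus>\<^bsub>R\<^esub> t) f = (\<lambda>e. - t f e)"
proof -
  have "(t \<oplus>\<^bsub>R\<^esub> \<ominus>\<^bsub>R\<^esub> t) f = \<zero>\<^bsub>R\<^esub> f"
    by (simp only: End.r_neg[OF t])
  then have "(\<lambda>e. t f e + (\<ominus>\<^bsub>R\<^esub> t) f e) = (\<lambda>e. 0)"
    using f by simp
  then show ?thesis
    by (simp add: fun_eq_iff eq_neg_iff_add_eq_0 add.commute)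
qed

text \<open>Commuting with a fixed \<open>T_P\<close> is inherited by sums, negatives and products,
  so \<open>hecke_op_commute_lin\<close> on the generators is enough.\<close>

lemma hecke_commute:
  assumes "t \<in> carrier (hecke_algebra n)" "f \<in> H"
  shows "t (hecke_op n (lin s) f) = hecke_op n (lin s) (t f)"
  using assms unfolding hecke_carrier
proof (induction arbitrary: f rule: generate_ring.induct)
  case one
  then show ?case using hecke_op_H0[OF monic lead_coeff_lin] by simp
next
  case (incl h)
  then obtain m where m: "h = hecke_T n m" "lead_coeff m = 1" by blast
  interpret bounded_cochain n f by (rule bounded) fact
  show ?case
    using incl.prems hecke_op_H0[OF monic lead_coeff_lin]
    by (simp add: m hecke_T_apply hecke_op_commute_lin[OF invariant])
next
  case (a_inv h)
  then have h: "h \<in> carrier R" using hecke_in_R hecke_carrier by blast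
  have "h f \<in> H" using R_closed[OF h] a_inv.prems .
  show ?case
    using a_inv hecke_op_H0[OF monic lead_coeff_lin] hecke_op_linear[of n "lin s" "- 1" "h f" 0 "h f"]
    by (simp add: a_inv_apply[OF h])
next
  case (eng_add h1 h2)
  then show ?case
    using hecke_op_H0[OF monic lead_coeff_lin] hecke_op_linear[of n "lin s" 1 "h1 f" 1 "h2 f"] by simp
next
  case (eng_mult h1 h2)
  then have h: "h1 \<in> carrier R" using hecke_in_R hecke_carrier by blast
  show ?case
    using eng_mult R_closed[OF h] hecke_op_H0[OF monic lead_coeff_lin] by simp
qed

text \<open>Minus the coordinate of \<open>t f\<close> at \<open>s\<close> is the value of
  \<open>T_P (t f)\<close> at \<open>e1\<close>, and commutation makes it the value of
  \<open>t\<close> applied to \<open>T_P f\<close>. So the values at \<open>e1\<close> alone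
  determine \<open>t\<close>.\<close>

lemma hecke_eqI:
  assumes t: "t \<in> carrier (hecke_algebra n)" "t' \<in> carrier (hecke_algebra n)"
    and eq: "\<And>f. f \<in> H \<Longrightarrow> t f e1 = t' f e1"
  shows "t = t'"
proof (rule R_ext)
  show R: "t \<in> carrier R" "t' \<in> carrier R" using t hecke_in_R by auto
  fix f assume f: "f \<in> H"
  have "coord (t f) s = - t (hecke_op n (lin s) f) e1" if t: "t \<in> carrier (hecke_algebra n)" for t s
  proof -
    interpret bounded_cochain n "t f" by (rule bounded[OF R_closed[OF hecke_in_R[OF t] f]])
    show ?thesis
      using hecke_lin_upper_edge[OF degree_n, of s] by (simp add: hecke_commute[OF t f])
  qed
  then show "t f = t' f"
    using t f eq hecke_op_H0[OF monic lead_coeff_lin f] R_closed R by (intro coord_inj) auto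
qed

lemma hecke_lin_e1: "f \<in> H \<Longrightarrow> hecke_op n (lin s) f e1 = - coord f s"
  using bounded_cochain.hecke_lin_upper_edge[OF bounded degree_n] by blast

lemma value_e1: "f \<in> H \<Longrightarrow> f e1 = (\<Sum>s\<in>UNIV. coord f s)"
  using bounded_cochain.upper_edge_2_1[OF bounded] by blast

lemma abelian_subring_group:
  assumes "subring S R" shows "comm_group (add_monoid (R\<lparr>carrier := S\<rparr>))"
proof -
  have "S \<subseteq> carrier R"
    using subringE(1)[OF assms] .
  then have "ring (R\<lparr>carrier := S\<rparr>)"
    using End.subring_iff assms by blast
  then show ?thesis
    using abelian_group.a_comm_group ring.is_abelian_group by blast
qed

definition lin_comb :: "('k \<Rightarrow> int) \<Rightarrow> ('k, int) cochain \<Rightarrow> ('k, int) cochain" where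
  "lin_comb c = (\<lambda>f\<in>H. \<lambda>e. \<Sum>s\<in>UNIV. c s * hecke_op n (lin s) f e)"

text \<open>The subring is a parameter because both extremes occur: the full endomorphism ring for
  membership in arbitrary subgroups, and the Hecke algebra for homomorphisms defined only
  there.\<close>

lemma lin_comb_eq:
  assumes S: "subring S R" and T: "\<And>s. hecke_T n (lin s) \<in> S"
  shows "lin_comb c = finprod (add_monoid (R\<lparr>carrier := S\<rparr>))
    (\<lambda>s. hecke_T n (lin s) [^]\<^bsub>add_monoid (R\<lparr>carrier := S\<rparr>)\<^esub> c s) UNIV"
proof -
  let ?A = "add_monoid (R\<lparr>carrier := S\<rparr>)"
  interpret A: comm_group ?A by (rule abelian_subring_group[OF S])
  let ?p = "finprod ?A (\<lambda>s. hecke_T n (lin s) [^]\<^bsub>?A\<^esub> c s) UNIV"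
  have "?p \<in> carrier ?A"
    by (intro A.finprod_closed Pi_I A.int_pow_closed) (simp add: T)
  then have p: "?p \<in> carrier R"
    using subringE(1)[OF S] by auto
  have "?p f = lin_comb c f" if f: "f \<in> H" for f
  proof
    fix e
    have "(\<lambda>t. t f e) \<in> hom ?A integer_group"
      using f by (auto simp: hom_def)
    from A.hom_integer_combination[OF this, of UNIV "\<lambda>s. hecke_T n (lin s)" c]
    show "?p f e = lin_comb c f e"
      using T f by (simp add: lin_comb_def hecke_T_apply)
  qed
  moreover have "?p \<in> extensional H" using p by simp
  moreover have "lin_comb c \<in> extensional H" by (simp add: lin_comb_def)
  ultimately show ?thesis
    by (intro extensionalityI[of "lin_comb c" H]) simp_all
qed

lemma subring_R: "subring (carrier R) R"
  by (simp add: End.carrier_is_subring del: End_ring_simps)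

lemma lin_comb_in_subgroup:
  assumes "subgroup K (add_monoid R)" "\<And>s. c s \<noteq> 0 \<Longrightarrow> hecke_T n (lin s) \<in> K"
  shows "lin_comb c \<in> K"
proof -
  have "lin_comb c = finprod (add_monoid R) (\<lambda>s. hecke_T n (lin s) [^]\<^bsub>add_monoid R\<^esub> c s) UNIV"
    using lin_comb_eq[OF subring_R hecke_T_in[OF lead_coeff_lin], of c] by simp
  also have "\<dots> \<in> K"
    using assms hecke_T_in[OF lead_coeff_lin]
    by (intro comm_group.integer_combination_in_subgroup[OF End.a_comm_group])
      (auto simp del: End_ring_simps)
  finally show ?thesis .
qed

lemma lin_T_in_hecke: "hecke_T n (lin s) \<in> carrier (hecke_algebra n)"
  unfolding hecke_carrier by (rule generate_ring.incl) (use lead_coeff_lin in blast)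

lemma lin_comb_in_hecke: "lin_comb c \<in> carrier (hecke_algebra n)"
  by (rule lin_comb_in_subgroup[OF subring.axioms(1)[OF hecke_subring] lin_T_in_hecke])

lemma lin_comb_e1: "f \<in> H \<Longrightarrow> lin_comb c f e1 = - (\<Sum>s\<in>UNIV. c s * coord f s)"
  by (simp add: lin_comb_def hecke_lin_e1 sum_negf)

lemma hom_H0_combination:
  assumes h: "h \<in> hom (H0 n) integer_group" and F: "\<And>s. F s \<in> H"
  shows "h (\<lambda>e. \<Sum>s\<in>UNIV. c s * F s e) = (\<Sum>s\<in>(UNIV :: 'k set). c s * h (F s))"
    and "(\<lambda>e. \<Sum>s\<in>(UNIV :: 'k set). c s * F s e) \<in> H"
proof -
  let ?p = "finprod (H0 n) (\<lambda>s. F s [^]\<^bsub>H0 n\<^esub> c s) (UNIV :: 'k set)"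
  have "?p e = (\<Sum>s\<in>UNIV. c s * F s e)" for e
    by (rule H0.hom_integer_combination[where h = "\<lambda>f. f e"]) (use F in \<open>auto simp: hom_def\<close>)
  then have eq: "(\<lambda>e. \<Sum>s\<in>UNIV. c s * F s e) = ?p"
    by (simp add: fun_eq_iff)
  show "(\<lambda>e. \<Sum>s\<in>(UNIV :: 'k set). c s * F s e) \<in> H"
    unfolding eq using F by (intro H0.finprod_closed) auto
  show "h (\<lambda>e. \<Sum>s\<in>UNIV. c s * F s e) = (\<Sum>s\<in>(UNIV :: 'k set). c s * h (F s))"
    unfolding eq using F by (intro H0.hom_integer_combination[OF h]) auto
qed

lemma hecke_hom:
  assumes "t \<in> carrier R" shows "(\<lambda>f. - t f e) \<in> hom (H0 n) integer_group"
  by (rule homI) (simp_all add: R_add[OF assms])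

text \<open>Expanding \<open>f\<close> along the frame shows that both operators give the same value
  at \<open>e1\<close>. The coefficients are the pairings of \<open>t\<close> with the frame
  vectors.\<close>

lemma hecke_eq_lin_comb:
  assumes t: "t \<in> carrier (hecke_algebra n)"
    and F: "\<And>s. F s \<in> H" "\<And>f. f \<in> H \<Longrightarrow> f = (\<lambda>e. \<Sum>s\<in>UNIV. coord f s * F s e)"
  shows "t = lin_comb (\<lambda>s. - t (F s) e1)"
proof (rule hecke_eqI[OF t lin_comb_in_hecke])
  fix f assume f: "f \<in> H"
  have "- t f e1 = - t (\<lambda>e. \<Sum>s\<in>UNIV. coord f s * F s e) e1"
    using F(2)[OF f] by simp
  also have "\<dots> = (\<Sum>s\<in>UNIV. coord f s * - t (F s) e1)"
    by (rule hom_H0_combination(1)[OF hecke_hom[OF hecke_in_R[OF t]] F(1)])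
  finally show "t f e1 = lin_comb (\<lambda>s. - t (F s) e1) f e1"
    by (simp add: lin_comb_e1[OF f] mult.commute)
qed

lemma hecke_in_subgroup:
  assumes t: "t \<in> carrier (hecke_algebra n)"
    and K: "subgroup K (add_monoid R)" "\<And>s. hecke_T n (lin s) \<in> K"
  shows "t \<in> K"
proof -
  obtain F where F: "\<And>s. F s \<in> H" "\<And>f. f \<in> H \<Longrightarrow> f = (\<lambda>e. \<Sum>s\<in>UNIV. coord f s * F s e)"
    using frame by blast
  show ?thesis
    by (subst hecke_eq_lin_comb[OF t F]) (auto intro: lin_comb_in_subgroup K)
qed

end

section \<open>Operators of degree one in the algebra prime to the level\<close>

lemma lin_inject [simp]: "lin r = lin s \<longleftrightarrow> r = s"
  by (simp add: lin_def)

lemma monic_linear_eq_lin: "lead_coeff p = 1 \<Longrightarrow> degree p = 1 \<Longrightarrow> \<exists>s. p = lin s" for p :: "'k::field poly"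
proof -
  assume "lead_coeff p = 1" "degree p = 1"
  then obtain c where "p = [:c, 1:]" using degree_1_monic by blast
  then have "p = lin (- c)" by (simp add: lin_def)
  then show ?thesis ..
qed

lemma prime_elem_lin: "prime_elem (lin s)" for s :: "'k::field"
  by (rule prime_elemI) (simp_all add: lin_not_unit linear_dvd_iff)

lemma linear_prime_hecke_operators:
  "{hecke_T n P | P. lead_coeff P = 1 \<and> prime_elem P \<and> degree P = 1} = range (\<lambda>s. hecke_T n (lin s))"
proof (intro equalityI subsetI)
  fix t assume "t \<in> {hecke_T n P | P. lead_coeff P = 1 \<and> prime_elem P \<and> degree P = 1}"
  then obtain P where P: "t = hecke_T n P" "lead_coeff P = 1" "degree P = 1" by auto
  obtain s where "P = lin s" using monic_linear_eq_lin[OF P(2,3)] by auto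
  then show "t \<in> range (\<lambda>s. hecke_T n (lin s))" using P(1) by simp
next
  fix t assume "t \<in> range (\<lambda>s. hecke_T n (lin s))"
  then obtain s where s: "t = hecke_T n (lin s)" by auto
  show "t \<in> {hecke_T n P | P. lead_coeff P = 1 \<and> prime_elem P \<and> degree P = 1}"
    by (intro CollectI exI[of _ "lin s"] conjI s lead_coeff_lin prime_elem_lin degree_lin)
qed

context level_three
begin

lemma hecke0_carrier:
  "carrier (hecke_algebra0 n) = generate_ring R {hecke_T n m | m. lead_coeff m = 1 \<and> coprime m n}"
  by (simp add: hecke_algebra0_def)

lemma hecke0_subring: "subring (carrier (hecke_algebra0 n)) R"
  unfolding hecke0_carrier by (rule End.generate_ring_is_subring) (use generators_in in blast)

lemma hecke0_subset: "carrier (hecke_algebra0 n) \<subseteq> carrier (hecke_algebra n)"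
  unfolding hecke0_carrier
proof (rule End.generate_ring_min_subring1[OF _ hecke_subring])
  show "{hecke_T n m | m. lead_coeff m = 1 \<and> coprime m n} \<subseteq> carrier R"
    using generators_in by auto
  show "{hecke_T n m | m. lead_coeff m = 1 \<and> coprime m n} \<subseteq> carrier (hecke_algebra n)"
    unfolding hecke_carrier by (auto intro: generate_ring.incl)
qed

lemma one_in_hecke: "\<one>\<^bsub>R\<^esub> \<in> carrier (hecke_algebra n)" "\<zero>\<^bsub>R\<^esub> \<in> carrier (hecke_algebra n)"
  by (rule subringE(3)[OF hecke_subring], rule subringE(2)[OF hecke_subring])

text \<open>At a multiple root the coordinate vanishes on every cochain, and this coordinate is all
  that the operator contributes at \<open>e1\<close>.\<close>

lemma lin_T_double_root:
  assumes "n = lin r * h" "poly h r = 0"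
  shows "hecke_T n (lin r) = \<zero>\<^bsub>R\<^esub>"
proof (rule hecke_eqI[OF lin_T_in_hecke one_in_hecke(2)])
  fix f assume f: "f \<in> H"
  interpret bounded_cochain n f by (rule bounded[OF f])
  have "coord f r = 0"
    by (rule coord_double_root[OF degree_n assms])
  then show "hecke_T n (lin r) f e1 = \<zero>\<^bsub>R\<^esub> f e1"
    using f by (simp add: hecke_T_apply hecke_lin_e1)
qed

text \<open>The identity is minus the sum of all \<open>T\<^sub>P\<close> with \<open>P\<close> of degree one, so a single
  missing \<open>T\<^sub>P\<close> can be recovered from the others.\<close>

lemma lin_T_from_others:
  fixes r :: 'k
  defines "c \<equiv> (\<lambda>s. if s = r then 0 else 1)"
  shows "hecke_T n (lin r) = \<ominus>\<^bsub>R\<^esub> (\<one>\<^bsub>R\<^esub> \<oplus>\<^bsub>R\<^esub> lin_comb c)"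
proof (rule hecke_eqI[OF lin_T_in_hecke])
  have in_hecke: "\<one>\<^bsub>R\<^esub> \<oplus>\<^bsub>R\<^esub> lin_comb c \<in> carrier (hecke_algebra n)"
    by (rule subringE(7)[OF hecke_subring one_in_hecke(1) lin_comb_in_hecke])
  then show "\<ominus>\<^bsub>R\<^esub> (\<one>\<^bsub>R\<^esub> \<oplus>\<^bsub>R\<^esub> lin_comb c) \<in> carrier (hecke_algebra n)"
    by (rule subringE(5)[OF hecke_subring])
  fix f assume f: "f \<in> H"
  have "(\<Sum>s\<in>UNIV. c s * coord f s) = (\<Sum>s\<in>UNIV. coord f s - (if s = r then coord f s else 0))"
    by (intro sum.cong) (auto simp: c_def)
  also have "\<dots> = (\<Sum>s\<in>UNIV. coord f s) - coord f r"
    by (simp add: sum_subtractf)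
  finally show "hecke_T n (lin r) f e1 = (\<ominus>\<^bsub>R\<^esub> (\<one>\<^bsub>R\<^esub> \<oplus>\<^bsub>R\<^esub> lin_comb c)) f e1"
    using f by (simp add: a_inv_apply[OF hecke_in_R[OF in_hecke]] hecke_T_apply hecke_lin_e1 lin_comb_e1 value_e1)
qed

text \<open>Two simple roots leave a linear cofactor in degree three, and simplicity keeps its root
  away from both. This is exactly the shape of level excluded in (i).\<close>

lemma simple_roots_distinct:
  assumes r: "n = lin r * h" "poly h r \<noteq> 0" and r': "n = lin r' * h'" "poly h' r' \<noteq> 0" and "r \<noteq> r'"
  obtains r'' where "n = lin r * lin r' * lin r''" "distinct [r, r', r'']"
proof -
  have "poly n r' = 0" by (simp add: r'(1))
  then have "poly h r' = 0" using \<open>r \<noteq> r'\<close> by (simp add: r(1))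
  then obtain g where g: "h = lin r' * g"
    unfolding linear_dvd_iff[symmetric] ..
  have n: "n = lin r * lin r' * g" by (simp add: r(1) g mult.assoc)
  have "lin r * lin r' dvd n" by (simp add: n)
  then obtain g' where g': "n = lin r * lin r' * g'" "lead_coeff g' = 1" "degree n = degree (lin r * lin r') + degree g'"
    using monic_dvd_factor[OF monic, of "lin r * lin r'"] by (metis lead_coeff_lin lead_coeff_mult mult_1)
  have "g' = g"
    using n g'(1) by simp
  have "degree g = 1"
    using g'(3) degree_n by (simp add: degree_mult_eq \<open>g' = g\<close>)
  then obtain r'' where r'': "g = lin r''"
    using g'(2) monic_linear_eq_lin \<open>g' = g\<close> by blast
  have "lin r' * h' = lin r' * (lin r * lin r'')"
    using r'(1) n by (simp add: r'' mult_ac)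
  then have "h' = lin r * lin r''"
    by simp
  then have "r'' \<noteq> r'" "r'' \<noteq> r"
    using r'(2) r(2) by (auto simp: g r'')
  then show ?thesis
    using that[of r''] n \<open>r \<noteq> r'\<close> by (auto simp: r'')
qed

lemma lin_T_in_hecke0_not_simple:
  assumes "\<And>h. n = lin s * h \<Longrightarrow> poly h s = 0"
  shows "hecke_T n (lin s) \<in> carrier (hecke_algebra0 n)"
proof (cases "poly n s = 0")
  case True
  then obtain h where h: "n = lin s * h"
    unfolding linear_dvd_iff[symmetric] ..
  show ?thesis
    unfolding lin_T_double_root[OF h assms[OF h]] by (rule subringE(2)[OF hecke0_subring])
next
  case False
  then show ?thesis
    unfolding hecke0_carrier
    by (intro generate_ring.incl) (use lead_coeff_lin coprime_linear_iff in blast)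
qed

theorem hecke_algebra_eq_hecke_algebra0:
  assumes "\<nexists>l1 l2 l3. lead_coeff l1 = 1 \<and> lead_coeff l2 = 1 \<and> lead_coeff l3 = 1 \<and>
          degree l1 = 1 \<and> degree l2 = 1 \<and> degree l3 = 1 \<and> distinct [l1, l2, l3] \<and> n = l1 * l2 * l3"
  shows "hecke_algebra n = hecke_algebra0 n"
proof -
  define simple where "simple s \<longleftrightarrow> (\<exists>h. n = lin s * h \<and> poly h s \<noteq> 0)" for s
  have unique: "r = r'" if "simple r" "simple r'" for r r'
  proof (rule ccontr)
    assume "r \<noteq> r'"
    obtain h where h: "n = lin r * h" "poly h r \<noteq> 0"
      using \<open>simple r\<close> unfolding simple_def by blast
    obtain h' where h': "n = lin r' * h'" "poly h' r' \<noteq> 0"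
      using \<open>simple r'\<close> unfolding simple_def by blast
    obtain r'' where "n = lin r * lin r' * lin r''" "distinct [r, r', r'']"
      using simple_roots_distinct[OF h h' \<open>r \<noteq> r'\<close>] .
    then have "lead_coeff (lin r) = 1 \<and> lead_coeff (lin r') = 1 \<and> lead_coeff (lin r'') = 1 \<and>
        degree (lin r) = 1 \<and> degree (lin r') = 1 \<and> degree (lin r'') = 1 \<and>
        distinct [lin r, lin r', lin r''] \<and> n = lin r * lin r' * lin r''"
      by (auto simp: lead_coeff_lin simp del: degree_lin coeff_lin) simp_all
    with assms show False by blast
  qed
  have not_simple: "hecke_T n (lin s) \<in> carrier (hecke_algebra0 n)" if "\<not> simple s" for s
    using that by (intro lin_T_in_hecke0_not_simple) (auto simp: simple_def)
  have "hecke_T n (lin s) \<in> carrier (hecke_algebra0 n)" for s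
  proof (cases "simple s")
    case True
    have "lin_comb (\<lambda>t. if t = s then 0 else 1) \<in> carrier (hecke_algebra0 n)"
      by (rule lin_comb_in_subgroup[OF subring.axioms(1)[OF hecke0_subring]])
        (use not_simple unique True in \<open>auto split: if_splits\<close>)
    then show ?thesis
      unfolding lin_T_from_others[of s]
      by (intro subringE(5)[OF hecke0_subring] subringE(7)[OF hecke0_subring] subringE(3)[OF hecke0_subring])
  qed (rule not_simple)
  then have "carrier (hecke_algebra n) \<subseteq> carrier (hecke_algebra0 n)"
    using hecke_in_subgroup[OF _ subring.axioms(1)[OF hecke0_subring]] by blast
  then have "carrier (hecke_algebra n) = carrier (hecke_algebra0 n)"
    using hecke0_subset by blast
  then show ?thesis
    by (simp add: hecke_algebra_def hecke_algebra0_def)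
qed

theorem generate_lin:
  "generate (add_monoid R) (range (\<lambda>s. hecke_T n (lin s))) = carrier (hecke_algebra n)"
proof
  have "range (\<lambda>s. hecke_T n (lin s)) \<subseteq> carrier (add_monoid R)"
    using hecke_T_in[OF lead_coeff_lin] by auto
  then have K: "subgroup (generate (add_monoid R) (range (\<lambda>s. hecke_T n (lin s)))) (add_monoid R)"
    by (rule group.generate_is_subgroup[OF comm_group.axioms(2)[OF End.a_comm_group]])
  show "carrier (hecke_algebra n) \<subseteq> generate (add_monoid R) (range (\<lambda>s. hecke_T n (lin s)))"
  proof (intro subsetI)
    fix t assume t: "t \<in> carrier (hecke_algebra n)"
    show "t \<in> generate (add_monoid R) (range (\<lambda>s. hecke_T n (lin s)))"
      by (rule hecke_in_subgroup[OF t K]) (rule generate.incl[OF rangeI])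
  qed
  show "generate (add_monoid R) (range (\<lambda>s. hecke_T n (lin s))) \<subseteq> carrier (hecke_algebra n)"
    by (rule group.generate_subgroup_incl[OF comm_group.axioms(2)[OF End.a_comm_group] _ subring.axioms(1)[OF hecke_subring]])
      (use lin_T_in_hecke in blast)
qed

section \<open>Perfectness of the pairing with the first Fourier coefficient\<close>

context
  fixes \<eta>0 :: "'k \<Rightarrow> complex"
  assumes \<eta>: "nontrivial_character \<eta>0"
begin

lemma fourier_e1: "t \<in> carrier R \<Longrightarrow> f \<in> H \<Longrightarrow> fourier_coeff \<eta>0 (t f) 1 = of_int (- t f e1)"
  by (rule bounded_cochain.fourier_coeff_1[OF bounded[OF R_closed] \<eta>])

lemma hecke_pairing_e1: "t \<in> carrier R \<Longrightarrow> f \<in> H \<Longrightarrow> hecke_pairing \<eta>0 t f = - t f e1"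
  unfolding hecke_pairing_def fourier_e1 of_int_eq_iff by simp

lemma pairing_left_iso:
  "(\<lambda>t. \<lambda>f\<in>H. hecke_pairing \<eta>0 t f) \<in> iso (add_monoid (hecke_algebra n)) (dual_group (H0 n))"
proof (rule isoI)
  let ?A = "add_monoid (hecke_algebra n)" and ?B = "\<lambda>t. \<lambda>f\<in>H. hecke_pairing \<eta>0 t f"
  have B: "?B t \<in> carrier (dual_group (H0 n))" if "t \<in> carrier ?A" for t
  proof -
    have t: "t \<in> carrier R" using that hecke_in_R by simp
    have "?B t \<in> hom (H0 n) integer_group"
      using H0.m_closed by (intro homI) (simp_all add: hecke_pairing_e1[OF t] R_add[OF t])
    then show ?thesis by (simp add: dual_group_def)
  qed
  show "?B \<in> hom ?A (dual_group (H0 n))"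
  proof (rule homI)
    fix s t assume st: "s \<in> carrier ?A" "t \<in> carrier ?A"
    then have R: "s \<in> carrier R" "t \<in> carrier R" using hecke_in_R by auto
    have add: "s \<otimes>\<^bsub>?A\<^esub> t = s \<oplus>\<^bsub>R\<^esub> t"
      by (simp add: hecke_algebra_def)
    show "?B (s \<otimes>\<^bsub>?A\<^esub> t) = ?B s \<otimes>\<^bsub>dual_group (H0 n)\<^esub> ?B t"
      unfolding add using hecke_pairing_e1[OF End.a_closed[OF R]] hecke_pairing_e1[OF R(1)] hecke_pairing_e1[OF R(2)]
      by (auto simp: dual_group_def fun_eq_iff restrict_def)
  qed (rule B)
  show "bij_betw ?B (carrier ?A) (carrier (dual_group (H0 n)))"
  proof (rule bij_betw_imageI)
    show "inj_on ?B (carrier ?A)"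
    proof (rule inj_onI)
      fix s t assume st: "s \<in> carrier ?A" "t \<in> carrier ?A" "?B s = ?B t"
      then have R: "s \<in> carrier R" "t \<in> carrier R" using hecke_in_R by auto
      show "s = t"
      proof (rule hecke_eqI)
        fix f assume "f \<in> H"
        then show "s f e1 = t f e1"
          using fun_cong[OF st(3), of f] hecke_pairing_e1[OF R(1)] hecke_pairing_e1[OF R(2)] by simp
      qed (use st in simp_all)
    qed
    show "?B ` carrier ?A = carrier (dual_group (H0 n))"
    proof (intro equalityI subsetI)
      fix \<phi> assume \<phi>: "\<phi> \<in> carrier (dual_group (H0 n))"
      then have h: "\<phi> \<in> hom (H0 n) integer_group" "\<phi> \<in> extensional H"
        by (simp_all add: dual_group_def)
      obtain F where F: "\<And>s. F s \<in> H" "\<And>f. f \<in> H \<Longrightarrow> f = (\<lambda>e. \<Sum>s\<in>UNIV. coord f s * F s e)"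
        using frame by blast
      \<comment> \<open>The frame gives \<phi>(f) as the sum of coord f s times \<phi>(F s), and
        pairing with \<open>T_P\<close> reads off a coordinate; hence these coefficients.\<close>
      let ?t = "lin_comb (\<lambda>s. \<phi> (F s))"
      have "?B ?t = \<phi>"
      proof (rule extensionalityI[of _ H])
        fix f assume f: "f \<in> H"
        have "\<phi> f = \<phi> (\<lambda>e. \<Sum>s\<in>UNIV. coord f s * F s e)"
          using F(2)[OF f] by simp
        also have "\<dots> = (\<Sum>s\<in>UNIV. coord f s * \<phi> (F s))"
          by (rule hom_H0_combination(1)[OF h(1) F(1)])
        finally show "?B ?t f = \<phi> f"
          using f by (simp add: hecke_pairing_e1[OF hecke_in_R[OF lin_comb_in_hecke]] lin_comb_e1 mult.commute)
      qed (use h in auto)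
      then show "\<phi> \<in> ?B ` carrier ?A"
        using lin_comb_in_hecke by (intro image_eqI[of _ _ ?t]) auto
    qed (use B in auto)
  qed
qed

lemma hom_lin_comb:
  assumes "\<psi> \<in> hom (add_monoid (hecke_algebra n)) integer_group"
  shows "\<psi> (lin_comb c) = (\<Sum>s\<in>UNIV. c s * \<psi> (hecke_T n (lin s)))"
proof -
  let ?A = "R\<lparr>carrier := carrier (hecke_algebra n)\<rparr>"
  have "add_monoid (hecke_algebra n) = add_monoid ?A"
    by (simp add: hecke_algebra_def)
  with assms have "\<psi> \<in> hom (add_monoid ?A) integer_group"
    by metis
  then show ?thesis
    unfolding lin_comb_eq[OF hecke_subring lin_T_in_hecke]
    by (rule comm_group.hom_integer_combination[OF abelian_subring_group[OF hecke_subring]])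
      (use lin_T_in_hecke in simp_all)
qed

lemma pairing_right_iso:
  "(\<lambda>f. \<lambda>t\<in>carrier (add_monoid (hecke_algebra n)). hecke_pairing \<eta>0 t f)
     \<in> iso (H0 n) (dual_group (add_monoid (hecke_algebra n)))"
proof (rule isoI)
  let ?A = "add_monoid (hecke_algebra n)"
  let ?B = "\<lambda>f. \<lambda>t\<in>carrier ?A. hecke_pairing \<eta>0 t f"
  have val: "?B f t = - t f e1" if "t \<in> carrier ?A" "f \<in> H" for f t
    using that hecke_pairing_e1[OF hecke_in_R] by simp
  have B: "?B f \<in> carrier (dual_group ?A)" if f: "f \<in> H" for f
  proof -
    have "?B f \<in> hom ?A integer_group"
    proof (rule homI)
      fix s t assume st: "s \<in> carrier ?A" "t \<in> carrier ?A"
      have "s \<otimes>\<^bsub>?A\<^esub> t = s \<oplus>\<^bsub>R\<^esub> t"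
        by (simp add: hecke_algebra_def)
      moreover have "s \<oplus>\<^bsub>R\<^esub> t \<in> carrier ?A"
        using subringE(7)[OF hecke_subring] st by simp
      ultimately show "?B f (s \<otimes>\<^bsub>?A\<^esub> t) = ?B f s \<otimes>\<^bsub>integer_group\<^esub> ?B f t"
        using f val[OF _ f] st by simp
    qed simp
    then show ?thesis by (simp add: dual_group_def)
  qed
  have eqI: "\<phi> = \<psi>" if "\<phi> \<in> extensional (carrier ?A)" "\<psi> \<in> extensional (carrier ?A)"
    "\<And>t. t \<in> carrier ?A \<Longrightarrow> \<phi> t = \<psi> t" for \<phi> \<psi> :: "_ \<Rightarrow> int"
    using that by (rule extensionalityI)
  show "?B \<in> hom (H0 n) (dual_group ?A)"
  proof (rule homI)
    fix f g assume fg: "f \<in> H" "g \<in> H"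
    show "?B (f \<otimes>\<^bsub>H0 n\<^esub> g) = ?B f \<otimes>\<^bsub>dual_group ?A\<^esub> ?B g"
    proof (rule eqI)
      fix t assume t: "t \<in> carrier ?A"
      have "?B (f \<otimes>\<^bsub>H0 n\<^esub> g) t = - t (\<lambda>e. f e + g e) e1"
        using val[OF t H0.m_closed[OF fg]] by simp
      also have "\<dots> = ?B f t + ?B g t"
        using t R_add[OF hecke_in_R fg, of t] val[OF t fg(1)] val[OF t fg(2)] by simp
      finally show "?B (f \<otimes>\<^bsub>H0 n\<^esub> g) t = (?B f \<otimes>\<^bsub>dual_group ?A\<^esub> ?B g) t"
        using t by (simp add: dual_group_def)
    qed (simp_all add: dual_group_def)
  qed (rule B)
  show "bij_betw ?B H (carrier (dual_group ?A))"
  proof (rule bij_betw_imageI)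
    show "inj_on ?B H"
    proof (rule inj_onI)
      fix f g assume fg: "f \<in> H" "g \<in> H" "?B f = ?B g"
      show "f = g"
      proof (rule coord_inj[OF fg(1,2)])
        fix s
        have T: "hecke_T n (lin s) \<in> carrier ?A" using lin_T_in_hecke by simp
        show "coord f s = coord g s"
          using fun_cong[OF fg(3), of "hecke_T n (lin s)"] unfolding val[OF T fg(1)] val[OF T fg(2)]
          using fg by (simp add: hecke_T_apply hecke_lin_e1)
      qed
    qed
    show "?B ` H = carrier (dual_group ?A)"
    proof (intro equalityI subsetI)
      fix \<psi> assume "\<psi> \<in> carrier (dual_group ?A)"
      then have h: "\<psi> \<in> hom ?A integer_group" "\<psi> \<in> extensional (carrier ?A)"
        by (simp_all add: dual_group_def)
      obtain F where F: "\<And>s. F s \<in> H" "\<And>f. f \<in> H \<Longrightarrow> f = (\<lambda>e. \<Sum>s\<in>UNIV. coord f s * F s e)"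
        using frame by blast
      \<comment> \<open>The \<open>T_P\<close> span the algebra, so \<open>\<psi>\<close> is known
        from its values on them; these serve as coefficients along the frame.\<close>
      define f where "f = (\<lambda>e. \<Sum>s\<in>UNIV. \<psi> (hecke_T n (lin s)) * F s e)"
      have one_hom: "(\<lambda>f. - \<one>\<^bsub>R\<^esub> f e1) \<in> hom (H0 n) integer_group"
        by (rule hecke_hom) (rule End.one_closed)
      have f: "f \<in> H"
        unfolding f_def by (rule hom_H0_combination(2)[OF one_hom F(1)])
      have "?B f = \<psi>"
      proof (rule eqI)
        fix t assume t: "t \<in> carrier ?A"
        then have t': "t \<in> carrier (hecke_algebra n)" by simp
        have "?B f t = - t f e1" by (rule val[OF t f])
        also have "\<dots> = (\<Sum>s\<in>UNIV. \<psi> (hecke_T n (lin s)) * - t (F s) e1)"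
          unfolding f_def by (rule hom_H0_combination(1)[OF hecke_hom[OF hecke_in_R[OF t']] F(1)])
        also have "\<dots> = \<psi> (lin_comb (\<lambda>s. - t (F s) e1))"
          unfolding hom_lin_comb[OF h(1)] by (simp add: mult.commute)
        also have "lin_comb (\<lambda>s. - t (F s) e1) = t"
          using hecke_eq_lin_comb[OF t' F] by simp
        finally show "?B f t = \<psi> t" .
      qed (use h in auto)
      then show "\<psi> \<in> ?B ` H"
        using f by blast
    qed (use B in auto)
  qed
qed

end

end

theorem theorem1p4:
  fixes n :: "'k::finite_field poly" and \<eta>0 :: "'k \<Rightarrow> complex"
  assumes "lead_coeff n = 1" and "degree n = 3"
    and "nontrivial_character \<eta>0"
  shows
    "((\<nexists>l1 l2 l3. lead_coeff l1 = 1 \<and> lead_coeff l2 = 1 \<and> lead_coeff l3 = 1 \<and>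
          degree l1 = 1 \<and> degree l2 = 1 \<and> degree l3 = 1 \<and>
          distinct [l1, l2, l3] \<and> n = l1 * l2 * l3)
        \<longrightarrow> hecke_algebra n = hecke_algebra0 n)
     \<and>
     ((\<forall>t\<in>carrier (hecke_algebra n). \<forall>f\<in>carrier (H0 n). fourier_coeff \<eta>0 (t f) 1 \<in> \<int>) \<and>
      perfect_pairing (add_monoid (hecke_algebra n)) (H0 n) (hecke_pairing \<eta>0) \<and>
      (\<lambda>t. \<lambda>f\<in>carrier (H0 n). hecke_pairing \<eta>0 t f)
        \<in> iso (add_monoid (hecke_algebra n)) (dual_group (H0 n)) \<and>
      (\<forall>s\<in>carrier (hecke_algebra n). \<forall>t\<in>carrier (hecke_algebra n).
         (\<lambda>f\<in>carrier (H0 n). hecke_pairing \<eta>0 (s \<otimes>\<^bsub>hecke_algebra n\<^esub> t) f) =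
         dual_act (H0 n) s (\<lambda>f\<in>carrier (H0 n). hecke_pairing \<eta>0 t f)))
     \<and>
     generate (add_monoid (End_ring (H0 n)))
        {hecke_T n P | P. lead_coeff P = 1 \<and> prime_elem P \<and> degree P = 1}
       = carrier (hecke_algebra n)"
proof -
  interpret level_three n
    by standard (use assms in auto)
  have "fourier_coeff \<eta>0 (t f) 1 \<in> \<int>" if "t \<in> carrier (hecke_algebra n)" "f \<in> H" for t f
    unfolding fourier_e1[OF assms(3) hecke_in_R[OF that(1)] that(2)] by simp
  \<comment> \<open>Operators act from the right: the product of \<open>s\<close> and
    \<open>t\<close> applies \<open>s\<close> first, so it pairs with \<open>f\<close> as
    \<open>t\<close> pairs with \<open>s f\<close>, which is the dual action of
    \<open>s\<close>.\<close>
  moreover have "(\<lambda>f\<in>H. hecke_pairing \<eta>0 (s \<otimes>\<^bsub>hecke_algebra n\<^esub> t) f) =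
      dual_act (H0 n) s (\<lambda>f\<in>H. hecke_pairing \<eta>0 t f)" if s: "s \<in> carrier (hecke_algebra n)" for s t
  proof (rule extensionalityI[of _ H])
    fix f assume f: "f \<in> H"
    have "(s \<otimes>\<^bsub>hecke_algebra n\<^esub> t) f = t (s f)"
      using f by (simp add: hecke_algebra_def)
    then show "(\<lambda>f\<in>H. hecke_pairing \<eta>0 (s \<otimes>\<^bsub>hecke_algebra n\<^esub> t) f) f =
        dual_act (H0 n) s (\<lambda>f\<in>H. hecke_pairing \<eta>0 t f) f"
      using f R_closed[OF hecke_in_R[OF s] f] by (simp add: dual_act_def hecke_pairing_def)
  qed (simp_all add: dual_act_def)
  ultimately show ?thesis
    using hecke_algebra_eq_hecke_algebra0 generate_lin pairing_left_iso[OF assms(3)]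
      pairing_right_iso[OF assms(3)]
    unfolding linear_prime_hecke_operators perfect_pairing_def by simp
qed

end
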